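(* Let $X,Y$ be rearrangement-invariant Banach function spaces on $\mathbb{T}$ such that $X\subset Y$ and $Y$ has nontrivial Boyd indices. Suppose $a\in M(X,Y)$ and consider the Toeplitz operator $T_a:H[X]\to H[Y]$, $T_af=P(af)$. Then the measure of noncompactness of $T_a$ satisfies $$\alpha(T_a)\ge m_Y\max_{n\in\mathbb{Z}}|\widehat a(n)|,$$ where $m_Y>0$ is a constant of the inclusion $Y\subset L^1$, i.e. $\|f\|_Y\ge m_Y\|f\|_{L^1}$ for all $f\in Y$. In particular, the operator $T_a:H[X]\to H[Y]$ is compact if and only if $a=0$.
   Context: $\mathbb{T}$ is the unit circle with normalized Lebesgue measure $m$; $L^0$ is the space of a.e. finite measurable complex functions on $\mathbb{T}$ (modulo a.e. equality). A Banach function space (B.f.s.) is a complex Banach space $X\subset L^0$ such that (a) $f\in X$, $g\in L^0$, $|g|\le|f|$ a.e. imply $g\in X$, $\|g\|_X\le\|f\|_X$; (b) $L^\infty\subset X$; (c) $f_n,f\in X$, $0\le f_n\uparrow f$ a.e. imply $\|f\|_X=\sup_n\|f_n\|_X$. $X$ is rearrangement-invariant (r.i.) if whenever $f\in X$ and $g\in L^0$ are equimeasurable (i.e. $m\{|f|>\lambda\}=m\{|g|>\lambda\}$ for all $\lambda\ge0$), then $g\in X$ and $\|f\|_X=\|g\|_X$; every r.i. B.f.s. satisfies $X\subset L^1$ continuously. Boyd indices: for $s>0$ let $(D_sf)(e^{i\theta})=f(e^{i\theta s})$ if $\theta s\in[0,2\pi)$ and $0$ otherwise ($\theta\in[0,2\pi)$);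 $\alpha_X=\lim_{s\to0}\frac{\log\|D_{1/s}\|_{X\to X}}{\log s}$, $\beta_X=\lim_{s\to\infty}\frac{\log\|D_{1/s}\|_{X\to X}}{\log s}$. They are nontrivial if $\alpha_X,\beta_X\in(0,1)$. $M(X,Y)=\{f\in L^0: fg\in Y\text{ for all }g\in X\}$ with $\|f\|_{M(X,Y)}=\sup_{\|g\|_X\le1}\|fg\|_Y$. $\langle f,g\rangle=\int_{\mathbb{T}}f\overline{g}\,dm$, $\chi_n(t)=t^n$ for $n\in\mathbb{Z}$, $\widehat f(n)=\langle f,\chi_n\rangle$. $H[X]=\{f\in X:\widehat f(n)=0\text{ for all }n<0\}$ with the norm of $X$. $P$ is the Riesz projection, $Pf=\frac12(f+i\tilde f+\widehat f(0))$ for $f\in L^1$, where $\tilde f$ is the conjugate function of $f$ (for $f\in L^p$, $p>1$, $P$ maps $\sum_{n\in\mathbb{Z}}\widehat f(n)t^n$ to $\sum_{n\ge0}\widehat f(n)t^n$); $P$ is bounded on an r.i. B.f.s. iff its Boyd indices are nontrivial. The measure of noncompactness of a set $A$ in a Banach space is $\alpha(A)=\inf\{\delta>0:A\subset\bigcup_{k=1}^NB_k\text{ for some }N<\infty\text{ and sets }B_k\text{ with }\operatorname{diam}(B_k)\le\delta\}$; for an operator $T:E\to F$ between Banach spaces, $\alpha(T)$ is the measure of noncompactness in $F$ of the image under $T$ of the unit ball of $E$.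
   Formalization: The bound is proved as α(T_a) ≥ (m_Y/‖1‖_X) max|â(n)|, so as stated when ‖1‖_X = 1; without normalising the norm of X it fails (X = L² with norm 10‖·‖₂, Y = L², a = 1, m_Y = 1: α(T_a) ≤ 1/5). The compactness part needs no normalisation. *)

theory Defs
  imports "HOL-Analysis.Analysis"
begin

(* Elements of L^0 are represented by functions "complex \<Rightarrow> complex" that are measurable for
   circle_measure.  Only their values on the unit circle matter, and two representatives that
   agree almost everywhere denote the same element of L^0. *)

definition circle_measure :: "complex measure" where
  "circle_measure =
     completion (distr (uniform_measure lborel {0..<2*pi}) (restrict_space borel (sphere 0 1)) cis)"

abbreviation L0 :: "(complex \<Rightarrow> complex) set" where
  "L0 \<equiv> borel_measurable circle_measure"

(* X is closed under a.e. equality and N is constant on a.e. classes by "ideal", so X with N is a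
   Banach space after identifying a.e. equal functions. In "fatou" the nonnegative functions are
   given by real-valued representatives. *)
locale banach_function_space =
  fixes X :: "(complex \<Rightarrow> complex) set" and N :: "(complex \<Rightarrow> complex) \<Rightarrow> real"
  assumes sub_L0: "X \<subseteq> L0"
    and add_mem: "\<lbrakk>f \<in> X; g \<in> X\<rbrakk> \<Longrightarrow> (\<lambda>t. f t + g t) \<in> X"
    and scale_mem: "f \<in> X \<Longrightarrow> (\<lambda>t. c * f t) \<in> X"
    and norm_nonneg: "f \<in> X \<Longrightarrow> 0 \<le> N f"
    and norm_eq_0: "f \<in> X \<Longrightarrow> N f = 0 \<longleftrightarrow> (AE t in circle_measure. f t = 0)"
    and norm_triangle: "\<lbrakk>f \<in> X; g \<in> X\<rbrakk> \<Longrightarrow> N (\<lambda>t. f t + g t) \<le> N f + N g"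
    and norm_scale: "f \<in> X \<Longrightarrow> N (\<lambda>t. c * f t) = cmod c * N f"
    and complete: "\<And>F :: nat \<Rightarrow> complex \<Rightarrow> complex.
        \<lbrakk>\<And>n. F n \<in> X; \<And>e. e > 0 \<Longrightarrow> \<exists>k. \<forall>m\<ge>k. \<forall>n\<ge>k. N (\<lambda>t. F m t - F n t) < e\<rbrakk>
          \<Longrightarrow> \<exists>f\<in>X. (\<lambda>n. N (\<lambda>t. F n t - f t)) \<longlonglongrightarrow> 0"
    and ideal: "\<lbrakk>f \<in> X; g \<in> L0; AE t in circle_measure. cmod (g t) \<le> cmod (f t)\<rbrakk>
          \<Longrightarrow> g \<in> X \<and> N g \<le> N f"
    and Linfty_sub: "\<lbrakk>f \<in> L0; \<exists>C. AE t in circle_measure. cmod (f t) \<le> C\<rbrakk> \<Longrightarrow> f \<in> X"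
    and fatou: "\<And>(F :: nat \<Rightarrow> complex \<Rightarrow> real) f.
        \<lbrakk>\<And>n. (\<lambda>t. complex_of_real (F n t)) \<in> X; (\<lambda>t. complex_of_real (f t)) \<in> X;
          AE t in circle_measure. (\<forall>n. 0 \<le> F n t) \<and> incseq (\<lambda>n. F n t) \<and> (\<lambda>n. F n t) \<longlonglongrightarrow> f t\<rbrakk>
          \<Longrightarrow> N (\<lambda>t. complex_of_real (f t)) = (SUP n. N (\<lambda>t. complex_of_real (F n t)))"

definition equimeasurable :: "(complex \<Rightarrow> complex) \<Rightarrow> (complex \<Rightarrow> complex) \<Rightarrow> bool" where
  "equimeasurable f g \<longleftrightarrow>
     (\<forall>c\<ge>0. measure circle_measure {t \<in> space circle_measure. cmod (f t) > c} =
             measure circle_measure {t \<in> space circle_measure. cmod (g t) > c})"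

locale ri_banach_function_space = banach_function_space +
  assumes rearrangement_invariant:
    "\<lbrakk>f \<in> X; g \<in> L0; equimeasurable f g\<rbrakk> \<Longrightarrow> g \<in> X \<and> N f = N g"

definition dilation :: "real \<Rightarrow> (complex \<Rightarrow> complex) \<Rightarrow> complex \<Rightarrow> complex" where
  "dilation s f t = (if Arg2pi t * s < 2 * pi then f (cis (Arg2pi t * s)) else 0)"

definition op_norm ::
    "(complex \<Rightarrow> complex) set \<Rightarrow> ((complex \<Rightarrow> complex) \<Rightarrow> real) \<Rightarrow>
     ((complex \<Rightarrow> complex) \<Rightarrow> complex \<Rightarrow> complex) \<Rightarrow> ennreal" where
  "op_norm X N T = (SUP f \<in> {f \<in> X. N f \<le> 1}. ennreal (N (T f)))"

(* For a rearrangement-invariant space both limits always exist. *)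
definition has_boyd_indices ::
    "(complex \<Rightarrow> complex) set \<Rightarrow> ((complex \<Rightarrow> complex) \<Rightarrow> real) \<Rightarrow> real \<Rightarrow> real \<Rightarrow> bool" where
  "has_boyd_indices X N \<alpha> \<beta> \<longleftrightarrow>
     ((\<lambda>s. ln (enn2real (op_norm X N (dilation (1 / s)))) / ln s) \<longlongrightarrow> \<alpha>) (at_right 0) \<and>
     ((\<lambda>s. ln (enn2real (op_norm X N (dilation (1 / s)))) / ln s) \<longlongrightarrow> \<beta>) at_top"

definition nontrivial_boyd_indices ::
    "(complex \<Rightarrow> complex) set \<Rightarrow> ((complex \<Rightarrow> complex) \<Rightarrow> real) \<Rightarrow> bool" where
  "nontrivial_boyd_indices X N \<longleftrightarrow>
     (\<exists>\<alpha> \<beta>. has_boyd_indices X N \<alpha> \<beta> \<and> \<alpha> \<in> {0<..<1} \<and> \<beta> \<in> {0<..<1})"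

definition multipliers ::
    "(complex \<Rightarrow> complex) set \<Rightarrow> (complex \<Rightarrow> complex) set \<Rightarrow> (complex \<Rightarrow> complex) set" where
  "multipliers X Y = {f \<in> L0. \<forall>g\<in>X. (\<lambda>t. f t * g t) \<in> Y}"

definition pairing :: "(complex \<Rightarrow> complex) \<Rightarrow> (complex \<Rightarrow> complex) \<Rightarrow> complex" where
  "pairing f g = (LINT t|circle_measure. f t * cnj (g t))"

definition circle_char :: "int \<Rightarrow> complex \<Rightarrow> complex" where
  "circle_char n t = t powi n"

definition fourier_coeff :: "(complex \<Rightarrow> complex) \<Rightarrow> int \<Rightarrow> complex" where
  "fourier_coeff f n = pairing f (circle_char n)"

definition hardy :: "(complex \<Rightarrow> complex) set \<Rightarrow> (complex \<Rightarrow> complex) set" where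
  "hardy X = {f \<in> X. \<forall>n<0. fourier_coeff f n = 0}"

(* The harmonic conjugate, vanishing at 0, of the Poisson integral of f, evaluated at r t.
   For z = r exp(i x), Im ((1 + z) / (1 - z)) is the conjugate Poisson kernel
   2 r sin x / (1 - 2 r cos x + r^2). *)
definition conjugate_poisson :: "(complex \<Rightarrow> complex) \<Rightarrow> real \<Rightarrow> complex \<Rightarrow> complex" where
  "conjugate_poisson f r t =
     (LINT u|circle_measure.
        complex_of_real (Im ((1 + of_real r * t * cnj u) / (1 - of_real r * t * cnj u))) * f u)"

(* For integrable f the radial limit exists for almost every t in the circle. *)
definition conjugate_function :: "(complex \<Rightarrow> complex) \<Rightarrow> complex \<Rightarrow> complex" where
  "conjugate_function f t = Lim (at_left 1) (\<lambda>r. conjugate_poisson f r t)"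

definition riesz_projection :: "(complex \<Rightarrow> complex) \<Rightarrow> complex \<Rightarrow> complex" where
  "riesz_projection f t = (f t + \<i> * conjugate_function f t + fourier_coeff f 0) / 2"

definition toeplitz :: "(complex \<Rightarrow> complex) \<Rightarrow> (complex \<Rightarrow> complex) \<Rightarrow> complex \<Rightarrow> complex" where
  "toeplitz a f = riesz_projection (\<lambda>t. a t * f t)"

(* Subsets of a normed space F (of functions, with norm NF). The infimum is taken in [0, \<infinity>], so
   that it is \<infinity> if there is no admissible cover. *)
definition noncompactness ::
    "(complex \<Rightarrow> complex) set \<Rightarrow> ((complex \<Rightarrow> complex) \<Rightarrow> real) \<Rightarrow>
     (complex \<Rightarrow> complex) set \<Rightarrow> ennreal" where
  "noncompactness F NF A =
     Inf {ennreal \<delta> |\<delta>. \<delta> > 0 \<and>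
       (\<exists>\<B>. finite \<B> \<and> A \<subseteq> \<Union>\<B> \<and>
          (\<forall>B\<in>\<B>. B \<subseteq> F \<and> (\<forall>f\<in>B. \<forall>g\<in>B. NF (\<lambda>t. f t - g t) \<le> \<delta>)))}"

definition op_noncompactness ::
    "(complex \<Rightarrow> complex) set \<Rightarrow> ((complex \<Rightarrow> complex) \<Rightarrow> real) \<Rightarrow>
     (complex \<Rightarrow> complex) set \<Rightarrow> ((complex \<Rightarrow> complex) \<Rightarrow> real) \<Rightarrow>
     ((complex \<Rightarrow> complex) \<Rightarrow> complex \<Rightarrow> complex) \<Rightarrow> ennreal" where
  "op_noncompactness E NE F NF T = noncompactness F NF (T ` {f \<in> E. NE f \<le> 1})"

definition compact_operator ::
    "(complex \<Rightarrow> complex) set \<Rightarrow> ((complex \<Rightarrow> complex) \<Rightarrow> real) \<Rightarrow>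
     (complex \<Rightarrow> complex) set \<Rightarrow> ((complex \<Rightarrow> complex) \<Rightarrow> real) \<Rightarrow>
     ((complex \<Rightarrow> complex) \<Rightarrow> complex \<Rightarrow> complex) \<Rightarrow> bool" where
  "compact_operator E NE F NF T \<longleftrightarrow>
     T ` E \<subseteq> F \<and>
     (\<forall>f :: nat \<Rightarrow> complex \<Rightarrow> complex. (\<forall>n. f n \<in> E) \<and> (\<exists>C. \<forall>n. NE (f n) \<le> C) \<longrightarrow>
        (\<exists>r g. strict_mono r \<and> g \<in> F \<and> (\<lambda>n. NF (\<lambda>t. T (f (r n)) t - g t)) \<longlonglongrightarrow> 0))"

(* Stated with the nonnegative integral, which is \<infinity> for non-integrable f, so that the inequality
   includes the inclusion of Y in L^1. *)
definition L1_inclusion_constant ::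
    "(complex \<Rightarrow> complex) set \<Rightarrow> ((complex \<Rightarrow> complex) \<Rightarrow> real) \<Rightarrow> real \<Rightarrow> bool" where
  "L1_inclusion_constant Y N c \<longleftrightarrow>
     c > 0 \<and> (\<forall>f\<in>Y. ennreal c * (\<integral>\<^sup>+ t. ennreal (cmod (f t)) \<partial>circle_measure) \<le> ennreal (N f))"

end

theory Submission
  imports Defs "HOL-Complex_Analysis.Cauchy_Integral_Formula" "HOL-Probability.Probability_Measure"
begin

text \<open>
  The \<open>j\<close>-th Fourier coefficient of \<open>T\<^sub>a \<chi>\<^sub>n\<close> is the \<open>(j - n)\<close>-th coefficient of \<open>a\<close> for \<open>j \<ge> 0\<close>. Hence, for
  \<open>n + k \<ge> 0\<close>, the \<open>(n + k)\<close>-th coefficient of \<open>T\<^sub>a \<chi>\<^sub>n - T\<^sub>a \<chi>\<^sub>m\<close> is the difference of the coefficients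
  of \<open>a\<close> at \<open>k\<close> and at \<open>k + n - m\<close>, and the latter tends to \<open>0\<close> as \<open>m \<rightarrow> \<infinity>\<close> by the Riemann--Lebesgue lemma.
  The embedding of \<open>Y\<close> in \<open>L^1\<close> turns this into a lower bound for the mutual distances of infinitely many of
  the functions \<open>T\<^sub>a \<chi>\<^sub>n\<close>, which by the pigeonhole principle bounds the diameter of one member of any finite
  cover.

  The analytic input is the computation of the Fourier coefficients of the Riesz projection, which is
  defined by radial limits. As the upper Boyd index of \<open>Y\<close> is less than \<open>1\<close>, \<open>Y\<close> lies in some \<open>L^p\<close> with
  \<open>1 < p < 2\<close>. By the M. Riesz inequality the Cauchy integrals of an \<open>L^p\<close> function \<open>f\<close> on the circles of
  radius \<open>r\<close> form a Cauchy family in \<open>L^1\<close> as \<open>r \<rightarrow> 1\<close>. They are the Poisson integrals of their limit,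
  so Fatou's theorem identifies the radial limit with the \<open>L^1\<close> limit, whose coefficients are visible.
\<close>

subsection \<open>Lebesgue measure on the circle\<close>

text \<open>The obstacle is that the radial limits defining \<open>riesz_projection\<close> exist
  a.e. for every integrable function, while the resulting function may fail to be integrable, and
  the integral of a non-integrable function is 0 by convention. A Fourier coefficient of
  \<open>toeplitz a\<close> applied to a character therefore carries information only once that
  function is known to be integrable. This is why an exponent p > 1 has to be extracted from the
  Boyd index. The bound p < 2 keeps p \<theta> between pi/2 and pi for \<theta> close to pi/2, where
  the cosine is negative and decreasing. The factor \<open>1 / NX (\<lambda>_. 1)\<close> in the
  conclusion is a normalisation: all characters are equimeasurable with the constant 1, so they
  share its norm, and division by that norm puts them on the unit sphere of \<open>hardy X\<close>.
  The witness \<open>k\<close> stands for the index of the maximal coefficient, which exists because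
  the coefficients tend to 0.\<close>

abbreviation \<mu> :: "complex measure" where
  "\<mu> \<equiv> circle_measure"

lemma cis_measurable_circle:
  "cis \<in> measurable (uniform_measure lborel {0..<2*pi}) (restrict_space borel (sphere 0 1))"
proof (rule measurable_restrict_space2)
  show "cis \<in> space (uniform_measure lborel {0..<2*pi}) \<rightarrow> sphere 0 1" by auto
  have "continuous_on UNIV cis" by (intro continuous_intros)
  then have "cis \<in> borel_measurable borel" by (rule borel_measurable_continuous_onI)
  then show "cis \<in> borel_measurable (uniform_measure lborel {0..<2*pi})" by simp
qed

lemma cis_borel [measurable]: "cis \<in> borel_measurable borel"
  by (intro borel_measurable_continuous_onI continuous_intros)

lemma space_circle [simp]: "space \<mu> = sphere 0 1"
  by (simp add: circle_measure_def space_restrict_space)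

lemma prob_space_circle: "prob_space \<mu>"
proof -
  have "prob_space (uniform_measure lborel {0..<2*pi})"
    by (rule prob_space_uniform_measure) auto
  then have *: "prob_space (distr (uniform_measure lborel {0..<2*pi}) (restrict_space borel (sphere 0 1)) cis)"
    using cis_measurable_circle by (rule prob_space.prob_space_distr)
  show ?thesis
    unfolding circle_measure_def using * by (rule prob_space.prob_space_completion)
qed

interpretation circle: prob_space \<mu>
  by (rule prob_space_circle)

lemma borel_measurable_circle:
  assumes "f \<in> measurable borel M"
  shows "f \<in> measurable \<mu> M"
proof -
  have "f \<in> measurable (restrict_space borel (sphere 0 1)) M"
    using assms by (rule measurable_restrict_space1)
  then show ?thesis
    unfolding circle_measure_def by (intro measurable_completion) simp
qed

lemma id_circle_measurable: "(\<lambda>t. t) \<in> borel_measurable \<mu>"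
  by (rule borel_measurable_circle) simp

lemma nn_integral_circle:
  assumes [measurable]: "f \<in> borel_measurable borel"
  shows "(\<integral>\<^sup>+ t. f t \<partial>\<mu>) =
     (\<integral>\<^sup>+ \<theta>. f (cis \<theta>) * indicator {0..<2*pi} \<theta> \<partial>lborel) / ennreal (2*pi)"
proof -
  have "(\<integral>\<^sup>+ t. f t \<partial>\<mu>) = (\<integral>\<^sup>+ \<theta>. f (cis \<theta>) \<partial>(uniform_measure lborel {0..<2*pi}))"
    unfolding circle_measure_def nn_integral_completion
    by (rule nn_integral_distr[OF cis_measurable_circle]) (auto intro: measurable_restrict_space1)
  also have "\<dots> = (\<integral>\<^sup>+ \<theta>. f (cis \<theta>) * indicator {0..<2*pi} \<theta> \<partial>lborel) / ennreal (2*pi)"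
    by (subst nn_integral_uniform_measure) (auto simp: )
  finally show ?thesis .
qed

lemma emeasure_circle:
  assumes [measurable]: "A \<in> sets borel"
  shows "emeasure \<mu> (A \<inter> sphere 0 1) =
     emeasure lborel ({0..<2*pi} \<inter> cis -` A) / ennreal (2*pi)"
proof -
  have [measurable]: "A \<inter> sphere 0 1 \<in> sets \<mu>"
    using measurable_sets[OF id_circle_measurable assms] by (simp add: vimage_def Int_commute Collect_conj_eq)
  have "emeasure \<mu> (A \<inter> sphere 0 1) = (\<integral>\<^sup>+ t. indicator (A \<inter> sphere 0 1) t \<partial>\<mu>)"
    by simp
  also have "\<dots> = (\<integral>\<^sup>+ t. indicator A t \<partial>\<mu>)"
    by (rule nn_integral_cong) (auto simp: indicator_def)
  also have "\<dots> = (\<integral>\<^sup>+ \<theta>. indicator A (cis \<theta>) * indicator {0..<2*pi} \<theta> \<partial>lborel) / ennreal (2*pi)"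
    by (rule nn_integral_circle) simp
  also have "(\<integral>\<^sup>+ \<theta>. indicator A (cis \<theta>) * indicator {0..<2*pi} \<theta> \<partial>lborel)
     = (\<integral>\<^sup>+ \<theta>. indicator ({0..<2*pi} \<inter> cis -` A) \<theta> \<partial>lborel)"
    by (rule nn_integral_cong) (auto simp: indicator_def)
  also have "\<dots> = emeasure lborel ({0..<2*pi} \<inter> cis -` A)"
    using measurable_sets_borel[OF cis_borel assms] by (intro nn_integral_indicator) auto
  finally show ?thesis .
qed

lemma integrable_circle_bounded:
  fixes f :: "complex \<Rightarrow> 'a::{banach, second_countable_topology}"
  assumes "f \<in> borel_measurable \<mu>" "\<And>t. norm t = 1 \<Longrightarrow> norm (f t) \<le> B"
  shows "integrable \<mu> f"
  by (rule circle.integrable_const_bound[where B = B]) (use assms in \<open>auto intro!: AE_I2\<close>)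

lemma integral_powi_circle:
  "(\<integral>t. t powi n \<partial>\<mu>) = (if n = 0 then 1 else (0::complex))"
proof (cases "n = 0")
  case True
  then show ?thesis using circle.prob_space by simp
next
  case False
  have [measurable]: "(\<lambda>\<theta>::real. cis (of_int n * \<theta>)) \<in> borel_measurable borel"
    by (intro borel_measurable_continuous_onI continuous_intros)
  have m: "(\<lambda>t::complex. t powi n) \<in> borel_measurable borel"
    unfolding power_int_def by measurable
  have "(\<integral>t. t powi n \<partial>\<mu>) = (\<integral>\<theta>. cis \<theta> powi n \<partial>(uniform_measure lborel {0..<2*pi}))"
    unfolding circle_measure_def
    apply (subst integral_completion)
     apply (simp add: measurable_restrict_space1 m)
    apply (subst integral_distr[OF cis_measurable_circle])
     apply (auto intro!: measurable_restrict_space1 m)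
    done
  also have "uniform_measure lborel {0..<2*pi} = density lborel (\<lambda>x. ennreal (indicator {0..<2*pi} x / (2*pi)))"
    unfolding uniform_measure_def
    by (intro density_cong) (auto simp: indicator_def divide_ennreal simp flip: ennreal_1)
  also have "(\<integral>\<theta>. cis \<theta> powi n \<partial>density lborel (\<lambda>x. ennreal (indicator {0..<2*pi} x / (2*pi)))) =
    (\<integral>\<theta>. (indicator {0..<2*pi} \<theta> / (2*pi)) *\<^sub>R cis \<theta> powi n \<partial>lborel)"
    by (subst integral_density) (auto simp: indicator_def cis_power_int)
  \<comment> \<open>The right end point is a null set; adding it gives the closed interval on which
    the fundamental theorem of calculus is formulated.\<close>
  also have "\<dots> = (\<integral>\<theta>. inverse (2*pi) *\<^sub>R (indicator {0..2*pi} \<theta> *\<^sub>R cis (of_int n * \<theta>)) \<partial>lborel)"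
  proof (rule integral_cong_AE)
    show "AE \<theta> in lborel. (indicator {0..<2*pi} \<theta> / (2*pi)) *\<^sub>R cis \<theta> powi n =
       inverse (2*pi) *\<^sub>R (indicator {0..2*pi} \<theta> *\<^sub>R cis (of_int n * \<theta>))"
      using AE_lborel_singleton[of "2*pi"]
      by eventually_elim (auto simp: indicator_def cis_power_int field_simps)
  qed (simp_all add: cis_power_int)
  also have "\<dots> = inverse (2*pi) *\<^sub>R (\<integral>\<theta>. indicator {0..2*pi} \<theta> *\<^sub>R cis (of_int n * \<theta>) \<partial>lborel)"
    by (rule integral_scaleR_right)
  also have "(\<integral>\<theta>. indicator {0..2*pi} \<theta> *\<^sub>R cis (of_int n * \<theta>) \<partial>lborel) =
      cis (of_int n * (2*pi)) / (\<i> * of_int n) - cis (of_int n * 0) / (\<i> * of_int n)"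
  proof (rule integral_FTC_Icc)
    fix x :: real
    have "((\<lambda>\<theta>. cis (of_int n * \<theta>)) has_derivative (\<lambda>t. (of_int n * t) *\<^sub>R (\<i> * cis (of_int n * x)))) (at x within {0..2*pi})"
      by (auto intro!: derivative_eq_intros)
    then have "((\<lambda>\<theta>. cis (of_int n * \<theta>)) has_vector_derivative of_int n *\<^sub>R (\<i> * cis (of_int n * x))) (at x within {0..2*pi})"
      by (simp add: has_vector_derivative_def mult.commute)
    then have "((\<lambda>\<theta>. cis (of_int n * \<theta>) / (\<i> * of_int n)) has_vector_derivative (of_int n *\<^sub>R (\<i> * cis (of_int n * x))) / (\<i> * of_int n)) (at x within {0..2*pi})"
      by (rule has_vector_derivative_divide)
    then show "((\<lambda>\<theta>. cis (of_int n * \<theta>) / (\<i> * of_int n)) has_vector_derivative cis (of_int n * x)) (at x within {0..2*pi})"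
      using False by (simp add: scaleR_conv_of_real)
  qed (auto intro!: continuous_intros)
  also have "cis (of_int n * (2*pi)) = 1"
    using cis_multiple_2pi[of "of_int n"] by (simp add: mult_ac)
  finally show ?thesis using False by simp
qed

section \<open>Arc length against chord length, and the doubling property of arcs\<close>

lemma sin_ge_half:
  assumes "0 \<le> x" "x \<le> pi/2"
  shows "x / 2 \<le> sin x"
\<comment> \<open>Up to pi/3 the cosine is at least 1/2, so the mean value theorem gives slope at
  least 1/2. Beyond pi/3 the sine is at least sqrt 3 / 2, hence at least 0.8, while x/2 is at most
  pi/4.\<close>
proof (cases "x \<le> pi/3")
  case True
  show ?thesis
  proof (cases "x = 0")
    case False
    then have "0 < x" using assms by simp
    then obtain z where z: "0 < z" "z < x" "sin x - sin 0 = (x - 0) * cos z"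
      using MVT2[of 0 x sin cos] DERIV_sin by blast
    have "cos (pi/3) \<le> cos z"
      by (rule cos_monotone_0_pi_le) (use z True pi_gt3 in auto)
    then have "1/2 \<le> cos z" by (simp add: cos_60)
    then have "x * (1/2) \<le> x * cos z" using assms by (intro mult_left_mono) auto
    then show ?thesis using z by simp
  qed simp
next
  case False
  have "sin (pi/3) \<le> sin x"
    by (rule sin_monotone_2pi_le) (use assms False pi_gt3 in auto)
  then have "sqrt 3 / 2 \<le> sin x" by (simp add: sin_60)
  moreover have "1.6 \<le> sqrt 3" by (rule real_le_rsqrt) (simp add: power2_eq_square)
  moreover have "pi < 3.15" using pi_approx by simp
  ultimately show ?thesis using assms by simp
qed

lemma dist_cis: "dist (cis x) (cis y) = 2 * \<bar>sin ((x - y) / 2)\<bar>"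
proof -
  have "cis x - cis y = cis y * (cis (x - y) - 1)"
    by (simp add: algebra_simps cis_mult)
  then have "dist (cis x) (cis y) = cmod (cis (x - y) - 1)"
    by (simp add: dist_norm norm_mult)
  then show ?thesis using dist_exp_i_1[of "x - y"] by (simp add: cis_conv_exp)
qed

lemma dist_cis_le: "dist (cis x) (cis y) \<le> \<bar>x - y\<bar>"
  using abs_sin_x_le_abs_x[of "(x - y) / 2"] by (simp add: dist_cis)

lemma emeasure_circle_ball_ge:
  assumes "cmod a = 1" "0 < r"
  shows "ennreal (min r pi / (2*pi)) \<le> emeasure \<mu> (ball a r \<inter> sphere 0 1)"
proof -
  define x where "x = Arg2pi a"
  have x: "0 \<le> x" "x < 2*pi" "a = cis x"
    using Arg2pi[of a] assms by (auto simp: x_def is_Arg_def cis_conv_exp)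
  \<comment> \<open>A two-sided interval of angles around x could leave [0, 2 pi). A one-sided
    interval of length \<open>min r pi\<close> fits: to the right of x if x is at most pi, to the
    left otherwise.\<close>
  obtain l where l: "0 \<le> l" "l + min r pi \<le> 2*pi" "\<And>y. l < y \<Longrightarrow> y < l + min r pi \<Longrightarrow> \<bar>x - y\<bar> < r"
  proof (cases "x \<le> pi")
    case True
    show ?thesis by (rule that[of x]) (use x True assms in auto)
  next
    case False
    show ?thesis by (rule that[of "x - min r pi"]) (use x False assms in auto)
  qed
  have "{l<..<l + min r pi} \<subseteq> {0..<2*pi} \<inter> cis -` ball a r"
  proof
    fix y assume y: "y \<in> {l<..<l + min r pi}"
    then have "\<bar>x - y\<bar> < r" using l(3) by auto
    then have "dist (cis x) (cis y) < r" using dist_cis_le[of x y] by linarith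
    then show "y \<in> {0..<2*pi} \<inter> cis -` ball a r"
      using l(1,2) y x by auto
  qed
  then have "emeasure lborel {l<..<l + min r pi} \<le> emeasure lborel ({0..<2*pi} \<inter> cis -` ball a r)"
    using measurable_sets_borel[OF cis_borel, of "ball a r"] by (intro emeasure_mono) auto
  then have "ennreal (min r pi) \<le> emeasure lborel ({0..<2*pi} \<inter> cis -` ball a r)"
    using assms by (simp add: emeasure_lborel_Ioo)
  then have "ennreal (min r pi) / ennreal (2*pi) \<le> emeasure \<mu> (ball a r \<inter> sphere 0 1)"
    by (simp add: emeasure_circle divide_right_mono_ennreal)
  then show ?thesis using assms by (simp add: divide_ennreal)
qed

lemma emeasure_circle_ball_le:
  assumes "cmod a = 1" "0 < r"
  shows "emeasure \<mu> (ball a r \<inter> sphere 0 1) \<le> ennreal (8 * r / (2*pi))"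
proof -
  define x where "x = Arg2pi a"
  have x: "0 \<le> x" "x < 2*pi" "a = cis x"
    using Arg2pi[of a] assms by (auto simp: x_def is_Arg_def cis_conv_exp)
  \<comment> \<open>Angles near x contribute an interval of length 4 r. The other two intervals, of
    length 2 r each, catch the wrap-around at angle 0, where y is close to x + 2 pi or to x - 2 pi.
    The total length is 8 r.\<close>
  have "{0..<2*pi} \<inter> cis -` ball a r \<subseteq> {x - 2*r..x + 2*r} \<union> ({x + 2*pi - 2*r..x + 2*pi} \<union> {x - 2*pi..x - 2*pi + 2*r})"
  proof
    fix y assume y: "y \<in> {0..<2*pi} \<inter> cis -` ball a r"
    then have d: "2 * \<bar>sin ((x - y) / 2)\<bar> < r" using x by (auto simp: dist_cis)
    define w where "w = \<bar>x - y\<bar> / 2"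
    have "sin ((y - x) / 2) = - sin ((x - y) / 2)"
      using sin_minus[of "(x - y) / 2"] by (simp only: minus_divide_left minus_diff_eq)
    then have "\<bar>sin ((x - y) / 2)\<bar> = \<bar>sin w\<bar>"
      by (cases "y \<le> x") (simp_all add: w_def)
    with d have dw: "2 * \<bar>sin w\<bar> < r" by simp
    have w: "0 \<le> w" "w < pi" using x y by (auto simp: w_def)
    show "y \<in> {x - 2*r..x + 2*r} \<union> ({x + 2*pi - 2*r..x + 2*pi} \<union> {x - 2*pi..x - 2*pi + 2*r})"
    proof (cases "w \<le> pi/2")
      case True
      then have "w < r" using sin_ge_half[of w] w dw by auto
      then show ?thesis by (auto simp: w_def abs_if split: if_splits)
    next
      case False
      then have "(pi - w) / 2 \<le> sin (pi - w)" by (intro sin_ge_half) (use w in auto)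
      then have "pi - w < r" using dw by (auto simp: sin_pi_minus)
      then show ?thesis using x y by (auto simp: w_def abs_if field_simps split: if_splits)
    qed
  qed
  then have "emeasure lborel ({0..<2*pi} \<inter> cis -` ball a r) \<le>
     emeasure lborel ({x - 2*r..x + 2*r} \<union> ({x + 2*pi - 2*r..x + 2*pi} \<union> {x - 2*pi..x - 2*pi + 2*r}))"
    by (rule emeasure_mono) simp
  also have "\<dots> \<le> emeasure lborel {x - 2*r..x + 2*r} + emeasure lborel ({x + 2*pi - 2*r..x + 2*pi} \<union> {x - 2*pi..x - 2*pi + 2*r})"
    by (rule emeasure_subadditive) auto
  also have "\<dots> \<le> emeasure lborel {x - 2*r..x + 2*r} + (emeasure lborel {x + 2*pi - 2*r..x + 2*pi} + emeasure lborel {x - 2*pi..x - 2*pi + 2*r})"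
    by (intro add_left_mono emeasure_subadditive) auto
  also have "\<dots> = ennreal (8 * r)"
    using assms by (simp flip: ennreal_plus)
  finally have "emeasure \<mu> (ball a r \<inter> sphere 0 1) \<le> ennreal (8 * r) / ennreal (2*pi)"
    by (simp add: emeasure_circle divide_right_mono_ennreal)
  then show ?thesis using assms by (simp add: divide_ennreal)
qed

lemma sets_circle_Int: "A \<in> sets borel \<Longrightarrow> A \<inter> sphere 0 1 \<in> sets \<mu>"
  using measurable_sets[OF id_circle_measurable] by (simp add: vimage_def Int_commute Collect_conj_eq)

text \<open>The enlargement 5 is the one of the Vitali covering lemma. Up to radius pi the two
  estimates for arcs differ by the factor 8 * 5 = 40; for larger radii the small disc already
  carries half of the total mass.\<close>

lemma circle_doubling:
  assumes "cmod a = 1" "0 < r"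
  shows "measure \<mu> (ball a (5 * r) \<inter> sphere 0 1) \<le> 40 * measure \<mu> (ball a r \<inter> sphere 0 1)"
proof -
  have ge: "min r pi / (2*pi) \<le> measure \<mu> (ball a r \<inter> sphere 0 1)"
    using emeasure_circle_ball_ge[OF assms] assms by (simp add: circle.emeasure_eq_measure)
  have le: "measure \<mu> (ball a (5*r) \<inter> sphere 0 1) \<le> 8 * (5*r) / (2*pi)"
    using emeasure_circle_ball_le[of a "5*r"] assms by (simp add: circle.emeasure_eq_measure)
  show ?thesis
  proof (cases "r \<le> pi")
    case True
    then have "r / (2*pi) \<le> measure \<mu> (ball a r \<inter> sphere 0 1)"
      using ge by (simp add: min_def)
    moreover have "8 * (5*r) / (2*pi) = 40 * (r / (2*pi))" by simp
    ultimately show ?thesis using le by linarith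
  next
    case False
    then have "1/2 \<le> measure \<mu> (ball a r \<inter> sphere 0 1)" using ge by (simp add: min_def)
    then show ?thesis using circle.prob_le_1[of "ball a (5 * r) \<inter> sphere 0 1"] by linarith
  qed
qed

subsection \<open>Fourier coefficients, Cauchy integrals and Poisson integrals\<close>

lemma continuous_on_circle_measurable:
  fixes g :: "complex \<Rightarrow> 'a::topological_space"
  assumes "continuous_on (sphere 0 1) g"
  shows "g \<in> borel_measurable \<mu>"
proof -
  have "g \<in> borel_measurable (restrict_space borel (sphere 0 1))"
    using assms by (rule borel_measurable_continuous_on_restrict)
  then show ?thesis unfolding circle_measure_def by (intro measurable_completion) simp
qed

lemma continuous_on_circle_bounded:
  fixes g :: "complex \<Rightarrow> 'a::real_normed_vector"
  assumes "continuous_on (sphere 0 1) g"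
  shows "\<exists>B\<ge>0. \<forall>t. cmod t = 1 \<longrightarrow> norm (g t) \<le> B"
proof -
  have "compact (g ` sphere 0 1)" using assms by (intro compact_continuous_image) auto
  then have "bounded (g ` sphere 0 1)" by (rule compact_imp_bounded)
  then obtain B where "0 < B" "\<forall>t\<in>sphere 0 1. norm (g t) \<le> B"
    unfolding bounded_pos by auto
  then show ?thesis by (intro exI[of _ B]) auto
qed

lemma integrable_continuous_circle:
  fixes g :: "complex \<Rightarrow> 'a::{banach, second_countable_topology}"
  assumes "continuous_on (sphere 0 1) g"
  shows "integrable \<mu> g"
proof -
  obtain B where "\<forall>t. cmod t = 1 \<longrightarrow> norm (g t) \<le> B"
    using continuous_on_circle_bounded[OF assms] by blast
  then show ?thesis
    using continuous_on_circle_measurable[OF assms] by (intro integrable_circle_bounded[where B = B]) auto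
qed

lemma borel_measurable_cnj [measurable]:
  assumes "f \<in> borel_measurable M"
  shows "(\<lambda>t. cnj (f t)) \<in> borel_measurable M"
  using assms by (rule measurable_compose) (intro borel_measurable_continuous_onI continuous_intros)

lemma circle_char_measurable [measurable]: "(\<lambda>t::complex. t powi n) \<in> borel_measurable \<mu>"
  by (rule borel_measurable_circle) (unfold power_int_def, measurable)

lemma cnj_circle_char_measurable [measurable]: "(\<lambda>t::complex. cnj t powi n) \<in> borel_measurable \<mu>"
  using borel_measurable_cnj[OF circle_char_measurable] by simp

lemma fourier_coeff_eq: "fourier_coeff f n = (\<integral>t. f t * cnj (t powi n) \<partial>\<mu>)"
  by (simp add: fourier_coeff_def pairing_def circle_char_def)

lemma norm_powi_circle: "cmod t = 1 \<Longrightarrow> cmod (t powi n) = 1"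
  by (simp add: norm_power_int)

lemma integrable_circle_mult_bounded:
  fixes f g :: "complex \<Rightarrow> complex"
  assumes f: "integrable \<mu> f" and [measurable]: "g \<in> borel_measurable \<mu>"
    and B: "\<And>t. cmod t = 1 \<Longrightarrow> cmod (g t) \<le> B"
  shows "integrable \<mu> (\<lambda>t. f t * g t)"
proof (rule Bochner_Integration.integrable_bound)
  show "integrable \<mu> (\<lambda>t. B * cmod (f t))" using f by auto
  show "(\<lambda>t. f t * g t) \<in> borel_measurable \<mu>" using f by measurable
  show "AE t in \<mu>. norm (f t * g t) \<le> norm (B * cmod (f t))"
  proof (rule AE_I2)
    fix t assume "t \<in> space \<mu>"
    then have "cmod (g t) \<le> B" using B by simp
    then have "cmod (f t) * cmod (g t) \<le> cmod (f t) * B" by (rule mult_left_mono) simp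
    also have "\<dots> \<le> norm (B * cmod (f t))" by (simp add: abs_mult mult.commute mult_mono)
    finally show "norm (f t * g t) \<le> norm (B * cmod (f t))" by (simp add: norm_mult)
  qed
qed

lemma norm_fourier_coeff_le:
  assumes "integrable \<mu> f"
  shows "cmod (fourier_coeff f n) \<le> (\<integral>t. cmod (f t) \<partial>\<mu>)"
proof -
  have "cmod (fourier_coeff f n) \<le> (\<integral>t. cmod (f t * cnj (t powi n)) \<partial>\<mu>)"
    unfolding fourier_coeff_eq by (rule integral_norm_bound)
  also have "\<dots> = (\<integral>t. cmod (f t) \<partial>\<mu>)"
    by (rule Bochner_Integration.integral_cong) (auto simp: norm_mult norm_powi_circle)
  finally show ?thesis .
qed

lemma fourier_coeff_diff:
  assumes "integrable \<mu> f" "integrable \<mu> g"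
  shows "fourier_coeff (\<lambda>t. f t - g t) n = fourier_coeff f n - fourier_coeff g n"
  unfolding fourier_coeff_eq left_diff_distrib
  by (intro Bochner_Integration.integral_diff integrable_circle_mult_bounded[where B=1] assms)
    (auto simp: norm_powi_circle)

lemma fourier_coeff_cong_AE:
  assumes [measurable]: "f \<in> L0" "g \<in> L0" and "AE t in \<mu>. f t = g t"
  shows "fourier_coeff f n = fourier_coeff g n"
  unfolding fourier_coeff_eq by (rule integral_cong_AE) (use assms(3) in auto)

lemma fourier_coeff_cmult: "fourier_coeff (\<lambda>t. c * f t) n = c * fourier_coeff f n"
  unfolding fourier_coeff_eq by (simp add: mult.assoc)

lemma fourier_coeff_shift:
  "fourier_coeff (\<lambda>t. f t * t powi m) n = fourier_coeff f (n - m)"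
  unfolding fourier_coeff_eq
proof (rule Bochner_Integration.integral_cong)
  fix t :: complex assume "t \<in> space \<mu>"
  then have t: "cmod t = 1" by simp
  then have "t \<noteq> 0" by auto
  have "t powi m * cnj (t powi n) = cnj (t powi (n - m))"
  proof -
    have "cnj (t powi n) = cnj (t powi (n - m)) * cnj (t powi m)"
      using \<open>t \<noteq> 0\<close> by (simp add: power_int_diff)
    moreover have "cnj (t powi m) * t powi m = 1"
      using norm_powi_circle[OF t, of m] by (metis complex_norm_square mult.commute of_real_1 one_power2)
    ultimately show ?thesis by (simp add: mult_ac)
  qed
  then show "f t * t powi m * cnj (t powi n) = f t * cnj (t powi (n - m))" by (simp add: mult.assoc)
qed simp

lemma fourier_coeff_cnj: "fourier_coeff (\<lambda>t. cnj (f t)) n = cnj (fourier_coeff f (- n))"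
proof -
  have "fourier_coeff (\<lambda>t. cnj (f t)) n = (\<integral>t. cnj (f t * cnj (t powi (- n))) \<partial>\<mu>)"
    unfolding fourier_coeff_eq
  proof (rule Bochner_Integration.integral_cong)
    fix t :: complex assume "t \<in> space \<mu>"
    then have "cmod (t powi n) = 1" by (simp add: norm_powi_circle)
    then have "cnj (t powi n) = inverse (t powi n)"
      by (metis complex_norm_square inverse_unique of_real_1 one_power2)
    then show "cnj (f t) * cnj (t powi n) = cnj (f t * cnj (t powi - n))"
      by (simp add: power_int_minus)
  qed simp
  also have "\<dots> = cnj (fourier_coeff f (- n))"
    unfolding fourier_coeff_eq by (simp only: Bochner_Integration.integral_cnj)
  finally show ?thesis .
qed

text \<open>The Cauchy integral of f over the circle, written with the Szego kernel. In the disc it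
  is the power series formed from the Fourier coefficients of f with nonnegative index.\<close>

definition szego :: "(complex \<Rightarrow> complex) \<Rightarrow> complex \<Rightarrow> complex" where
  "szego f z = (\<integral>u. f u / (1 - z * cnj u) \<partial>\<mu>)"

text \<open>Expand the kernel into a geometric series in z \<open>cnj u\<close>. Integration term by
  term is legitimate because the n-th term has L^1 norm equal to that of f times |z|^n.\<close>

lemma szego_sums:
  assumes f: "integrable \<mu> f" and z: "cmod z < 1"
  shows "(\<lambda>n. fourier_coeff f (int n) * z ^ n) sums szego f z"
proof -
  let ?h = "\<lambda>n u. f u * (z * cnj u) ^ n"
  have int: "integrable \<mu> (?h n)" for n
    by (rule integrable_circle_mult_bounded[OF f, where B = 1])
      (use z in \<open>auto simp: norm_mult norm_power power_le_one intro!: continuous_on_circle_measurable continuous_intros\<close>)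
  have nrm: "cmod (z * cnj u) < 1" if "cmod u = 1" for u using z that by (simp add: norm_mult)
  have "(\<lambda>n. \<integral>u. ?h n u \<partial>\<mu>) sums (\<integral>u. (\<Sum>n. ?h n u) \<partial>\<mu>)"
  proof (rule sums_integral[OF int])
    show "AE u in \<mu>. summable (\<lambda>n. norm (?h n u))"
      by (rule AE_I2) (use nrm in \<open>auto simp: norm_mult norm_power intro!: summable_mult summable_geometric\<close>)
    have "(\<integral>u. norm (?h n u) \<partial>\<mu>) = (\<integral>u. cmod (f u) \<partial>\<mu>) * cmod z ^ n" for n
    proof -
      have "(\<integral>u. norm (?h n u) \<partial>\<mu>) = (\<integral>u. cmod (f u) * cmod z ^ n \<partial>\<mu>)"
        by (rule Bochner_Integration.integral_cong) (auto simp: norm_mult norm_power)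
      then show ?thesis by simp
    qed
    then show "summable (\<lambda>n. \<integral>u. norm (?h n u) \<partial>\<mu>)"
      using z by (auto intro!: summable_mult summable_geometric)
  qed
  also have "(\<integral>u. (\<Sum>n. ?h n u) \<partial>\<mu>) = szego f z"
    unfolding szego_def
  proof (rule Bochner_Integration.integral_cong)
    fix u assume "u \<in> space \<mu>"
    then have "cmod (z * cnj u) < 1" using nrm by simp
    then show "(\<Sum>n. ?h n u) = f u / (1 - z * cnj u)"
      by (simp add: suminf_mult suminf_geometric summable_geometric)
  qed simp
  also have "(\<lambda>n. \<integral>u. ?h n u \<partial>\<mu>) = (\<lambda>n. fourier_coeff f (int n) * z ^ n)"
    unfolding fourier_coeff_eq
    by (simp add: power_mult_distrib mult_ac flip: integral_mult_right_zero integral_mult_left_zero)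
  finally show ?thesis .
qed

lemma szego_holomorphic:
  assumes "integrable \<mu> f"
  shows "szego f holomorphic_on ball 0 1"
  by (rule power_series_holomorphic[where a = "\<lambda>n. fourier_coeff f (int n)"])
    (use szego_sums[OF assms] in auto)

text \<open>On the circle, conjugating the k-th character inverts it, so each term becomes a
  multiple of the character with index n - k. Absolute summability permits integration term by term,
  and only n = k survives.\<close>

lemma fourier_coeff_power_series:
  fixes c :: "nat \<Rightarrow> complex"
  assumes c: "summable (\<lambda>n. cmod (c n))" and g: "\<And>t. cmod t = 1 \<Longrightarrow> (\<lambda>n. c n * t ^ n) sums g t"
  shows "fourier_coeff g k = (if 0 \<le> k then c (nat k) else 0)"
proof -
  let ?h = "\<lambda>n t. c n * (t powi (int n - k))"
  have "(\<lambda>n. \<integral>t. ?h n t \<partial>\<mu>) sums (\<integral>t. (\<Sum>n. ?h n t) \<partial>\<mu>)"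
  proof (rule sums_integral)
    show "integrable \<mu> (?h n)" for n
      by (rule integrable_circle_bounded[where B = "cmod (c n)"]) (auto simp: norm_mult norm_powi_circle)
    show "AE t in \<mu>. summable (\<lambda>n. norm (?h n t))"
      by (rule AE_I2) (use c in \<open>simp add: norm_mult norm_powi_circle\<close>)
    have "(\<integral>t. norm (?h n t) \<partial>\<mu>) = cmod (c n)" for n
    proof -
      have "(\<integral>t. norm (?h n t) \<partial>\<mu>) = (\<integral>t. cmod (c n) \<partial>\<mu>)"
        by (rule Bochner_Integration.integral_cong) (auto simp: norm_mult norm_powi_circle)
      then show ?thesis using circle.prob_space by simp
    qed
    then show "summable (\<lambda>n. \<integral>t. norm (?h n t) \<partial>\<mu>)" using c by simp
  qed
  also have "(\<integral>t. (\<Sum>n. ?h n t) \<partial>\<mu>) = fourier_coeff g k"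
    unfolding fourier_coeff_eq
  proof (rule Bochner_Integration.integral_cong)
    fix t assume "t \<in> space \<mu>"
    then have t: "cmod t = 1" by simp
    then have "t \<noteq> 0" by auto
    have "cnj (t powi k) = inverse (t powi k)"
      using norm_powi_circle[OF t, of k] by (metis complex_norm_square inverse_unique of_real_1 one_power2)
    then have "?h n t = c n * t ^ n * cnj (t powi k)" for n
      using \<open>t \<noteq> 0\<close> by (simp add: power_int_diff field_simps)
    then have eq: "(\<lambda>n. ?h n t) = (\<lambda>n. c n * t ^ n * cnj (t powi k))" by blast
    have "(\<lambda>n. c n * t ^ n * cnj (t powi k)) sums (g t * cnj (t powi k))"
      by (rule sums_mult2[OF g[OF t]])
    then show "(\<Sum>n. ?h n t) = g t * cnj (t powi k)"
      unfolding eq by (rule sums_unique[symmetric])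
  qed simp
  also have "(\<lambda>n. \<integral>t. ?h n t \<partial>\<mu>) = (\<lambda>n. if int n = k then c n else 0)"
    by (auto simp: integral_powi_circle)
  finally have s: "(\<lambda>n. if int n = k then c n else 0) sums fourier_coeff g k" .
  show ?thesis
  proof (cases "0 \<le> k")
    case True
    have "(\<lambda>n. if n = nat k then c n else 0) sums c (nat k)" by (rule sums_single)
    moreover have "n = nat k \<longleftrightarrow> int n = k" for n using True by auto
    ultimately have "(\<lambda>n. if int n = k then c n else 0) sums c (nat k)" by simp
    then show ?thesis using s True sums_unique2 by auto
  next
    case False
    then have "(\<lambda>n. if int n = k then c n else 0) = (\<lambda>n. 0)" by auto
    then show ?thesis using s False sums_unique2[OF _ sums_zero] by auto
  qed
qed

lemma fourier_coeff_szego: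
  assumes f: "integrable \<mu> f" and r: "0 \<le> r" "r < 1"
  shows "fourier_coeff (\<lambda>t. szego f (of_real r * t)) k = (if 0 \<le> k then fourier_coeff f k * of_real r ^ nat k else 0)"
proof -
  have "fourier_coeff (\<lambda>t. szego f (of_real r * t)) k =
    (if 0 \<le> k then fourier_coeff f (int (nat k)) * of_real r ^ nat k else 0)"
  proof (rule fourier_coeff_power_series)
    have "summable (\<lambda>n. (\<integral>t. cmod (f t) \<partial>\<mu>) * r ^ n)"
      using r by (intro summable_mult summable_geometric) auto
    then show "summable (\<lambda>n. cmod (fourier_coeff f (int n) * of_real r ^ n))"
      by (rule summable_comparison_test')
        (use r norm_fourier_coeff_le[OF f] in \<open>auto simp: norm_mult norm_power intro!: mult_right_mono\<close>)
    show "(\<lambda>n. fourier_coeff f (int n) * of_real r ^ n * t ^ n) sums szego f (of_real r * t)"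
      if "cmod t = 1" for t
      using szego_sums[OF f, of "of_real r * t"] that r by (simp add: norm_mult power_mult_distrib mult.assoc)
  qed
  then show ?thesis by simp
qed

lemma continuous_on_szego_circle:
  assumes f: "integrable \<mu> f" and r: "0 \<le> r" "r < 1"
  shows "continuous_on (sphere 0 1) (\<lambda>t. szego f (of_real r * t))"
  by (rule continuous_on_compose2[OF holomorphic_on_imp_continuous_on[OF szego_holomorphic[OF f]]])
    (use r in \<open>auto intro!: continuous_intros simp: norm_mult\<close>)

lemma integrable_szego:
  assumes f: "integrable \<mu> f" and r: "0 \<le> r" "r < 1"
  shows "integrable \<mu> (\<lambda>t. szego f (of_real r * t))"
  by (rule integrable_continuous_circle[OF continuous_on_szego_circle[OF assms]])

section \<open>The Poisson kernel and its relation to Cauchy integrals\<close>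

definition poisson_kernel :: "real \<Rightarrow> complex \<Rightarrow> complex \<Rightarrow> real" where
  "poisson_kernel r t u = Re ((1 + of_real r * t * cnj u) / (1 - of_real r * t * cnj u))"

definition poisson :: "(complex \<Rightarrow> complex) \<Rightarrow> real \<Rightarrow> complex \<Rightarrow> complex" where
  "poisson f r t = (\<integral>u. of_real (poisson_kernel r t u) * f u \<partial>\<mu>)"

text \<open>In this form the kernel visibly depends on u only through its distance to t and
  decreases with it. Symmetry, positivity, the concentration near t and the shape of the superlevel
  sets are all read off from here.\<close>

lemma poisson_kernel_eq:
  assumes "cmod t = 1" "cmod u = 1" "0 \<le> r" "r < 1"
  shows "poisson_kernel r t u = (1 - r\<^sup>2) / ((1 - r)\<^sup>2 + r * (dist u t)\<^sup>2)"
proof -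
  define w where "w = of_real r * t * cnj u"
  have w: "cmod w = r" using assms by (simp add: w_def norm_mult)
  have t: "(Re t)\<^sup>2 + (Im t)\<^sup>2 = 1" and u: "(Re u)\<^sup>2 + (Im u)\<^sup>2 = 1"
    using assms by (simp_all add: cmod_def)
  have d: "(dist u t)\<^sup>2 = 2 - 2 * (Re t * Re u + Im t * Im u)"
    unfolding dist_norm cmod_power2 using t u by (simp add: power2_diff algebra_simps)
  have n1: "(cmod (1 - w))\<^sup>2 = 1 - 2 * Re w + r\<^sup>2"
    using w by (simp add: cmod_power2 power2_diff algebra_simps flip: w)
  have "Re ((1 + w) / (1 - w)) = (1 - r\<^sup>2) / (cmod (1 - w))\<^sup>2"
    using cmod_power2[of w] w by (simp add: Re_divide' algebra_simps power2_eq_square)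
  also have "(cmod (1 - w))\<^sup>2 = (1 - r)\<^sup>2 + r * (dist u t)\<^sup>2"
    unfolding n1 d by (simp add: w_def power2_eq_square algebra_simps)
  finally show ?thesis by (simp add: poisson_kernel_def w_def)
qed

lemma poisson_kernel_sym:
  assumes "cmod t = 1" "cmod u = 1" "0 \<le> r" "r < 1"
  shows "poisson_kernel r t u = poisson_kernel r u t"
  using assms by (simp add: poisson_kernel_eq dist_commute)

lemma poisson_kernel_pos:
  assumes "cmod t = 1" "cmod u = 1" "0 \<le> r" "r < 1"
  shows "0 < poisson_kernel r t u"
proof -
  have "r\<^sup>2 < 1" using assms by (simp add: power_less_one_iff)
  moreover have "0 < (1 - r)\<^sup>2 + r * (dist u t)\<^sup>2"
    using assms by (intro add_pos_nonneg) auto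
  ultimately show ?thesis using assms by (simp add: poisson_kernel_eq)
qed

lemma one_minus_circle_ge:
  assumes "cmod t = 1" "cmod u = 1" "0 \<le> r" "r < 1"
  shows "1 - r \<le> cmod (1 - of_real r * t * cnj u)"
  using norm_triangle_ineq2[of 1 "of_real r * t * cnj u"] assms by (simp add: norm_mult)

lemma poisson_kernel_measurable [measurable]:
  "poisson_kernel r t \<in> borel_measurable \<mu>"
  unfolding poisson_kernel_def by (rule borel_measurable_circle) measurable

lemma integrable_szego_kernel:
  assumes "integrable \<mu> f" "cmod t = 1" "0 \<le> r" "r < 1"
  shows "integrable \<mu> (\<lambda>u. f u / (1 - of_real r * t * cnj u))"
  unfolding divide_inverse
proof (rule integrable_circle_mult_bounded[OF assms(1), where B = "1 / (1 - r)"])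
  show "(\<lambda>u. inverse (1 - of_real r * t * cnj u)) \<in> borel_measurable \<mu>"
    by (rule borel_measurable_circle) measurable
  show "cmod (inverse (1 - of_real r * t * cnj u)) \<le> 1 / (1 - r)" if "cmod u = 1" for u
    using one_minus_circle_ge[OF assms(2) that assms(3,4)] assms
    unfolding norm_inverse divide_inverse by (simp add: le_imp_inverse_le)
qed

text \<open>With w = r t \<open>cnj u\<close>, the quotient (1 + w)/(1 - w) equals 2/(1 - w) - 1, so
  its real part is 1/(1 - w) plus its conjugate minus 1. The conjugated kernel is absorbed by
  conjugating f inside and the whole integral outside.\<close>

lemma poisson_eq_szego:
  assumes f: "integrable \<mu> f" and t: "cmod t = 1" and r: "0 \<le> r" "r < 1"
  shows "poisson f r t = szego f (of_real r * t) + cnj (szego (\<lambda>u. cnj (f u)) (of_real r * t)) - fourier_coeff f 0"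
proof -
  let ?k = "\<lambda>u. 1 - of_real r * t * cnj u"
  have "poisson f r t = (\<integral>u. f u / ?k u + cnj (cnj (f u) / ?k u) - f u \<partial>\<mu>)"
    unfolding poisson_def
  proof (rule Bochner_Integration.integral_cong)
    fix u assume "u \<in> space \<mu>"
    then have "?k u \<noteq> 0" using one_minus_circle_ge[OF t _ r, of u] r by auto
    define k where "k = ?k u"
    have "k \<noteq> 0" using \<open>?k u \<noteq> 0\<close> by (simp add: k_def)
    have "of_real (Re ((2 - k) / k)) = 1 / k + cnj (1 / k) - 1"
    proof -
      have "(2 - k) / k = 2 / k - 1" using \<open>k \<noteq> 0\<close> by (simp add: field_simps)
      moreover have "of_real (Re z) = (z + cnj z) / 2" for z by (simp add: complex_eq_iff)
      ultimately show ?thesis by (simp add: add_divide_distrib diff_divide_distrib)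
    qed
    moreover have "1 + of_real r * t * cnj u = 2 - k" by (simp add: k_def)
    then have "poisson_kernel r t u = Re ((2 - k) / k)"
      unfolding poisson_kernel_def k_def by (rule arg_cong[where f = "\<lambda>x. Re (x / _)"])
    ultimately have "of_real (poisson_kernel r t u) = 1 / k + cnj (1 / k) - 1"
      by (simp only:)
    then have "of_real (poisson_kernel r t u) * f u = f u / k + cnj (cnj (f u) / k) - f u"
      by (simp add: distrib_right left_diff_distrib)
    then show "of_real (poisson_kernel r t u) * f u = f u / ?k u + cnj (cnj (f u) / ?k u) - f u"
      unfolding k_def .
  qed simp
  also have "\<dots> = szego f (of_real r * t) + cnj (szego (\<lambda>u. cnj (f u)) (of_real r * t)) - fourier_coeff f 0"
  proof -
    have 1: "integrable \<mu> (\<lambda>u. f u / ?k u)"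
      by (rule integrable_szego_kernel[OF f t r])
    have 2: "integrable \<mu> (\<lambda>u. cnj (f u) / ?k u)"
      by (rule integrable_szego_kernel[OF _ t r]) (use f in simp)
    then have 3: "integrable \<mu> (\<lambda>u. cnj (cnj (f u) / ?k u))" by (rule integrable_cnj)
    show ?thesis
      using 1 3 f unfolding szego_def fourier_coeff_eq
      by (simp del: complex_cnj_divide complex_cnj_cnj add: Bochner_Integration.integral_diff Bochner_Integration.integral_add flip: integral_cnj)
  qed
  finally show ?thesis .
qed

text \<open>The Poisson kernel and its conjugate are the real and imaginary parts of one analytic
  quotient, and \<i> Im k = k - Re k. Rearranged, twice the Cauchy integral is
  \<open>poisson\<close> plus \<i> times \<open>conjugate_poisson\<close> plus the mean: the formula
  of \<open>riesz_projection\<close> before the radial limit.\<close>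

lemma conjugate_poisson_eq_szego:
  assumes f: "integrable \<mu> f" and t: "cmod t = 1" and r: "0 \<le> r" "r < 1"
  shows "\<i> * conjugate_poisson f r t = 2 * szego f (of_real r * t) - poisson f r t - fourier_coeff f 0"
proof -
  let ?k = "\<lambda>u. 1 - of_real r * t * cnj u"
  have 1: "integrable \<mu> (\<lambda>u. f u / ?k u)"
    by (rule integrable_szego_kernel[OF f t r])
  have B: "cmod ((1 + of_real r * t * cnj u) / ?k u) \<le> 2 / (1 - r)" if "cmod u = 1" for u
  proof -
    have "cmod (1 + of_real r * t * cnj u) \<le> 2"
      using norm_triangle_ineq[of 1 "of_real r * t * cnj u"] t r that by (simp add: norm_mult)
    then show ?thesis
      using one_minus_circle_ge[OF t that r] r unfolding norm_divide by (intro frac_le) auto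
  qed
  have 2: "integrable \<mu> (\<lambda>u. of_real (poisson_kernel r t u) * f u)"
    by (subst mult.commute, rule integrable_circle_mult_bounded[OF f, where B = "2 / (1 - r)"])
      (measurable, use order_trans[OF abs_Re_le_cmod B] in \<open>simp add: poisson_kernel_def\<close>)
  have "\<i> * conjugate_poisson f r t =
     (\<integral>u. 2 * (f u / ?k u) - of_real (poisson_kernel r t u) * f u - f u \<partial>\<mu>)"
    unfolding conjugate_poisson_def integral_mult_right_zero[symmetric]
  proof (rule Bochner_Integration.integral_cong)
    fix u assume "u \<in> space \<mu>"
    then have "?k u \<noteq> 0" using one_minus_circle_ge[OF t _ r, of u] r by auto
    define k where "k = (1 + of_real r * t * cnj u) / ?k u"
    have "k = 2 / ?k u - 1" using \<open>?k u \<noteq> 0\<close> by (simp add: k_def divide_eq_eq left_diff_distrib)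
    then have "k * f u = 2 * (f u / ?k u) - f u" by (simp add: left_diff_distrib)
    moreover have "\<i> * of_real (Im k) = k - of_real (Re k)" by (simp add: complex_eq_iff)
    ultimately have "\<i> * of_real (Im k) * f u = 2 * (f u / ?k u) - of_real (Re k) * f u - f u"
      by (simp add: left_diff_distrib)
    then show "\<i> * (of_real (Im ((1 + of_real r * t * cnj u) / ?k u)) * f u) =
        2 * (f u / ?k u) - of_real (poisson_kernel r t u) * f u - f u"
      unfolding poisson_kernel_def k_def by (simp only: mult.assoc)
  qed simp
  also have "\<dots> = 2 * szego f (of_real r * t) - poisson f r t - fourier_coeff f 0"
    unfolding szego_def fourier_coeff_eq poisson_def
    by (simp only: Bochner_Integration.integral_diff[OF Bochner_Integration.integrable_diff[OF integrable_mult_right[OF 1] 2] f]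
        Bochner_Integration.integral_diff[OF integrable_mult_right[OF 1] 2] integral_mult_right_zero) simp
  finally show ?thesis .
qed

lemma szego_1: "cmod z < 1 \<Longrightarrow> szego (\<lambda>_. 1) z = 1"
proof -
  assume z: "cmod z < 1"
  have "fourier_coeff (\<lambda>_. 1) (int n) = cnj (\<integral>t. t powi int n \<partial>\<mu>)" for n
    unfolding fourier_coeff_eq mult_1 by (simp only: Bochner_Integration.integral_cnj)
  then have "fourier_coeff (\<lambda>_. 1) (int n) = (if n = 0 then 1 else 0)" for n
    by (simp only: integral_powi_circle of_nat_eq_0_iff if_distrib[of cnj] complex_cnj_one complex_cnj_zero)
  then have "(\<lambda>n. if n = 0 then 1 else 0) sums szego (\<lambda>_. 1) z"
    using szego_sums[OF _ z, of "\<lambda>_. 1"] by (simp add: if_distrib[of "\<lambda>x. x * _"] cong: if_cong)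
  moreover have "(\<lambda>n. if n = 0 then 1 else 0) sums (1::complex)" using sums_single[of 0 "\<lambda>_. 1::complex"] by simp
  ultimately show ?thesis by (rule sums_unique2)
qed

lemma integral_poisson_kernel:
  assumes "cmod t = 1" "0 \<le> r" "r < 1"
  shows "(\<integral>u. poisson_kernel r t u \<partial>\<mu>) = 1"
proof -
  have "of_real (\<integral>u. poisson_kernel r t u \<partial>\<mu>) = poisson (\<lambda>_. 1) r t"
    by (simp add: poisson_def)
  also have "\<dots> = 1"
    using assms circle.prob_space by (subst poisson_eq_szego) (simp_all add: szego_1 norm_mult fourier_coeff_eq)
  finally show ?thesis by (simp only: of_real_eq_1_iff)
qed

lemma poisson_kernel_le:
  assumes "cmod t = 1" "cmod u = 1" "0 \<le> r" "r < 1"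
  shows "poisson_kernel r t u \<le> 2 / (1 - r)"
proof -
  have "1 - r\<^sup>2 = (1 + r) * (1 - r)" by (simp add: power2_eq_square algebra_simps)
  also have "\<dots> \<le> 2 * (1 - r)" using assms by (intro mult_right_mono) auto
  finally have "poisson_kernel r t u \<le> 2 * (1 - r) / (1 - r)\<^sup>2"
    unfolding poisson_kernel_eq[OF assms] using assms by (intro frac_le) auto
  also have "\<dots> = 2 / (1 - r)"
    by (subst power2_eq_square) (rule mult_divide_mult_cancel_right, use assms in simp)
  finally show ?thesis .
qed

subsection \<open>Fatou's theorem on radial limits\<close>

lemma ball_circle_sets [measurable]: "ball a r \<inter> sphere 0 1 \<in> sets \<mu>"
  by (rule sets_circle_Int) simp

lemma emeasure_circle_doubling:
  assumes "cmod a = 1" "0 < r"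
  shows "emeasure \<mu> (ball a (5 * r) \<inter> sphere 0 1) \<le> 40 * emeasure \<mu> (ball a r \<inter> sphere 0 1)"
proof -
  have "ennreal (measure \<mu> (ball a (5 * r) \<inter> sphere 0 1)) \<le>
      ennreal (40 * measure \<mu> (ball a r \<inter> sphere 0 1))"
    by (rule ennreal_leI[OF circle_doubling[OF assms]])
  then show ?thesis by (simp add: circle.emeasure_eq_measure ennreal_mult')
qed

text \<open>Arcs are traces of discs, so the Vitali covering lemma of the plane applies.\<close>

lemma maximal_weak_type:
  fixes h :: "complex \<Rightarrow> ennreal" and l :: ennreal
  assumes h [measurable]: "h \<in> borel_measurable \<mu>"
  obtains A where "A \<in> sets \<mu>" "l * emeasure \<mu> A \<le> 40 * (\<integral>\<^sup>+ u. h u \<partial>\<mu>)"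
    "\<And>t \<rho>. \<lbrakk>cmod t = 1; t \<notin> A; 0 < \<rho>; \<rho> \<le> 3\<rbrakk> \<Longrightarrow>
       (\<integral>\<^sup>+ u. h u * indicator (ball t \<rho> \<inter> sphere 0 1) u \<partial>\<mu>) \<le> l * emeasure \<mu> (ball t \<rho> \<inter> sphere 0 1)"
proof -
  \<comment> \<open>The pairs (centre, radius) of arcs over which the average of h exceeds l. The
    covering lemma asks for bounded radii; the bound 3 loses nothing, because the circle has
    diameter 2.\<close>
  define K where "K = {(t, \<rho>). cmod t = 1 \<and> 0 < \<rho> \<and> \<rho> \<le> (3::real) \<and>
     l * emeasure \<mu> (ball t \<rho> \<inter> sphere 0 1) <
       (\<integral>\<^sup>+ u. h u * indicator (ball t \<rho> \<inter> sphere 0 1) u \<partial>\<mu>)}"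
  have K: "0 < snd i \<and> snd i \<le> 3" if "i \<in> K" for i
    using that by (simp add: K_def case_prod_beta')
  obtain C where C: "countable C" "C \<subseteq> K"
     "pairwise (\<lambda>i j. disjnt (ball (fst i) (snd i)) (ball (fst j) (snd j))) C"
     "(\<Union>i\<in>K. ball (fst i) (snd i)) \<subseteq> (\<Union>i\<in>C. ball (fst i) (5 * snd i))"
    by (rule Vitali_covering_lemma_balls[where a = fst and r = snd, OF subset_refl K])
  define B5 where "B5 n = (if n \<in> to_nat_on C ` C then ball (fst (from_nat_into C n)) (5 * snd (from_nat_into C n)) \<inter> sphere 0 1 else {})" for n
  define B where "B n = (if n \<in> to_nat_on C ` C then ball (fst (from_nat_into C n)) (snd (from_nat_into C n)) \<inter> sphere 0 1 else {})" for n
  have [measurable]: "B n \<in> sets \<mu>" "B5 n \<in> sets \<mu>" for n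
    by (simp_all add: B_def B5_def)
  have inC: "from_nat_into C n \<in> C" if "n \<in> to_nat_on C ` C" for n
    using that C(1) by (auto simp: from_nat_into)
  have disj: "disjoint_family B"
    unfolding disjoint_family_on_def
  proof (intro ballI impI)
    fix m n :: nat assume "m \<noteq> n"
    show "B m \<inter> B n = {}"
    proof (cases "m \<in> to_nat_on C ` C \<and> n \<in> to_nat_on C ` C")
      case True
      then obtain i j where ij: "i \<in> C" "j \<in> C" "m = to_nat_on C i" "n = to_nat_on C j" by auto
      then have "i \<noteq> j" using \<open>m \<noteq> n\<close> by auto
      then have "disjnt (ball (fst i) (snd i)) (ball (fst j) (snd j))"
        using C(3) ij by (auto simp: pairwise_def)
      then show ?thesis using ij C(1) True by (auto simp: B_def disjnt_def)
    qed (auto simp: B_def)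
  qed
  have "emeasure \<mu> (\<Union>n. B5 n) \<le> (\<Sum>n. emeasure \<mu> (B5 n))"
    by (rule emeasure_subadditive_countably) auto
  also have "\<dots> \<le> (\<Sum>n. 40 * emeasure \<mu> (B n))"
  proof (intro suminf_le)
    fix n show "emeasure \<mu> (B5 n) \<le> 40 * emeasure \<mu> (B n)"
    proof (cases "n \<in> to_nat_on C ` C")
      case True
      then have "from_nat_into C n \<in> K" using inC C(2) by auto
      then show ?thesis
        using True emeasure_circle_doubling by (auto simp: B5_def B_def K_def)
    qed (simp add: B5_def)
  qed auto
  finally have "l * emeasure \<mu> (\<Union>n. B5 n) \<le> l * (\<Sum>n. 40 * emeasure \<mu> (B n))"
    by (rule mult_left_mono) simp
  also have "\<dots> = 40 * (\<Sum>n. l * emeasure \<mu> (B n))"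
    by (simp add: mult.left_commute)
  also have "\<dots> \<le> 40 * (\<Sum>n. \<integral>\<^sup>+ u. h u * indicator (B n) u \<partial>\<mu>)"
  proof (intro mult_left_mono suminf_le)
    fix n show "l * emeasure \<mu> (B n) \<le> (\<integral>\<^sup>+ u. h u * indicator (B n) u \<partial>\<mu>)"
    proof (cases "n \<in> to_nat_on C ` C")
      case True
      then have "from_nat_into C n \<in> K" using inC C(2) by auto
      then show ?thesis
        using True by (auto simp: B_def K_def)
    qed (simp add: B_def)
  qed auto
  also have "\<dots> = 40 * (\<integral>\<^sup>+ u. h u * indicator (\<Union>n. B n) u \<partial>\<mu>)"
    by (subst nn_integral_suminf[symmetric]) (auto simp: suminf_indicator[OF disj])
  also have "\<dots> \<le> 40 * (\<integral>\<^sup>+ u. h u \<partial>\<mu>)"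
    by (intro mult_left_mono nn_integral_mono) (auto simp: indicator_def)
  finally have main: "l * emeasure \<mu> (\<Union>n. B5 n) \<le> 40 * (\<integral>\<^sup>+ u. h u \<partial>\<mu>)" .
  show ?thesis
  proof (rule that[OF _ main])
    fix t \<rho> assume t: "cmod t = 1" "t \<notin> (\<Union>n. B5 n)" and \<rho>: "0 < \<rho>" "\<rho> \<le> (3::real)"
    have "(t, \<rho>) \<notin> K"
    proof
      assume "(t, \<rho>) \<in> K"
      then have "t \<in> (\<Union>i\<in>K. ball (fst i) (snd i))" using \<rho> by force
      then obtain i where i: "i \<in> C" "t \<in> ball (fst i) (5 * snd i)" using C(4) by blast
      then have "t \<in> B5 (to_nat_on C i)" using C(1) t by (simp add: B5_def)
      then show False using t by blast
    qed
    then show "(\<integral>\<^sup>+ u. h u * indicator (ball t \<rho> \<inter> sphere 0 1) u \<partial>\<mu>) \<le> l * emeasure \<mu> (ball t \<rho> \<inter> sphere 0 1)"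
      using t \<rho> by (auto simp: K_def not_less)
  qed measurable
qed

text \<open>Clearing the positive denominator turns the condition into an upper bound for s r times
  the squared distance to t. If s r = 0 the bound no longer involves u, so either no point or every
  point satisfies it. Radii above 3 are cut down to 3, since a disc of that radius about a point of
  the circle already contains the circle.\<close>

lemma poisson_superlevel:
  assumes t: "cmod t = 1" and r: "0 \<le> r" "r < 1" and s: "0 \<le> s"
  obtains "{u \<in> sphere 0 1. s < poisson_kernel r t u} = {}" | \<rho> where "0 < \<rho>" "\<rho> \<le> 3"
    "{u \<in> sphere 0 1. s < poisson_kernel r t u} = ball t \<rho> \<inter> sphere 0 1"
proof -
  let ?U = "{u \<in> sphere 0 1. s < poisson_kernel r t u}"
  have all: "ball t 3 \<inter> sphere 0 1 = sphere 0 1"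
  proof -
    have "dist t u < 3" if "cmod u = 1" for u
      using t that norm_triangle_ineq4[of t u] by (simp add: dist_norm)
    then show ?thesis by auto
  qed
  have iff: "s < poisson_kernel r t u \<longleftrightarrow> s * r * (dist u t)\<^sup>2 < 1 - r\<^sup>2 - s * (1 - r)\<^sup>2" if "cmod u = 1" for u
  proof -
    have "0 < (1 - r)\<^sup>2 + r * (dist u t)\<^sup>2" using r by (intro add_pos_nonneg) auto
    then show ?thesis
      unfolding poisson_kernel_eq[OF t that r] by (simp add: pos_less_divide_eq algebra_simps)
  qed
  show ?thesis
  proof (cases "s * r = 0")
    case True
    then have "?U = {} \<or> ?U = sphere 0 1" using iff by auto
    then show ?thesis using that(1) that(2)[of 3] all by auto
  next
    case False
    then have sr: "0 < s * r" using s r by simp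
    define q where "q = (1 - r\<^sup>2 - s * (1 - r)\<^sup>2) / (s * r)"
    have iff': "s < poisson_kernel r t u \<longleftrightarrow> (dist u t)\<^sup>2 < q" if "cmod u = 1" for u
      unfolding iff[OF that] q_def using sr by (simp add: pos_less_divide_eq mult.commute)
    show ?thesis
    proof (cases "q \<le> 0")
      case True
      then have "\<not> (dist u t)\<^sup>2 < q" for u using zero_le_power2[of "dist u t"] by linarith
      then show ?thesis using that(1) iff' by auto
    next
      case False
      then have "(dist u t)\<^sup>2 < q \<longleftrightarrow> dist u t < sqrt q" for u
        by (metis abs_of_nonneg not_le real_sqrt_abs real_sqrt_less_iff zero_le_dist)
      then have U: "?U = ball t (sqrt q) \<inter> sphere 0 1" using iff' by (auto simp: dist_commute)
      show ?thesis
      proof (cases "sqrt q \<le> 3")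
        case True
        then show ?thesis using that(2)[of "sqrt q"] U False by auto
      next
        case f: False
        then have "ball t 3 \<subseteq> ball t (sqrt q)" by auto
        then have "?U = ball t 3 \<inter> sphere 0 1" using U all by auto
        then show ?thesis using that(2)[of 3] by auto
      qed
    qed
  qed
qed

lemma nn_integral_poisson_kernel:
  assumes "cmod t = 1" "0 \<le> r" "r < 1"
  shows "(\<integral>\<^sup>+ u. ennreal (poisson_kernel r t u) \<partial>\<mu>) = 1"
proof -
  have "integrable \<mu> (poisson_kernel r t)"
    by (rule integrable_circle_bounded[where B = "2 / (1 - r)"])
      (use poisson_kernel_le[OF assms(1) _ assms(2,3)] poisson_kernel_pos[OF assms(1) _ assms(2,3)] in \<open>auto simp: less_imp_le\<close>)
  then have "(\<integral>\<^sup>+ u. ennreal (poisson_kernel r t u) \<partial>\<mu>) = ennreal (\<integral>u. poisson_kernel r t u \<partial>\<mu>)"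
    by (rule nn_integral_eq_integral) (auto intro!: AE_I2 less_imp_le poisson_kernel_pos assms)
  then show ?thesis by (simp add: integral_poisson_kernel[OF assms])
qed

text \<open>Layer cake: the superlevel sets of the Poisson kernel are arcs centred at \<open>t\<close>, so an average
  against the kernel is a mixture of averages over such arcs.\<close>

lemma poisson_le_maximal:
  fixes h :: "complex \<Rightarrow> ennreal" and l :: ennreal
  assumes h [measurable]: "h \<in> borel_measurable \<mu>"
    and t: "cmod t = 1" and r: "0 \<le> r" "r < 1"
    and ball: "\<And>\<rho>. \<lbrakk>0 < \<rho>; \<rho> \<le> 3\<rbrakk> \<Longrightarrow>
       (\<integral>\<^sup>+ u. h u * indicator (ball t \<rho> \<inter> sphere 0 1) u \<partial>\<mu>) \<le> l * emeasure \<mu> (ball t \<rho> \<inter> sphere 0 1)"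
  shows "(\<integral>\<^sup>+ u. ennreal (poisson_kernel r t u) * h u \<partial>\<mu>) \<le> l"
proof -
  interpret pair_sigma_finite lborel \<mu>
    by (intro pair_sigma_finite.intro lborel.sigma_finite_measure_axioms circle.sigma_finite_measure_axioms)
  define I :: "real \<Rightarrow> complex \<Rightarrow> ennreal" where
    "I s u = (if 0 \<le> s \<and> s < poisson_kernel r t u then 1 else 0)" for s u
  have Im: "case_prod I \<in> borel_measurable (lborel \<Otimes>\<^sub>M \<mu>)"
    unfolding I_def by measurable
  have layer: "(\<integral>\<^sup>+ u. ennreal (poisson_kernel r t u) * g u \<partial>\<mu>) =
      (\<integral>\<^sup>+ s. (\<integral>\<^sup>+ u. I s u * g u \<partial>\<mu>) \<partial>lborel)"
    if [measurable]: "g \<in> borel_measurable \<mu>" for g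
  proof -
    have m: "(\<lambda>(s, u). I s u * g u) \<in> borel_measurable (lborel \<Otimes>\<^sub>M \<mu>)"
      using Im by (auto simp: case_prod_beta')
    have "(\<integral>\<^sup>+ u. ennreal (poisson_kernel r t u) * g u \<partial>\<mu>) =
        (\<integral>\<^sup>+ u. (\<integral>\<^sup>+ s. I s u * g u \<partial>lborel) \<partial>\<mu>)"
    proof (rule nn_integral_cong)
      fix u assume "u \<in> space \<mu>"
      then have p: "0 < poisson_kernel r t u" using poisson_kernel_pos[OF t _ r] by simp
      have [measurable]: "(\<lambda>s. I s u) \<in> borel_measurable lborel" unfolding I_def by measurable
      have "(\<integral>\<^sup>+ s. I s u * g u \<partial>lborel) = (\<integral>\<^sup>+ s. I s u \<partial>lborel) * g u"
        by (rule nn_integral_multc) measurable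
      also have "(\<integral>\<^sup>+ s. I s u \<partial>lborel) = (\<integral>\<^sup>+ s. indicator {0..<poisson_kernel r t u} s \<partial>lborel)"
        by (rule nn_integral_cong) (auto simp: I_def)
      also have "\<dots> = ennreal (poisson_kernel r t u)" using p by simp
      finally show "ennreal (poisson_kernel r t u) * g u = (\<integral>\<^sup>+ s. I s u * g u \<partial>lborel)" by simp
    qed
    also have "\<dots> = (\<integral>\<^sup>+ s. (\<integral>\<^sup>+ u. I s u * g u \<partial>\<mu>) \<partial>lborel)"
      by (rule Fubini'[OF m])
    finally show ?thesis .
  qed
  have Iu [measurable]: "(\<lambda>u. I s u) \<in> borel_measurable \<mu>" for s unfolding I_def by measurable
  have "(\<integral>\<^sup>+ u. I s u * h u \<partial>\<mu>) \<le> l * (\<integral>\<^sup>+ u. I s u * 1 \<partial>\<mu>)" for s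
  proof (cases "0 \<le> s")
    case True
    let ?U = "{u \<in> sphere 0 1. s < poisson_kernel r t u}"
    have I: "I s u = indicator ?U u" if "u \<in> space \<mu>" for u
      using that True by (auto simp: I_def)
    have 1: "(\<integral>\<^sup>+ u. I s u * h u \<partial>\<mu>) = (\<integral>\<^sup>+ u. h u * indicator ?U u \<partial>\<mu>)"
      by (rule nn_integral_cong) (simp add: I mult.commute)
    have 2: "(\<integral>\<^sup>+ u. I s u * 1 \<partial>\<mu>) = (\<integral>\<^sup>+ u. indicator ?U u \<partial>\<mu>)"
      by (rule nn_integral_cong) (simp add: I)
    show ?thesis unfolding 1 2
    proof (rule poisson_superlevel[OF t r True])
      assume "?U = {}"
      then show "(\<integral>\<^sup>+ u. h u * indicator ?U u \<partial>\<mu>) \<le> l * (\<integral>\<^sup>+ u. indicator ?U u \<partial>\<mu>)"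
        by (simp only:) simp
    next
      fix \<rho> assume "0 < \<rho>" "\<rho> \<le> 3" and U: "?U = ball t \<rho> \<inter> sphere 0 1"
      then show "(\<integral>\<^sup>+ u. h u * indicator ?U u \<partial>\<mu>) \<le> l * (\<integral>\<^sup>+ u. indicator ?U u \<partial>\<mu>)"
        unfolding U using ball by simp
    qed
  qed (simp add: I_def)
  then have "(\<integral>\<^sup>+ u. ennreal (poisson_kernel r t u) * h u \<partial>\<mu>) \<le>
      (\<integral>\<^sup>+ s. l * (\<integral>\<^sup>+ u. I s u * 1 \<partial>\<mu>) \<partial>lborel)"
    unfolding layer[OF h] by (intro nn_integral_mono) auto
  also have "\<dots> = l * (\<integral>\<^sup>+ s. (\<integral>\<^sup>+ u. I s u * 1 \<partial>\<mu>) \<partial>lborel)"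
    by (rule nn_integral_cmult) (use Im in measurable)
  \<comment> \<open>The layer cake formula read backwards with weight 1: the measures of the arcs
    add up to the mass of the kernel, which is 1.\<close>
  also have "\<dots> = l * (\<integral>\<^sup>+ u. ennreal (poisson_kernel r t u) * 1 \<partial>\<mu>)"
    by (subst layer) auto
  also have "\<dots> = l" by (simp add: nn_integral_poisson_kernel[OF t r])
  finally show ?thesis .
qed

lemma integrable_poisson:
  fixes f :: "complex \<Rightarrow> complex"
  assumes f: "integrable \<mu> f" and t: "cmod t = 1" and r: "0 \<le> r" "r < 1"
  shows "integrable \<mu> (\<lambda>u. of_real (poisson_kernel r t u) * f u)"
  by (subst mult.commute, rule integrable_circle_mult_bounded[OF f, where B = "2 / (1 - r)"])
    (measurable, use poisson_kernel_le[OF t _ r] poisson_kernel_pos[OF t _ r] in \<open>simp add: abs_of_pos\<close>)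

lemma norm_poisson_le:
  assumes f: "integrable \<mu> f" and t: "cmod t = 1" and r: "0 \<le> r" "r < 1"
  shows "ennreal (cmod (poisson f r t)) \<le> (\<integral>\<^sup>+ u. ennreal (poisson_kernel r t u) * ennreal (cmod (f u)) \<partial>\<mu>)"
proof -
  have "ennreal (cmod (poisson f r t)) \<le> (\<integral>\<^sup>+ u. cmod (of_real (poisson_kernel r t u) * f u) \<partial>\<mu>)"
    unfolding poisson_def by (rule integral_norm_bound_ennreal[OF integrable_poisson[OF assms]])
  also have "\<dots> = (\<integral>\<^sup>+ u. ennreal (poisson_kernel r t u) * ennreal (cmod (f u)) \<partial>\<mu>)"
  proof (rule nn_integral_cong)
    fix u assume "u \<in> space \<mu>"
    then have "0 < poisson_kernel r t u" using poisson_kernel_pos[OF t _ r] by simp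
    then show "ennreal (cmod (of_real (poisson_kernel r t u) * f u)) = ennreal (poisson_kernel r t u) * ennreal (cmod (f u))"
      by (simp add: norm_mult ennreal_mult')
  qed
  finally show ?thesis .
qed

lemma poisson_tendsto_continuous:
  assumes g: "continuous_on UNIV g" and t: "cmod t = 1"
  shows "((\<lambda>r. poisson g r t) \<longlongrightarrow> g t) (at_left 1)"
proof (rule tendstoI)
  fix e :: real assume e: "0 < e"
  have gc: "continuous_on (sphere 0 1) g" using g by (rule continuous_on_subset) simp
  have gi: "integrable \<mu> g" by (rule integrable_continuous_circle[OF gc])
  have "continuous_on (sphere 0 1) (\<lambda>u. g u - g t)" using gc by (intro continuous_intros)
  then obtain B where B: "\<And>u. cmod u = 1 \<Longrightarrow> norm (g u - g t) \<le> B" "0 \<le> B"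
    using continuous_on_circle_bounded by blast
  have "isCont g t" using g by (simp add: continuous_on_eq_continuous_at)
  then obtain d where d: "0 < d" "\<And>u. dist u t < d \<Longrightarrow> dist (g u) (g t) < e / 2"
    unfolding continuous_at_eps_delta using e by (meson half_gt_zero)
  \<comment> \<open>The two contributions to the error: e/2 from points within distance d of t, by
    continuity, and the rest from points farther away, where the kernel is at most (1 - r^2)/(r d^2)
    and g deviates by at most B.\<close>
  have "((\<lambda>r::real. e / 2 + B * (1 - r\<^sup>2) / (r * d\<^sup>2)) \<longlongrightarrow> e / 2 + B * (1 - 1\<^sup>2) / (1 * d\<^sup>2)) (at_left 1)"
    using d by (intro tendsto_intros) auto
  then have "((\<lambda>r::real. e / 2 + B * (1 - r\<^sup>2) / (r * d\<^sup>2)) \<longlongrightarrow> e / 2) (at_left 1)" by simp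
  then have ev: "\<forall>\<^sub>F r in at_left 1. e / 2 + B * (1 - r\<^sup>2) / (r * d\<^sup>2) < e"
    by (rule order_tendstoD) (use e in simp)
  have ev1: "\<forall>\<^sub>F r::real in at_left 1. 0 < r \<and> r < 1"
    by (rule eventually_at_leftI[of 0]) auto
  show "\<forall>\<^sub>F r in at_left 1. dist (poisson g r t) (g t) < e"
    using ev ev1
  proof eventually_elim
    case (elim r)
    then have r: "0 \<le> r" "r < 1" "0 < r" by auto
    have pk: "0 < poisson_kernel r t u" if "cmod u = 1" for u using poisson_kernel_pos[OF t that r(1,2)] .
    have int: "integrable \<mu> (poisson_kernel r t)"
      by (rule integrable_circle_bounded[where B = "2 / (1 - r)"])
        (use poisson_kernel_le[OF t _ r(1,2)] pk in \<open>auto simp: less_imp_le\<close>)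
    have "poisson g r t - g t = (\<integral>u. of_real (poisson_kernel r t u) * g u - of_real (poisson_kernel r t u) * g t \<partial>\<mu>)"
      using integrable_poisson[OF gi t r(1,2)] int
      by (subst Bochner_Integration.integral_diff) (simp_all add: poisson_def integral_poisson_kernel[OF t r(1,2)])
    also have "norm \<dots> \<le> (\<integral>u. e / 2 * poisson_kernel r t u + B * (1 - r\<^sup>2) / (r * d\<^sup>2) \<partial>\<mu>)"
    proof (rule order_trans[OF integral_norm_bound], rule integral_mono)
      show "integrable \<mu> (\<lambda>u. norm (of_real (poisson_kernel r t u) * g u - of_real (poisson_kernel r t u) * g t))"
        using integrable_poisson[OF gi t r(1,2)] int by auto
      show "integrable \<mu> (\<lambda>u. e / 2 * poisson_kernel r t u + B * (1 - r\<^sup>2) / (r * d\<^sup>2))"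
        using int by auto
      fix u assume "u \<in> space \<mu>"
      then have u: "cmod u = 1" by simp
      have n: "norm (of_real (poisson_kernel r t u) * g u - of_real (poisson_kernel r t u) * g t) =
          poisson_kernel r t u * norm (g u - g t)"
        using pk[OF u] by (simp add: norm_mult flip: right_diff_distrib)
      have nn: "0 \<le> B * (1 - r\<^sup>2) / (r * d\<^sup>2)"
        using B(2) r d by (auto intro!: divide_nonneg_nonneg mult_nonneg_nonneg simp: power_le_one)
      show "norm (of_real (poisson_kernel r t u) * g u - of_real (poisson_kernel r t u) * g t) \<le>
          e / 2 * poisson_kernel r t u + B * (1 - r\<^sup>2) / (r * d\<^sup>2)"
      proof (cases "dist u t < d")
        case True
        then have "norm (g u - g t) \<le> e / 2" using d(2)[of u] by (simp add: dist_norm)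
        then have "poisson_kernel r t u * norm (g u - g t) \<le> poisson_kernel r t u * (e / 2)"
          using pk[OF u] by (intro mult_left_mono) auto
        then show ?thesis unfolding n using nn by (simp add: mult.commute)
      next
        case False
        have "0 \<le> 1 - r\<^sup>2" using r by (simp add: power_le_one)
        moreover have "d\<^sup>2 \<le> (dist u t)\<^sup>2" using False d(1) by (intro power_mono) auto
        then have "r * d\<^sup>2 \<le> r * (dist u t)\<^sup>2" using r by (intro mult_left_mono) auto
        then have "r * d\<^sup>2 \<le> (1 - r)\<^sup>2 + r * (dist u t)\<^sup>2" by (smt (verit) zero_le_power2)
        ultimately have "poisson_kernel r t u \<le> (1 - r\<^sup>2) / (r * d\<^sup>2)"
          unfolding poisson_kernel_eq[OF t u r(1,2)] using r d by (intro frac_le) auto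
        then have "poisson_kernel r t u * norm (g u - g t) \<le> (1 - r\<^sup>2) / (r * d\<^sup>2) * B"
          using B(1)[OF u] pk[OF u] by (intro mult_mono) auto
        then show ?thesis unfolding n using pk[OF u] e by (simp add: mult.commute add_increasing)
      qed
    qed
    also have "\<dots> = e / 2 + B * (1 - r\<^sup>2) / (r * d\<^sup>2)"
      using int circle.prob_space by (simp add: integral_poisson_kernel[OF t r(1,2)])
    finally show ?case using elim by (simp add: dist_norm)
  qed
qed

section \<open>Density of the continuous functions in L^1 of the circle\<close>

lemma integral_norm_diff_triangle:
  fixes f g h :: "'a \<Rightarrow> 'b::{banach, second_countable_topology}"
  assumes "integrable M f" "integrable M g" "integrable M h"
  shows "(\<integral>t. norm (f t - h t) \<partial>M) \<le> (\<integral>t. norm (f t - g t) \<partial>M) + (\<integral>t. norm (g t - h t) \<partial>M)"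
proof -
  have "(\<integral>t. norm (f t - h t) \<partial>M) \<le> (\<integral>t. norm (f t - g t) + norm (g t - h t) \<partial>M)"
  proof (rule integral_mono)
    show "norm (f t - h t) \<le> norm (f t - g t) + norm (g t - h t)" for t
      using norm_triangle_ineq[of "f t - g t" "g t - h t"] by simp
  qed (use assms in auto)
  also have "\<dots> = (\<integral>t. norm (f t - g t) \<partial>M) + (\<integral>t. norm (g t - h t) \<partial>M)"
    using assms by (intro Bochner_Integration.integral_add) auto
  finally show ?thesis .
qed

lemma indicator_compact_approx:
  fixes K :: "complex set"
  assumes K: "compact K" and e: "0 < e"
  shows "\<exists>g. continuous_on UNIV g \<and> (\<integral>t. cmod (indicator K t - g t) \<partial>\<mu>) < e"
proof (cases "K = {}")
  case True
  then show ?thesis using e by (intro exI[of _ "\<lambda>_. 0"]) simp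
next
  case False
  \<comment> \<open>Equal to 1 on K and decreasing linearly in the distance to K, reaching 0 at
    distance 1/n for n > 0. Off the closed set K the distance is positive, so the functions
    eventually vanish there.\<close>
  define g :: "nat \<Rightarrow> complex \<Rightarrow> complex" where "g n t = of_real (max 0 (1 - real n * infdist t K))" for n t
  have gc: "continuous_on UNIV (g n)" for n
    unfolding g_def by (intro continuous_intros)
  have cl: "closed K" using K by (rule compact_imp_closed)
  have [measurable]: "K \<in> sets borel" using cl by simp
  have Km: "(indicator K :: complex \<Rightarrow> complex) \<in> borel_measurable \<mu>" by (rule borel_measurable_circle) measurable
  have gm: "g n \<in> borel_measurable \<mu>" for n
    using integrable_continuous_circle[OF continuous_on_subset[OF gc subset_UNIV]] by (rule borel_measurable_integrable)
  have lim: "(\<lambda>n. cmod (indicator K t - g n t)) \<longlonglongrightarrow> 0" for t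
  proof (cases "t \<in> K")
    case True
    then show ?thesis by (simp add: g_def)
  next
    case f: False
    then have pos: "0 < infdist t K" using cl False
      by (metis in_closed_iff_infdist_zero infdist_nonneg less_eq_real_def)
    have "\<forall>\<^sub>F n in sequentially. 1 / infdist t K \<le> real n" by (rule eventually_sequentiallyI[of "nat \<lceil>1 / infdist t K\<rceil>"]) linarith
    then have "\<forall>\<^sub>F n in sequentially. cmod (indicator K t - g n t) = 0"
      by eventually_elim (use pos f in \<open>simp add: g_def field_simps\<close>)
    then show ?thesis by (rule tendsto_eventually)
  qed
  have "(\<lambda>n. \<integral>t. cmod (indicator K t - g n t) \<partial>\<mu>) \<longlonglongrightarrow> (\<integral>t. 0 \<partial>\<mu>)"
  proof (rule integral_dominated_convergence[where w = "\<lambda>_. 2"])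
    fix n show "AE t in \<mu>. norm (cmod (indicator K t - g n t)) \<le> 2"
    proof (rule AE_I2)
      fix t
      have "cmod (indicator K t - g n t) \<le> cmod (indicator K t) + cmod (g n t)" by (rule norm_triangle_ineq4)
      also have "\<dots> \<le> 1 + 1"
        by (intro add_mono) (auto simp: indicator_def g_def infdist_nonneg)
      finally show "norm (cmod (indicator K t - g n t)) \<le> 2" by simp
    qed
  qed (use lim Km gm in auto)
  then have "\<forall>\<^sub>F n in sequentially. (\<integral>t. cmod (indicator K t - g n t) \<partial>\<mu>) < e"
    using e by (intro order_tendstoD(2)) auto
  then show ?thesis using gc by (auto simp: eventually_sequentially)
qed

text \<open>Because \<open>circle_measure\<close> is a completion, a measurable set is Borel only up
  to a null set. Passing to the Borel set opens the way to inner regularity.\<close>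

lemma sets_circle_borel:
  assumes "A \<in> sets \<mu>"
  obtains B where "B \<in> sets borel" "AE t in \<mu>. t \<in> A \<longleftrightarrow> t \<in> B"
proof -
  let ?M = "distr (uniform_measure lborel {0..<2*pi}) (restrict_space borel (sphere 0 1)) cis"
  obtain S N N' where A: "A = S \<union> N" "N \<subseteq> N'" "N' \<in> null_sets ?M" "S \<in> sets ?M"
    using assms unfolding circle_measure_def by (rule sets_completionE)
  have "S \<in> sets borel" using A(4) by (auto simp: sets_restrict_space)
  moreover have "AE t in ?M. t \<notin> N'" using A(3) by (rule AE_not_in)
  then have "AE t in \<mu>. t \<notin> N'" unfolding circle_measure_def by (rule AE_completion)
  then have "AE t in \<mu>. t \<in> A \<longleftrightarrow> t \<in> S" by eventually_elim (use A in auto)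
  ultimately show ?thesis by (rule that)
qed

lemma indicator_approx:
  assumes A: "A \<in> sets \<mu>" and e: "0 < e"
  shows "\<exists>g. continuous_on UNIV g \<and> (\<integral>t. cmod (indicator A t - g t) \<partial>\<mu>) < e"
proof -
  obtain B where B: "B \<in> sets borel" "AE t in \<mu>. t \<in> A \<longleftrightarrow> t \<in> B"
    using sets_circle_borel[OF A] .
  \<comment> \<open>Inner regularity is a statement about finite measures on the Borel sets of the
    whole plane, so the circle measure is pushed forward to the plane.\<close>
  let ?M = "distr \<mu> borel (\<lambda>t. t)"
  have em: "emeasure ?M C = emeasure \<mu> (C \<inter> sphere 0 1)" if "C \<in> sets borel" for C
    using that by (subst emeasure_distr[OF id_circle_measurable]) (auto simp: Int_commute)
  have "emeasure ?M B = (SUP K \<in> {K. K \<subseteq> B \<and> compact K}. emeasure ?M K)"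
    by (rule inner_regular) (use B in \<open>auto simp: em circle.emeasure_eq_measure\<close>)
  then have "emeasure \<mu> (B \<inter> sphere 0 1) = (SUP K \<in> {K. K \<subseteq> B \<and> compact K}. emeasure ?M K)"
    using em B by simp
  moreover have "\<exists>K\<in>{K. K \<subseteq> B \<and> compact K}. emeasure \<mu> (B \<inter> sphere 0 1) < emeasure ?M K + ennreal (e/2)"
  proof (rule SUP_approx_ennreal)
    show "emeasure \<mu> (B \<inter> sphere 0 1) = (SUP K \<in> {K. K \<subseteq> B \<and> compact K}. emeasure ?M K)"
      by fact
  qed (use e in \<open>auto simp: circle.emeasure_eq_measure\<close>)
  ultimately obtain K where K: "K \<subseteq> B" "compact K"
    "emeasure \<mu> (B \<inter> sphere 0 1) < emeasure \<mu> (K \<inter> sphere 0 1) + ennreal (e/2)"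
    using em by (force simp: borel_compact)
  have [measurable]: "B \<inter> sphere 0 1 \<in> sets \<mu>" "K \<inter> sphere 0 1 \<in> sets \<mu>"
    using B K by (auto intro!: sets_circle_Int borel_compact)
  have "measure \<mu> (B \<inter> sphere 0 1) < measure \<mu> (K \<inter> sphere 0 1) + e/2"
    using K(3) e by (simp add: circle.emeasure_eq_measure ennreal_less_iff flip: ennreal_plus)
  then have d: "measure \<mu> (B \<inter> sphere 0 1 - K \<inter> sphere 0 1) < e / 2"
    using K(1) by (subst circle.finite_measure_Diff) auto
  obtain g where g: "continuous_on UNIV g" "(\<integral>t. cmod (indicator K t - g t) \<partial>\<mu>) < e / 2"
    using indicator_compact_approx[OF K(2), of "e/2"] e by auto
  have Ki: "integrable \<mu> (indicator K :: complex \<Rightarrow> complex)"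
    by (rule integrable_circle_bounded[where B = 1])
      (use borel_compact[OF K(2)] in \<open>auto intro: borel_measurable_circle simp: indicator_def\<close>)
  have Ai: "integrable \<mu> (indicator A :: complex \<Rightarrow> complex)"
    by (rule integrable_circle_bounded[where B = 1]) (use A in \<open>auto simp: indicator_def\<close>)
  have "(\<integral>t. cmod (indicator A t - indicator K t) \<partial>\<mu>) =
     (\<integral>t. indicator (B \<inter> sphere 0 1 - K \<inter> sphere 0 1) t \<partial>\<mu>)"
  proof (rule integral_cong_AE)
    show "AE t in \<mu>. cmod (indicator A t - indicator K t) = indicator (B \<inter> sphere 0 1 - K \<inter> sphere 0 1) t"
      using B(2) AE_space by eventually_elim (use K(1) in \<open>auto simp: indicator_def\<close>)
  qed (use Ki Ai in auto)
  also have "\<dots> = measure \<mu> ((B \<inter> sphere 0 1 - K \<inter> sphere 0 1) \<inter> sphere 0 1)" by simp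
  also have "(B \<inter> sphere 0 1 - K \<inter> sphere 0 1) \<inter> sphere 0 1 = B \<inter> sphere 0 1 - K \<inter> sphere 0 1" by auto
  also note d
  finally have "(\<integral>t. cmod (indicator A t - indicator K t) \<partial>\<mu>) < e / 2" .
  then show ?thesis
    using integral_norm_diff_triangle[OF Ai Ki integrable_continuous_circle[OF continuous_on_subset[OF g(1) subset_UNIV]]] g by (intro exI[of _ g]) auto
qed

lemma integrable_circle_approx:
  fixes f :: "complex \<Rightarrow> complex"
  assumes "integrable \<mu> f"
  shows "0 < e \<Longrightarrow> \<exists>g. continuous_on UNIV g \<and> (\<integral>t. cmod (f t - g t) \<partial>\<mu>) < e"
  using assms
proof (induction f arbitrary: e rule: integrable_induct)
  case (base A c)
  define d where "d = e / (cmod c + 1)"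
  have d: "0 < d" using base(3) by (simp add: d_def add_nonneg_pos)
  obtain g where g: "continuous_on UNIV g" "(\<integral>t. cmod (indicator A t - g t) \<partial>\<mu>) < d"
    using indicator_approx[OF base(1) d] by auto
  have "(\<integral>t. cmod (indicat_real A t *\<^sub>R c - g t * c) \<partial>\<mu>) = (\<integral>t. cmod (indicator A t - g t) * cmod c \<partial>\<mu>)"
    by (rule Bochner_Integration.integral_cong) (auto simp: indicator_def norm_mult left_diff_distrib simp flip: norm_mult)
  also have "\<dots> = (\<integral>t. cmod (indicator A t - g t) \<partial>\<mu>) * cmod c" by simp
  also have "\<dots> \<le> d * cmod c" using g by (intro mult_right_mono) auto
  also have "\<dots> < d * (cmod c + 1)" using d by simp
  also have "\<dots> = e" by (simp add: d_def add_nonneg_eq_0_iff)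
  finally show ?case using g(1) by (intro exI[of _ "\<lambda>t. g t * c"]) (auto intro!: continuous_intros)
next
  case (add f g)
  obtain a where a: "continuous_on UNIV a" "(\<integral>t. cmod (f t - a t) \<partial>\<mu>) < e / 2"
    using add(3)[of "e/2"] add(5) by auto
  obtain b where b: "continuous_on UNIV b" "(\<integral>t. cmod (g t - b t) \<partial>\<mu>) < e / 2"
    using add(4)[of "e/2"] add(5) by auto
  note ai = integrable_continuous_circle[OF continuous_on_subset[OF a(1) subset_UNIV]] and bi = integrable_continuous_circle[OF continuous_on_subset[OF b(1) subset_UNIV]]
  have "(\<integral>t. cmod (f t + g t - (a t + b t)) \<partial>\<mu>) \<le> (\<integral>t. cmod (f t - a t) + cmod (g t - b t) \<partial>\<mu>)"
    using add(1,2) ai bi by (intro integral_mono) (auto simp: norm_diff_triangle_ineq)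
  also have "\<dots> = (\<integral>t. cmod (f t - a t) \<partial>\<mu>) + (\<integral>t. cmod (g t - b t) \<partial>\<mu>)"
    using add(1,2) ai bi by (intro Bochner_Integration.integral_add) auto
  also have "\<dots> < e" using a b by simp
  finally show ?case using a b by (intro exI[of _ "\<lambda>t. a t + b t"]) (auto intro!: continuous_intros)
next
  case (lim f s)
  have "(\<lambda>i. \<integral>t. cmod (f t - s i t) \<partial>\<mu>) \<longlonglongrightarrow> (\<integral>t. 0 \<partial>\<mu>)"
  \<comment> \<open>The simple approximants are bounded by 2 |f|, hence the differences by 3
    |f|.\<close>
  proof (rule integral_dominated_convergence[where w = "\<lambda>t. 3 * cmod (f t)"])
    show "AE t in \<mu>. (\<lambda>i. cmod (f t - s i t)) \<longlonglongrightarrow> 0"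
    proof (rule AE_I2)
      fix t assume "t \<in> space \<mu>"
      then have "(\<lambda>i. s i t) \<longlonglongrightarrow> f t" by (rule lim(2))
      then have "(\<lambda>i. cmod (f t - s i t)) \<longlonglongrightarrow> cmod (f t - f t)" by (intro tendsto_intros)
      then show "(\<lambda>i. cmod (f t - s i t)) \<longlonglongrightarrow> 0" by simp
    qed
    fix i show "AE t in \<mu>. norm (cmod (f t - s i t)) \<le> 3 * cmod (f t)"
    proof (rule AE_I2)
      fix t assume "t \<in> space \<mu>"
      then show "norm (cmod (f t - s i t)) \<le> 3 * cmod (f t)"
        using lim(3)[of t i] norm_triangle_ineq4[of "f t" "s i t"] by simp
    qed
  qed (use lim(1) lim(4) in auto)
  then have "\<forall>\<^sub>F i in sequentially. (\<integral>t. cmod (f t - s i t) \<partial>\<mu>) < e / 2"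
    using lim(6) by (intro order_tendstoD(2)) auto
  then obtain i where i: "(\<integral>t. cmod (f t - s i t) \<partial>\<mu>) < e / 2"
    by (auto simp: eventually_sequentially)
  obtain g where g: "continuous_on UNIV g" "(\<integral>t. cmod (s i t - g t) \<partial>\<mu>) < e / 2"
    using lim(5)[of "e/2" i] lim(6) by auto
  show ?case
    using integral_norm_diff_triangle[OF lim(4) lim(1)[of i] integrable_continuous_circle[OF continuous_on_subset[OF g(1) subset_UNIV]]] g i
    by (intro exI[of _ g]) auto
qed

text \<open>Split G into a continuous g, for which convergence holds at every point, and a remainder
  of small L^1 norm. The maximal estimate bounds all Poisson integrals of the remainder by l at
  once, outside a set of small measure; the remainder itself is below l outside another one.\<close>

theorem poisson_tendsto_AE:
  assumes G: "integrable \<mu> G"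
  shows "AE t in \<mu>. ((\<lambda>r. poisson G r t) \<longlongrightarrow> G t) (at_left 1)"
proof -
  have [measurable]: "G \<in> borel_measurable \<mu>" using G by auto
  have main: "AE t in \<mu>. \<forall>\<^sub>F r in at_left 1. dist (poisson G r t) (G t) < 3 * l" if l: "0 < l" for l
  proof -
    let ?bad = "{t \<in> space \<mu>. \<not> (\<forall>\<^sub>F r in at_left 1. dist (poisson G r t) (G t) < 3 * l)}"
    have "?bad \<in> null_sets \<mu>"
      \<comment> \<open>Measurability of the exceptional set is not known beforehand. In a complete
        measure space it is enough to cover the set by measurable sets of arbitrarily small
        measure.\<close>
      unfolding circle_measure_def completion.null_sets_outer unfolding circle_measure_def[symmetric]
    proof (intro allI impI)
      fix e :: real assume e: "0 < e"
      \<comment> \<open>The constant 41 is 40 from the maximal estimate for A plus 1 from Markov's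
        inequality for D.\<close>
      obtain g where g: "continuous_on UNIV g" "(\<integral>t. cmod (G t - g t) \<partial>\<mu>) < e * l / 41"
        using integrable_circle_approx[OF G, of "e * l / 41"] e l by auto
      note gi = integrable_continuous_circle[OF continuous_on_subset[OF g(1) subset_UNIV]]
      have [measurable]: "g \<in> borel_measurable \<mu>" using gi by auto
      let ?h = "\<lambda>t. ennreal (cmod (G t - g t))"
      define H where "H = (\<integral>t. cmod (G t - g t) \<partial>\<mu>)"
      have H0: "0 \<le> H" by (simp add: H_def)
      have H: "(\<integral>\<^sup>+ t. ?h t \<partial>\<mu>) = ennreal H"
        unfolding H_def using G gi by (intro nn_integral_eq_integral) auto
      obtain A where A: "A \<in> sets \<mu>" "ennreal l * emeasure \<mu> A \<le> 40 * (\<integral>\<^sup>+ t. ?h t \<partial>\<mu>)"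
        "\<And>t \<rho>. \<lbrakk>cmod t = 1; t \<notin> A; 0 < \<rho>; \<rho> \<le> 3\<rbrakk> \<Longrightarrow>
         (\<integral>\<^sup>+ u. ?h u * indicator (ball t \<rho> \<inter> sphere 0 1) u \<partial>\<mu>) \<le> ennreal l * emeasure \<mu> (ball t \<rho> \<inter> sphere 0 1)"
        by (rule maximal_weak_type[of ?h "ennreal l"]) auto
      define D where "D = {t \<in> space \<mu>. l \<le> cmod (G t - g t)}"
      have [measurable]: "D \<in> sets \<mu>" unfolding D_def by measurable
      have "ennreal (l * measure \<mu> A) \<le> ennreal (40 * H)"
        using A(2) l H0 unfolding H circle.emeasure_eq_measure by (simp add: ennreal_mult')
      then have mA: "l * measure \<mu> A \<le> 40 * H" using H0 by simp
      have mD: "l * measure \<mu> D \<le> H"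
        using integral_Markov_inequality_measure[of \<mu> "\<lambda>t. cmod (G t - g t)" "{}" l] G gi l
        by (simp add: D_def H_def field_simps)
      have "l * measure \<mu> (A \<union> D) \<le> l * (measure \<mu> A + measure \<mu> D)"
        using A(1) l by (intro mult_left_mono measure_Un_le) auto
      also have "\<dots> \<le> 41 * H" using mA mD by (simp add: distrib_left)
      also have "\<dots> < e * l" using g(2) by (simp add: H_def)
      finally have lt: "measure \<mu> (A \<union> D) < e" using l by (simp add: mult.commute)
      have sub: "?bad \<subseteq> A \<union> D"
      proof
        fix t assume bad: "t \<in> ?bad"
        then have t: "cmod t = 1" by simp
        show "t \<in> A \<union> D"
        proof (rule ccontr)
          assume n: "t \<notin> A \<union> D"
          have 1: "cmod (G t - g t) < l" using n t by (simp add: D_def)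
          have 2: "cmod (poisson (\<lambda>t. G t - g t) r t) \<le> l" if r: "0 \<le> r" "r < 1" for r
          proof -
            have "ennreal (cmod (poisson (\<lambda>t. G t - g t) r t)) \<le> ennreal l"
              using norm_poisson_le[of "\<lambda>t. G t - g t" t r] G gi t r
                poisson_le_maximal[of ?h t r "ennreal l"] A(3)[of t] n by (auto intro: order_trans)
            then show ?thesis using l by simp
          qed
          have 3: "poisson (\<lambda>t. G t - g t) r t = poisson G r t - poisson g r t" if "0 \<le> r" "r < 1" for r
            unfolding poisson_def right_diff_distrib
            by (rule Bochner_Integration.integral_diff[OF integrable_poisson[OF G t that] integrable_poisson[OF gi t that]])
          have "\<forall>\<^sub>F r in at_left 1. dist (poisson g r t) (g t) < l"
            using tendstoD[OF poisson_tendsto_continuous[OF g(1) t] l] .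
          moreover have "\<forall>\<^sub>F r::real in at_left 1. 0 \<le> r \<and> r < 1"
            by (rule eventually_at_leftI[of 0]) auto
          ultimately have "\<forall>\<^sub>F r in at_left 1. dist (poisson G r t) (G t) < 3 * l"
          proof eventually_elim
            case (elim r)
            have "poisson G r t - G t = poisson (\<lambda>t. G t - g t) r t + (poisson g r t - g t) - (G t - g t)"
              using 3 elim by simp
            also have "cmod \<dots> \<le> cmod (poisson (\<lambda>t. G t - g t) r t) + cmod (poisson g r t - g t) + cmod (G t - g t)"
              by (intro order_trans[OF norm_triangle_ineq4] add_right_mono norm_triangle_ineq)
            also have "\<dots> < 3 * l" using 1 2[of r] elim by (simp add: dist_norm)
            finally show ?case by (simp add: dist_norm)
          qed
          then show False using bad by simp
        qed
      qed
      show "\<exists>T\<in>fmeasurable \<mu>. ?bad \<subseteq> T \<and> measure \<mu> T < e"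
        by (rule bexI[of _ "A \<union> D"]) (use sub lt A(1) in \<open>auto simp: circle.fmeasurable_eq_sets\<close>)
    qed
    then show ?thesis by (rule AE_I') auto
  qed
  have "AE t in \<mu>. \<forall>n. \<forall>\<^sub>F r in at_left 1. dist (poisson G r t) (G t) < 3 * (1 / real (Suc n))"
    unfolding AE_all_countable by (intro allI main) simp
  then show ?thesis
  proof eventually_elim
    case (elim t)
    show ?case
    proof (rule tendstoI)
      fix e :: real assume "0 < e"
      then obtain n where "inverse (real (Suc n)) < e / 3" using reals_Archimedean[of "e/3"] by auto
      then have "3 * (1 / real (Suc n)) < e" by (simp add: inverse_eq_divide)
      then show "\<forall>\<^sub>F r in at_left 1. dist (poisson G r t) (G t) < e"
        using spec[OF elim, of n] by (auto elim: eventually_mono)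
    qed
  qed
qed

subsection \<open>The M. Riesz theorem\<close>

text \<open>The inequality behind the M. Riesz theorem: since \<open>cos (p * \<theta>)\<close> is negative near \<open>\<plusminus>pi/2\<close>,
  the function \<open>\<bar>z\<bar> powr p\<close> is dominated on the right half plane by a multiple of \<open>(Re z) powr p\<close>
  minus a multiple of a harmonic function.\<close>

lemma riesz_trig_inequality:
  fixes p :: real
  assumes p: "1 < p" "p < 2"
  shows "\<exists>A B. 0 \<le> A \<and> 0 \<le> B \<and> (\<forall>\<theta>. \<bar>\<theta>\<bar> < pi/2 \<longrightarrow> 1 \<le> A * cos \<theta> powr p - B * cos (p * \<theta>))"
proof -
  \<comment> \<open>The midpoint of pi/(2p) and pi/2. From here up to pi/2 the angle p \<theta> lies
    between pi/2 and pi, where the cosine is negative and decreasing, so B can be fixed to give -B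
    cos(p \<theta>) at least 1. Below this point cos \<theta> stays away from 0, and A is then taken
    large enough to outweigh B as well.\<close>
  define \<theta>0 where "\<theta>0 = (pi / (2 * p) + pi / 2) / 2"
  have lt: "pi / (2 * p) < pi / 2" using p by (simp add: field_simps)
  have \<theta>0: "pi / (2 * p) < \<theta>0" "\<theta>0 < pi / 2" 
  proof -
    have "x < (x + y) / 2" "(x + y) / 2 < y" if "x < y" for x y :: real using that by auto
    then show "pi / (2 * p) < \<theta>0" "\<theta>0 < pi / 2" unfolding \<theta>0_def using lt by blast+
  qed
  have p0: "pi / 2 < p * \<theta>0" using \<theta>0(1) p by (simp add: field_simps)
  have p1: "p * \<theta>0 < pi" using \<theta>0(2) p mult_strict_mono[of p 2 \<theta>0 "pi/2"] p0 by (simp add: \<theta>0_def)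
  have neg: "cos (p * \<theta>0) < 0"
    using cos_monotone_0_pi[of "pi/2" "p * \<theta>0"] p0 p1 by simp
  have pos: "0 < cos \<theta>0" 
  proof (rule cos_gt_zero_pi)
    have "0 < pi / (2 * p)" using p by simp
    then show "- (pi / 2) < \<theta>0" using \<theta>0(1) pi_gt_zero by linarith
  qed (rule \<theta>0(2))
  define B where "B = 1 / (- cos (p * \<theta>0))"
  define A where "A = (1 + B) / cos \<theta>0 powr p"
  have B: "0 \<le> B" using neg by (simp add: B_def)
  have A: "0 \<le> A" using B by (simp add: A_def)
  have main: "1 \<le> A * cos \<theta> powr p - B * cos (p * \<theta>)" if \<theta>: "0 \<le> \<theta>" "\<theta> < pi/2" for \<theta>
  proof (cases "\<theta>0 \<le> \<theta>")
    case True
    have "p * \<theta>0 \<le> p * \<theta>" "p * \<theta> \<le> pi"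
      using True p \<theta> mult_mono[of p 2 \<theta> "pi/2"] by auto
    then have "cos (p * \<theta>) \<le> cos (p * \<theta>0)" using p0 by (intro cos_monotone_0_pi_le) auto
    then have "1 \<le> B * (- cos (p * \<theta>))" using neg by (simp add: B_def field_simps)
    moreover have "0 \<le> A * cos \<theta> powr p" using A by simp
    ultimately show ?thesis by simp
  next
    case False
    then have "cos \<theta>0 \<le> cos \<theta>" using \<theta> \<theta>0 by (intro cos_monotone_0_pi_le) auto
    then have "cos \<theta>0 powr p \<le> cos \<theta> powr p" using pos p by (intro powr_mono2) auto
    then have "A * cos \<theta>0 powr p \<le> A * cos \<theta> powr p" using A by (rule mult_left_mono)
    moreover have "A * cos \<theta>0 powr p = 1 + B" using pos by (simp add: A_def)
    moreover have "B * cos (p * \<theta>) \<le> B * 1" using B by (intro mult_left_mono) auto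
    ultimately show ?thesis by simp
  qed
  show ?thesis
  proof (intro exI conjI allI impI)
    show "0 \<le> A" "0 \<le> B" by fact+
    fix \<theta> :: real assume "\<bar>\<theta>\<bar> < pi/2"
    then show "1 \<le> A * cos \<theta> powr p - B * cos (p * \<theta>)"
      using main[of "\<bar>\<theta>\<bar>"] by (cases "0 \<le> \<theta>") (auto simp: abs_if)
  qed
qed

text \<open>Multiply the trigonometric inequality at the argument \<theta> of z by |z|^p. Then |z|^p
  cos(p \<theta>) is the real part of the analytic branch of z^p, hence harmonic.\<close>

lemma riesz_pointwise:
  fixes p :: real
  assumes p: "1 < p" "p < 2"
  shows "\<exists>A B. 0 \<le> A \<and> 0 \<le> B \<and>
    (\<forall>z. 0 < Re z \<longrightarrow> cmod z powr p \<le> A * Re z powr p - B * Re (exp (of_real p * Ln z)))"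
proof -
  obtain A B where AB: "0 \<le> A" "0 \<le> B"
    "\<And>\<theta>. \<bar>\<theta>\<bar> < pi/2 \<Longrightarrow> 1 \<le> A * cos \<theta> powr p - B * cos (p * \<theta>)"
    using riesz_trig_inequality[OF p] by blast
  show ?thesis
  proof (intro exI conjI allI impI)
    show "0 \<le> A" "0 \<le> B" by fact+
    fix z assume z: "0 < Re z"
    then have z0: "z \<noteq> 0" by auto
    define \<theta> where "\<theta> = Im (Ln z)"
    have \<theta>: "\<bar>\<theta>\<bar> < pi/2" using Re_Ln_pos_lt_imp[OF z] by (simp add: \<theta>_def)
    have "Re z = Re (exp (Ln z))" using z0 by simp
    also have "\<dots> = cmod z * cos \<theta>" using z0 by (simp only: Re_exp \<theta>_def) simp
    finally have re: "Re z = cmod z * cos \<theta>" .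
    have "exp (p * ln (cmod z)) = cmod z powr p" using z0 by (simp add: powr_def)
    then have rp: "Re (exp (of_real p * Ln z)) = cmod z powr p * cos (p * \<theta>)"
      using z0 by (simp add: Re_exp \<theta>_def)
    have "cmod z powr p * 1 \<le> cmod z powr p * (A * cos \<theta> powr p - B * cos (p * \<theta>))"
      by (rule mult_left_mono[OF AB(3)[OF \<theta>]]) simp
    moreover have "0 \<le> cos \<theta>" using \<theta> by (intro cos_ge_zero) auto
    ultimately show "cmod z powr p \<le> A * Re z powr p - B * Re (exp (of_real p * Ln z))"
      unfolding rp unfolding re by (simp add: powr_mult algebra_simps)
  qed
qed

lemma circle_mean_value:
  assumes H: "H holomorphic_on ball 0 1" and r: "0 \<le> r" "r < 1"
  shows "(\<integral>t. H (of_real r * t) \<partial>\<mu>) = H 0"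
proof -
  define a where "a n = (deriv ^^ n) H 0 / fact n" for n
  have sums: "(\<lambda>n. a n * w ^ n) sums H w" if "cmod w < 1" for w
    using holomorphic_power_series[OF H, of w] that by (simp add: a_def)
  \<comment> \<open>Convergence of the power series at the larger radius R yields absolute
    convergence at radius r.\<close>
  obtain R where R: "r < R" "R < 1" using dense[OF r(2)] by auto
  have "fourier_coeff (\<lambda>t. H (of_real r * t)) 0 = (if (0::int) \<le> 0 then a (nat 0) * of_real r ^ nat 0 else 0)"
  proof (rule fourier_coeff_power_series)
    have "summable (\<lambda>n. a n * of_real R ^ n)"
      using sums[of "of_real R"] R r by (auto simp: sums_iff)
    then show "summable (\<lambda>n. cmod (a n * of_real r ^ n))"
      by (rule powser_insidea) (use R r in auto)
    fix t assume "cmod t = 1"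
    then show "(\<lambda>n. a n * of_real r ^ n * t ^ n) sums H (of_real r * t)"
      using sums[of "of_real r * t"] r by (simp add: norm_mult power_mult_distrib mult.assoc)
  qed
  then show ?thesis by (simp add: fourier_coeff_eq a_def)
qed

text \<open>Convexity: the tangent of x^p at y lies below the graph. It is Young's inequality for
  the conjugate exponent q = p/(p - 1), multiplied by p.\<close>

lemma powr_tangent:
  fixes x y p :: real
  assumes "1 < p" "0 \<le> x" "0 < y"
  shows "p * y powr (p - 1) * x - (p - 1) * y powr p \<le> x powr p"
proof -
  define q where "q = p / (p - 1)"
  have q: "1 < q" "1 / p + 1 / q = 1" using assms by (simp_all add: q_def field_simps)
  have "x * y powr (p - 1) \<le> x powr p / p + (y powr (p - 1)) powr q / q"
    by (rule Youngs_inequality) (use assms q in auto)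
  also have "(y powr (p - 1)) powr q = y powr p" using assms by (simp add: powr_powr q_def)
  finally have "p * (x * y powr (p - 1)) \<le> p * (x powr p / p + y powr p / q)"
    using assms by (intro mult_left_mono) auto
  also have "\<dots> = x powr p + (p - 1) * y powr p"
    using assms by (simp add: q_def distrib_left)
  finally show ?thesis by (simp add: algebra_simps)
qed

lemma integrable_of_powr:
  fixes f :: "complex \<Rightarrow> 'a::{banach, second_countable_topology}"
  assumes [measurable]: "f \<in> borel_measurable \<mu>"
    and f: "integrable \<mu> (\<lambda>t. norm (f t) powr p)" and p: "1 \<le> p"
  shows "integrable \<mu> f"
proof (rule Bochner_Integration.integrable_bound)
  show "integrable \<mu> (\<lambda>t. 1 + norm (f t) powr p)" using f by simp
  have "x \<le> 1 + x powr p" if "0 \<le> x" for x :: real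
  proof (cases "1 \<le> x")
    case True
    then have "x powr 1 \<le> x powr p" using p by (intro powr_mono) auto
    then show ?thesis using True by simp
  qed (simp add: add_increasing2)
  then show "AE t in \<mu>. norm (f t) \<le> norm (1 + norm (f t) powr p)" by (intro AE_I2) simp
qed measurable

lemma poisson_kernel_measurable_pair [measurable]:
  "(\<lambda>(t, u). poisson_kernel r t u) \<in> borel_measurable (\<mu> \<Otimes>\<^sub>M \<mu>)"
proof -
  have [measurable]: "fst \<in> borel_measurable (\<mu> \<Otimes>\<^sub>M \<mu>)"
    by (rule measurable_compose[OF measurable_fst id_circle_measurable])
  have [measurable]: "snd \<in> borel_measurable (\<mu> \<Otimes>\<^sub>M \<mu>)"
    by (rule measurable_compose[OF measurable_snd id_circle_measurable])
  show ?thesis unfolding poisson_kernel_def case_prod_beta' by measurable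
qed

text \<open>After exchanging the integrals, symmetry of the kernel makes the inner integral over t a
  total mass, which is 1.\<close>

lemma nn_integral_poisson_average:
  assumes [measurable]: "g \<in> borel_measurable \<mu>" and r: "0 \<le> r" "r < 1"
  shows "(\<integral>\<^sup>+ t. (\<integral>\<^sup>+ u. ennreal (poisson_kernel r t u) * g u \<partial>\<mu>) \<partial>\<mu>) = (\<integral>\<^sup>+ u. g u \<partial>\<mu>)"
proof -
  interpret pair_sigma_finite \<mu> \<mu>
    by (intro pair_sigma_finite.intro circle.sigma_finite_measure_axioms)
  have "(\<integral>\<^sup>+ t. (\<integral>\<^sup>+ u. ennreal (poisson_kernel r t u) * g u \<partial>\<mu>) \<partial>\<mu>) =
     (\<integral>\<^sup>+ u. (\<integral>\<^sup>+ t. ennreal (poisson_kernel r t u) * g u \<partial>\<mu>) \<partial>\<mu>)"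
    by (rule Fubini'[symmetric]) measurable
  also have "\<dots> = (\<integral>\<^sup>+ u. g u \<partial>\<mu>)"
  proof (rule nn_integral_cong)
    fix u assume "u \<in> space \<mu>"
    then have u: "cmod u = 1" by simp
    have "(\<integral>\<^sup>+ t. ennreal (poisson_kernel r t u) * g u \<partial>\<mu>) =
       (\<integral>\<^sup>+ t. ennreal (poisson_kernel r u t) * g u \<partial>\<mu>)"
      by (rule nn_integral_cong) (use u r in \<open>simp add: poisson_kernel_sym\<close>)
    also have "\<dots> = (\<integral>\<^sup>+ t. ennreal (poisson_kernel r u t) \<partial>\<mu>) * g u"
      by (rule nn_integral_multc) measurable
    finally show "(\<integral>\<^sup>+ t. ennreal (poisson_kernel r t u) * g u \<partial>\<mu>) = g u"
      by (simp add: nn_integral_poisson_kernel[OF u r])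
  qed
  finally show ?thesis .
qed

text \<open>Jensen's inequality for the probability density given by the kernel: integrate the
  tangent inequality at y, the average of f.\<close>

lemma poisson_jensen:
  fixes f :: "complex \<Rightarrow> real"
  assumes f: "integrable \<mu> f" "\<And>t. 0 \<le> f t" and fp: "integrable \<mu> (\<lambda>t. f t powr p)"
    and p: "1 < p" and t: "cmod t = 1" and r: "0 \<le> r" "r < 1"
    and y: "y = (\<integral>u. poisson_kernel r t u * f u \<partial>\<mu>)" "0 < y"
  shows "y powr p \<le> (\<integral>u. poisson_kernel r t u * f u powr p \<partial>\<mu>)"
proof -
  have ki: "integrable \<mu> (\<lambda>u. poisson_kernel r t u * g u)" if "integrable \<mu> g" for g :: "complex \<Rightarrow> real"
    using integrable_Re[OF integrable_poisson[of "\<lambda>u. of_real (g u)", OF _ t r]] that by simp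
  have i1: "integrable \<mu> (\<lambda>u. p * y powr (p - 1) * (poisson_kernel r t u * f u) - (p - 1) * y powr p * poisson_kernel r t u)"
    using ki[OF f(1)] ki[of "\<lambda>_. 1"] by auto
  have e: "y powr p = y powr (p - 1) * y"
    using powr_mult_base[of y "p - 1"] y(2) by (simp add: mult.commute)
  have "y powr p = p * y powr (p - 1) * y - (p - 1) * y powr p"
    by (simp add: e algebra_simps)
  also have "\<dots> = (\<integral>u. p * y powr (p - 1) * (poisson_kernel r t u * f u) - (p - 1) * y powr p * poisson_kernel r t u \<partial>\<mu>)"
    using ki[OF f(1)] ki[of "\<lambda>_. 1"]
    by (subst Bochner_Integration.integral_diff) (auto simp: integral_poisson_kernel[OF t r] simp flip: y(1))
  also have "\<dots> \<le> (\<integral>u. poisson_kernel r t u * f u powr p \<partial>\<mu>)"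
  proof (rule integral_mono[OF i1 ki[OF fp]])
    fix u assume "u \<in> space \<mu>"
    then have "0 < poisson_kernel r t u" using poisson_kernel_pos[OF t _ r] by simp
    then have "poisson_kernel r t u * (p * y powr (p - 1) * f u - (p - 1) * y powr p) \<le> poisson_kernel r t u * f u powr p"
      by (intro mult_left_mono powr_tangent p f y) auto
    then show "p * y powr (p - 1) * (poisson_kernel r t u * f u) - (p - 1) * y powr p * poisson_kernel r t u \<le> poisson_kernel r t u * f u powr p"
      by (simp add: algebra_simps)
  qed
  finally show ?thesis .
qed

lemma szego_0: "szego f 0 = (\<integral>u. f u \<partial>\<mu>)"
  by (simp add: szego_def)

text \<open>For f with positive mean, the function F here is the Poisson integral plus \<i> times
  its conjugate: analytic with positive real part, so F^p is analytic too. In the integral of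
  \<open>riesz_pointwise\<close> over a circle the harmonic term becomes its value at the centre,
  which has the favourable sign, and what remains is the p-th power of the Poisson integral,
  controlled by Jensen's inequality. The constant depends on p alone.\<close>

theorem riesz_nonneg:
  fixes f :: "complex \<Rightarrow> real" and p :: real
  assumes p: "1 < p" "p < 2"
  obtains A where "0 \<le> A" "\<And>f r. \<lbrakk>f \<in> borel_measurable \<mu>; \<And>t. 0 \<le> f t; integrable \<mu> (\<lambda>t. f t powr p); 0 \<le> r; r < 1\<rbrakk> \<Longrightarrow>
     (\<integral>t. cmod (2 * szego (\<lambda>u. of_real (f u)) (of_real r * t) - of_real (\<integral>u. f u \<partial>\<mu>)) powr p \<partial>\<mu>)
       \<le> A * (\<integral>t. f t powr p \<partial>\<mu>)"
proof -
  obtain A B where AB: "0 \<le> A" "0 \<le> B"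
    "\<And>z. 0 < Re z \<Longrightarrow> cmod z powr p \<le> A * Re z powr p - B * Re (exp (of_real p * Ln z))"
    using riesz_pointwise[OF p] by blast
  show ?thesis
  proof (rule that[OF AB(1)])
    fix f :: "complex \<Rightarrow> real" and r :: real
    assume fm [measurable]: "f \<in> borel_measurable \<mu>" and f0: "\<And>t. 0 \<le> f t"
      and fp: "integrable \<mu> (\<lambda>t. f t powr p)" and r: "0 \<le> r" "r < 1"
    have f: "integrable \<mu> f"
      by (rule integrable_of_powr[OF fm, where p = p]) (use fp f0 p in auto)
    then have fc: "integrable \<mu> (\<lambda>u. complex_of_real (f u))" by simp
    define c where "c = (\<integral>u. f u \<partial>\<mu>)"
    define F where "F z = 2 * szego (\<lambda>u. of_real (f u)) z - of_real c" for z
    have c0: "0 \<le> c" unfolding c_def using f0 by simp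
    have I0: "0 \<le> (\<integral>t. f t powr p \<partial>\<mu>)" by simp
    show "(\<integral>t. cmod (2 * szego (\<lambda>u. of_real (f u)) (of_real r * t) - of_real (\<integral>u. f u \<partial>\<mu>)) powr p \<partial>\<mu>)
       \<le> A * (\<integral>t. f t powr p \<partial>\<mu>)"
      unfolding c_def[symmetric] F_def[symmetric]
    \<comment> \<open>If the mean is 0 then f vanishes a.e. and so do its Cauchy integrals.
      Otherwise the real part of F is strictly positive, as the analyticity of \<open>Ln\<close>
      along F requires.\<close>
    proof (cases "c = 0")
      case True
      then have "AE t in \<mu>. f t = 0"
        using integral_nonneg_eq_0_iff_AE[OF f] f0 by (simp add: c_def)
      then have "szego (\<lambda>u. of_real (f u)) z = (\<integral>u. 0 \<partial>\<mu>)" for z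
        unfolding szego_def
        by (intro integral_cong_AE) (auto intro!: borel_measurable_divide borel_measurable_diff borel_measurable_times borel_measurable_cnj id_circle_measurable)
      then show "(\<integral>t. cmod (F (of_real r * t)) powr p \<partial>\<mu>) \<le> A * (\<integral>t. f t powr p \<partial>\<mu>)"
        using True AB(1) I0 by (simp add: F_def)
    next
      case False
      then have c: "0 < c" using c0 by simp
      have fc0: "fourier_coeff (\<lambda>u. of_real (f u)) 0 = of_real c"
        by (simp add: fourier_coeff_eq c_def)
      have FP: "F (of_real q * t) = poisson (\<lambda>u. of_real (f u)) q t + \<i> * conjugate_poisson (\<lambda>u. of_real (f u)) q t"
        if "cmod t = 1" "0 \<le> q" "q < 1" for q t
        using conjugate_poisson_eq_szego[OF fc that] by (simp add: F_def fc0)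
      have ReF: "Re (F (of_real q * t)) = (\<integral>u. poisson_kernel q t u * f u \<partial>\<mu>)"
        if "cmod t = 1" "0 \<le> q" "q < 1" for q t
      proof -
        have 1: "poisson (\<lambda>u. of_real (f u)) q t = of_real (\<integral>u. poisson_kernel q t u * f u \<partial>\<mu>)"
          unfolding poisson_def by (simp flip: of_real_mult)
        have 2: "conjugate_poisson (\<lambda>u. of_real (f u)) q t = of_real (\<integral>u. Im ((1 + of_real q * t * cnj u) / (1 - of_real q * t * cnj u)) * f u \<partial>\<mu>)"
          unfolding conjugate_poisson_def by (simp flip: of_real_mult)
        show ?thesis unfolding FP[OF that] 1 2 by simp
      qed
      have ki: "integrable \<mu> (\<lambda>u. poisson_kernel q t u * g u)"
        if "integrable \<mu> g" "cmod t = 1" "0 \<le> q" "q < 1" for g :: "complex \<Rightarrow> real" and q t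
        using integrable_Re[OF integrable_poisson[of "\<lambda>u. of_real (g u)", OF _ that(2-4)]] that by simp
      have pos: "0 < Re (F (of_real q * t))" if "cmod t = 1" "0 \<le> q" "q < 1" for q t
      proof -
        \<comment> \<open>Points of the circle are at distance at most 2, so the denominator of the
          kernel is at most (1 + q)^2, hence at most 4, while the numerator 1 - q^2 is at least 1 -
          q. This uniform lower bound makes the Poisson integral positive as soon as the mean
          is.\<close>
        have "(1 - q) / 4 * f u \<le> poisson_kernel q t u * f u" if u: "cmod u = 1" for u
        proof (rule mult_right_mono)
          have "dist u t \<le> 2" using u \<open>cmod t = 1\<close> norm_triangle_ineq4[of u t] by (simp add: dist_norm)
          then have "(dist u t)\<^sup>2 \<le> 2\<^sup>2" by (intro power_mono) auto
          then have "q * (dist u t)\<^sup>2 \<le> q * 4" using \<open>0 \<le> q\<close> by (intro mult_left_mono) auto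
          moreover have "(1 - q)\<^sup>2 + q * 4 = (1 + q)\<^sup>2" by (simp add: power2_eq_square algebra_simps)
          moreover have "(1 + q)\<^sup>2 \<le> 2\<^sup>2" using \<open>0 \<le> q\<close> \<open>q < 1\<close> by (intro power_mono) auto
          ultimately have "(1 - q)\<^sup>2 + q * (dist u t)\<^sup>2 \<le> 4" by simp
          moreover have "1 - q \<le> 1 - q\<^sup>2" using \<open>0 \<le> q\<close> \<open>q < 1\<close> by (simp add: power2_eq_square mult_left_le)
          moreover have "0 < (1 - q)\<^sup>2 + q * (dist u t)\<^sup>2" using \<open>0 \<le> q\<close> \<open>q < 1\<close> by (intro add_pos_nonneg) auto
          ultimately show "(1 - q) / 4 \<le> poisson_kernel q t u"
            unfolding poisson_kernel_eq[OF \<open>cmod t = 1\<close> u \<open>0 \<le> q\<close> \<open>q < 1\<close>]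
            using \<open>q < 1\<close> by (intro frac_le) auto
        qed (rule f0)
        then have "(\<integral>u. (1 - q) / 4 * f u \<partial>\<mu>) \<le> (\<integral>u. poisson_kernel q t u * f u \<partial>\<mu>)"
          by (intro integral_mono ki[OF f that] integrable_mult_right f) auto
        moreover have "0 < (1 - q) / 4 * c" using that c by simp
        ultimately show ?thesis unfolding ReF[OF that] by (simp add: c_def)
      qed
      have posF: "0 < Re (F z)" if "z \<in> ball 0 1" for z
      proof (cases "z = 0")
        case True
        then show ?thesis using pos[of 1 0] by simp
      next
        case False
        then have "z = of_real (cmod z) * sgn z" by (simp add: sgn_eq)
        moreover have "0 < Re (F (of_real (cmod z) * sgn z))"
          by (rule pos) (use that False in \<open>auto simp: norm_sgn\<close>)
        ultimately show ?thesis by simp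
      qed
      have Fhol: "F holomorphic_on ball 0 1"
        unfolding F_def by (intro holomorphic_intros szego_holomorphic fc)
      define H where "H z = exp (of_real p * Ln (F z))" for z
      have Hhol: "H holomorphic_on ball 0 1"
        unfolding H_def
        by (intro holomorphic_intros Fhol) (use posF in \<open>force simp: complex_nonpos_Reals_iff\<close>)
      have sph: "(\<lambda>t. complex_of_real r * t) ` sphere 0 1 \<subseteq> ball 0 1" using r by (auto simp: norm_mult)
      have cont: "continuous_on (sphere 0 1) (\<lambda>t. G (of_real r * t))" if "G holomorphic_on ball 0 1" for G :: "complex \<Rightarrow> complex"
        by (rule continuous_on_compose2[OF holomorphic_on_imp_continuous_on[OF that]])
          (use sph in \<open>auto intro!: continuous_intros\<close>)
      note int = integrable_continuous_circle[where 'a = real]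
      have int1: "integrable \<mu> (\<lambda>t. cmod (F (of_real r * t)) powr p)"
        by (rule int, intro continuous_on_powr' continuous_intros cont Fhol) (use p in auto)
      have int2: "integrable \<mu> (\<lambda>t. Re (F (of_real r * t)) powr p)"
        by (rule int, intro continuous_on_powr' continuous_intros cont Fhol)
          (use pos r p in \<open>auto intro: less_imp_le\<close>)
      have int3: "integrable \<mu> (\<lambda>t. Re (H (of_real r * t)))"
        by (rule int, intro continuous_intros cont Hhol)
      have H3: "0 \<le> (\<integral>t. Re (H (of_real r * t)) \<partial>\<mu>)"
      proof -
        have "(\<integral>t. H (of_real r * t) \<partial>\<mu>) = H 0" by (rule circle_mean_value[OF Hhol r])
        moreover have "H 0 = of_real (c powr p)"
        proof -
          have "F 0 = of_real c" by (simp add: F_def szego_0 c_def)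
          then have "H 0 = exp (of_real p * of_real (ln c))" using c by (simp add: H_def Ln_of_real)
          also have "\<dots> = of_real (exp (p * ln c))" by (simp flip: exp_of_real)
          finally show ?thesis using c by (simp add: powr_def)
        qed
        moreover have "(\<integral>t. Re (H (of_real r * t)) \<partial>\<mu>) = Re (\<integral>t. H (of_real r * t) \<partial>\<mu>)"
          by (rule integral_Re[OF integrable_continuous_circle[OF cont[OF Hhol]]])
        ultimately show ?thesis by simp
      qed
      have "(\<integral>t. cmod (F (of_real r * t)) powr p \<partial>\<mu>) \<le>
          (\<integral>t. A * Re (F (of_real r * t)) powr p - B * Re (H (of_real r * t)) \<partial>\<mu>)"
      proof (rule integral_mono[OF int1])
        fix t assume "t \<in> space \<mu>"
        then show "cmod (F (of_real r * t)) powr p \<le> A * Re (F (of_real r * t)) powr p - B * Re (H (of_real r * t))"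
          unfolding H_def using r by (intro AB(3) pos) auto
      qed (use int2 int3 in auto)
      also have "\<dots> = A * (\<integral>t. Re (F (of_real r * t)) powr p \<partial>\<mu>) - B * (\<integral>t. Re (H (of_real r * t)) \<partial>\<mu>)"
        using int2 int3 by simp
      also have "\<dots> \<le> A * (\<integral>t. Re (F (of_real r * t)) powr p \<partial>\<mu>)"
        using H3 AB(2) by simp
      also have "\<dots> \<le> A * (\<integral>t. f t powr p \<partial>\<mu>)"
      proof (rule mult_left_mono[OF _ AB(1)])
        have "ennreal (\<integral>t. Re (F (of_real r * t)) powr p \<partial>\<mu>) = (\<integral>\<^sup>+ t. ennreal (Re (F (of_real r * t)) powr p) \<partial>\<mu>)"
          by (rule nn_integral_eq_integral[symmetric, OF int2]) simp
        also have "\<dots> \<le> (\<integral>\<^sup>+ t. (\<integral>\<^sup>+ u. ennreal (poisson_kernel r t u) * ennreal (f u powr p) \<partial>\<mu>) \<partial>\<mu>)"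
        proof (rule nn_integral_mono)
          fix t assume "t \<in> space \<mu>"
          then have t: "cmod t = 1" by simp
          have "ennreal (Re (F (of_real r * t)) powr p) \<le> ennreal (\<integral>u. poisson_kernel r t u * f u powr p \<partial>\<mu>)"
            by (rule ennreal_leI, rule poisson_jensen[OF f f0 fp p(1) t r]) (use ReF[OF t r] pos[OF t r] in auto)
          also have "\<dots> = (\<integral>\<^sup>+ u. ennreal (poisson_kernel r t u * f u powr p) \<partial>\<mu>)"
            by (rule nn_integral_eq_integral[symmetric, OF ki[OF fp t r]])
              (use poisson_kernel_pos[OF t _ r] in \<open>auto intro!: AE_I2 mult_nonneg_nonneg intro: less_imp_le\<close>)
          also have "\<dots> = (\<integral>\<^sup>+ u. ennreal (poisson_kernel r t u) * ennreal (f u powr p) \<partial>\<mu>)"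
            by (rule nn_integral_cong) (simp add: ennreal_mult'')
          finally show "ennreal (Re (F (of_real r * t)) powr p) \<le> (\<integral>\<^sup>+ u. ennreal (poisson_kernel r t u) * ennreal (f u powr p) \<partial>\<mu>)" .
        qed
        also have "\<dots> = (\<integral>\<^sup>+ u. ennreal (f u powr p) \<partial>\<mu>)"
          by (rule nn_integral_poisson_average[OF _ r]) measurable
        also have "\<dots> = ennreal (\<integral>t. f t powr p \<partial>\<mu>)"
          by (rule nn_integral_eq_integral[OF fp]) simp
        finally show "(\<integral>t. Re (F (of_real r * t)) powr p \<partial>\<mu>) \<le> (\<integral>t. f t powr p \<partial>\<mu>)"
          using I0 by simp
      qed
      finally show "(\<integral>t. cmod (F (of_real r * t)) powr p \<partial>\<mu>) \<le> A * (\<integral>t. f t powr p \<partial>\<mu>)" .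
    qed
  qed
qed

subsection \<open>The Riesz projection\<close>

lemma szego_add:
  assumes "integrable \<mu> f" "integrable \<mu> g" "cmod z < 1"
  shows "szego (\<lambda>u. f u + g u) z = szego f z + szego g z"
proof -
  have "fourier_coeff (\<lambda>u. f u + g u) n = fourier_coeff f n + fourier_coeff g n" for n
    unfolding fourier_coeff_eq distrib_right
    by (intro Bochner_Integration.integral_add integrable_circle_mult_bounded[where B=1] assms)
      (auto simp: norm_powi_circle)
  then have "(\<lambda>n. fourier_coeff f (int n) * z ^ n + fourier_coeff g (int n) * z ^ n) sums szego (\<lambda>u. f u + g u) z"
    using szego_sums[of "\<lambda>u. f u + g u" z] assms by (simp add: distrib_right)
  then show ?thesis
    using sums_add[OF szego_sums[OF assms(1,3)] szego_sums[OF assms(2,3)]] by (rule sums_unique2)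
qed

lemma szego_cmult: "szego (\<lambda>u. c * f u) z = c * szego f z"
  unfolding szego_def by (simp flip: integral_mult_right_zero)

lemma szego_diff:
  assumes "integrable \<mu> f" "integrable \<mu> g" "cmod z < 1"
  shows "szego (\<lambda>u. f u - g u) z = szego f z - szego g z"
proof -
  have "szego (\<lambda>u. f u + (- 1) * g u) z = szego f z + szego (\<lambda>u. (- 1) * g u) z"
    by (rule szego_add) (use assms in auto)
  then show ?thesis unfolding szego_cmult by simp
qed

lemma integrable_norm_szego:
  assumes "integrable \<mu> f" "0 \<le> r" "r < 1"
  shows "integrable \<mu> (\<lambda>t. cmod (szego f (of_real r * t)))"
  using integrable_szego[OF assms] by auto

text \<open>Up to height h use x itself; above it write x = x^(1-p) x^p, where the first factor
  decreases in x. After integration h can be fixed first and the integral of the p-th power made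
  small afterwards.\<close>

lemma le_add_powr:
  fixes x h p :: real
  assumes "0 \<le> x" "0 < h" "1 < p"
  shows "x \<le> h + h powr (1 - p) * x powr p"
proof (cases "x \<le> h")
  case False
  then have "x powr (1 - p) \<le> h powr (1 - p)" using assms by (intro powr_mono2') auto
  then have "x powr (1 - p) * x powr p \<le> h powr (1 - p) * x powr p" by (rule mult_right_mono) simp
  moreover have "x powr (1 - p) * x powr p = x" using False assms by (simp flip: powr_add)
  ultimately show ?thesis using assms by simp
qed (simp add: add_increasing2)

lemma integral_norm_le_powr:
  fixes g :: "complex \<Rightarrow> 'a::{banach, second_countable_topology}"
  assumes g: "integrable \<mu> g" and gp: "integrable \<mu> (\<lambda>t. norm (g t) powr p)" and h: "0 < h" "1 < p"
  shows "(\<integral>t. norm (g t) \<partial>\<mu>) \<le> h + h powr (1 - p) * (\<integral>t. norm (g t) powr p \<partial>\<mu>)"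
proof -
  have "(\<integral>t. norm (g t) \<partial>\<mu>) \<le> (\<integral>t. h + h powr (1 - p) * norm (g t) powr p \<partial>\<mu>)"
    using g gp h by (intro integral_mono) (auto intro!: le_add_powr)
  also have "\<dots> = h + h powr (1 - p) * (\<integral>t. norm (g t) powr p \<partial>\<mu>)"
    using gp circle.prob_space by simp
  finally show ?thesis .
qed

text \<open>A complex h splits into four nonnegative functions dominated by |h|, to which
  \<open>riesz_nonneg\<close> applies. The point is that d does not depend on r: the Cauchy
  integrals on all circles are equicontinuous at 0 from L^p to L^1.\<close>

theorem szego_small:
  fixes p :: real
  assumes p: "1 < p" "p < 2" and e: "0 < e"
  obtains d where "0 < d" "\<And>h r. \<lbrakk>h \<in> L0; integrable \<mu> (\<lambda>t. cmod (h t) powr p);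
     (\<integral>t. cmod (h t) powr p \<partial>\<mu>) \<le> d; 0 \<le> r; r < 1\<rbrakk> \<Longrightarrow>
     (\<integral>t. cmod (szego h (of_real r * t)) \<partial>\<mu>) \<le> e"
proof -
  obtain A where A: "0 \<le> A" "\<And>f r. \<lbrakk>f \<in> borel_measurable \<mu>; \<And>t. 0 \<le> f t; integrable \<mu> (\<lambda>t. f t powr p); 0 \<le> r; r < 1\<rbrakk> \<Longrightarrow>
     (\<integral>t. cmod (2 * szego (\<lambda>u. of_real (f u)) (of_real r * t) - of_real (\<integral>u. f u \<partial>\<mu>)) powr p \<partial>\<mu>)
       \<le> A * (\<integral>t. f t powr p \<partial>\<mu>)"
    using riesz_nonneg[OF p] by blast
  \<comment> \<open>Each of the four nonnegative parts may cost e/4. Of this, 2 k = e/8 comes from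
    the height k in \<open>integral_norm_le_powr\<close>, used once for F and once for the mean c,
    and d is chosen so that the p-th power terms contribute another e/8.\<close>
  define k where "k = e / 16"
  define d where "d = e / (8 * (k powr (1 - p) * (A + 1)))"
  have k: "0 < k" using e by (simp add: k_def)
  then have kp: "0 < k powr (1 - p)" by simp
  have d: "0 < d" using e kp A(1) by (simp add: d_def)
  show ?thesis
  proof (rule that[OF d])
    fix h r assume hm: "h \<in> L0" and hp: "integrable \<mu> (\<lambda>t. cmod (h t) powr p)"
      and hd: "(\<integral>t. cmod (h t) powr p \<partial>\<mu>) \<le> d" and r: "0 \<le> r" "r < (1::real)"
    note [measurable] = hm
    have nonneg: "integrable \<mu> f \<and> (\<integral>t. cmod (szego (\<lambda>u. of_real (f u)) (of_real r * t)) \<partial>\<mu>) \<le> e / 4"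
      if fm [measurable]: "f \<in> borel_measurable \<mu>" and f0: "\<And>t. 0 \<le> f t" and fh: "\<And>t. f t \<le> cmod (h t)" for f
    proof -
      have fp: "integrable \<mu> (\<lambda>t. f t powr p)"
        by (rule Bochner_Integration.integrable_bound[OF hp])
          (use f0 fh p in \<open>auto intro!: AE_I2 powr_mono2\<close>)
      define I where "I = (\<integral>t. f t powr p \<partial>\<mu>)"
      have I: "I \<le> d"
        unfolding I_def using f0 fh p by (intro order_trans[OF integral_mono[OF fp hp] hd] powr_mono2) auto
      have f: "integrable \<mu> f"
        by (rule integrable_of_powr[OF fm, where p = p]) (use fp f0 p in auto)
      define c where "c = (\<integral>u. f u \<partial>\<mu>)"
      let ?F = "\<lambda>t. 2 * szego (\<lambda>u. of_real (f u)) (of_real r * t) - of_real c"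
      have si: "integrable \<mu> (\<lambda>t. szego (\<lambda>u. of_real (f u)) (of_real r * t))"
        by (rule integrable_szego[OF _ r]) (use f in simp)
      then have Fi: "integrable \<mu> ?F" by auto
      have Fp: "integrable \<mu> (\<lambda>t. cmod (?F t) powr p)"
      proof -
        have "continuous_on (sphere 0 1) (\<lambda>t. szego (\<lambda>u. of_real (f u)) (of_real r * t))"
          by (rule continuous_on_szego_circle[OF _ r]) (use f in simp)
        then obtain b where b: "\<forall>t\<in>sphere 0 1. cmod (szego (\<lambda>u. of_real (f u)) (of_real r * t)) \<le> b"
          using continuous_on_circle_bounded by force
        show ?thesis
        proof (rule integrable_circle_bounded)
          show "(\<lambda>t. cmod (?F t) powr p) \<in> borel_measurable \<mu>" using Fi by measurable
          fix t :: complex assume "cmod t = 1"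
          then have "cmod (?F t) \<le> 2 * b + \<bar>c\<bar>"
            using b norm_triangle_ineq4[of "2 * szego (\<lambda>u. of_real (f u)) (of_real r * t)" "of_real c"] by (force simp: norm_mult)
          then show "norm (cmod (?F t) powr p) \<le> (2 * b + \<bar>c\<bar>) powr p" using p by (auto intro!: powr_mono2)
        qed
      qed
      have "(\<integral>t. cmod (?F t) \<partial>\<mu>) \<le> k + k powr (1 - p) * (\<integral>t. cmod (?F t) powr p \<partial>\<mu>)"
        by (rule integral_norm_le_powr[OF Fi Fp k p(1)])
      also have "\<dots> \<le> k + k powr (1 - p) * (A * I)"
        unfolding I_def c_def using A(2)[OF fm f0 fp r] by (intro add_left_mono mult_left_mono) auto
      finally have 1: "(\<integral>t. cmod (?F t) \<partial>\<mu>) \<le> k + k powr (1 - p) * (A * I)" .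
      have 2: "c \<le> k + k powr (1 - p) * I"
        using integral_norm_le_powr[OF f _ k p(1)] fp f0 by (simp add: c_def I_def)
      have c0: "0 \<le> c" using f0 by (simp add: c_def)
      have "(\<integral>t. cmod (szego (\<lambda>u. of_real (f u)) (of_real r * t)) \<partial>\<mu>) \<le> (\<integral>t. cmod (?F t) + c \<partial>\<mu>)"
      proof (rule integral_mono)
        fix t
        let ?s = "szego (\<lambda>u. of_real (f u)) (of_real r * t)"
        have "cmod ?s \<le> cmod (2 * ?s)" by (simp add: norm_mult)
        also have "\<dots> \<le> cmod (?F t) + cmod (of_real c)" using norm_triangle_ineq[of "?F t" "of_real c"] by simp
        finally show "cmod ?s \<le> cmod (?F t) + c" using c0 by simp
      qed (use si Fi in auto)
      also have "\<dots> = (\<integral>t. cmod (?F t) \<partial>\<mu>) + c" using Fi circle.prob_space by simp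
      also have "\<dots> \<le> 2 * k + (k powr (1 - p) * (A + 1)) * I" using 1 2 by (simp add: algebra_simps)
      also have "\<dots> \<le> 2 * k + (k powr (1 - p) * (A + 1)) * d" using I kp A(1) by (intro add_left_mono mult_left_mono) auto
      also have "(k powr (1 - p) * (A + 1)) * d = e / 8" unfolding d_def using kp A(1) by simp
      also have "2 * k + e / 8 = e / 4" by (simp add: k_def)
      finally show ?thesis using f by simp
    qed
    define f1 f2 f3 f4 where
      "f1 t = max (Re (h t)) 0" and "f2 t = max (- Re (h t)) 0" and
      "f3 t = max (Im (h t)) 0" and "f4 t = max (- Im (h t)) 0" for t
    have n1: "integrable \<mu> f1 \<and> (\<integral>t. cmod (szego (\<lambda>u. of_real (f1 u)) (of_real r * t)) \<partial>\<mu>) \<le> e / 4"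
      unfolding f1_def by (rule nonneg) (auto simp: complex_Re_le_cmod)
    have n2: "integrable \<mu> f2 \<and> (\<integral>t. cmod (szego (\<lambda>u. of_real (f2 u)) (of_real r * t)) \<partial>\<mu>) \<le> e / 4"
      unfolding f2_def by (rule nonneg) (auto intro: order_trans[OF abs_ge_minus_self abs_Re_le_cmod])
    have n3: "integrable \<mu> f3 \<and> (\<integral>t. cmod (szego (\<lambda>u. of_real (f3 u)) (of_real r * t)) \<partial>\<mu>) \<le> e / 4"
      unfolding f3_def by (rule nonneg) (auto intro: order_trans[OF abs_ge_self abs_Im_le_cmod])
    have n4: "integrable \<mu> f4 \<and> (\<integral>t. cmod (szego (\<lambda>u. of_real (f4 u)) (of_real r * t)) \<partial>\<mu>) \<le> e / 4"
      unfolding f4_def by (rule nonneg) (auto intro: order_trans[OF abs_ge_minus_self abs_Im_le_cmod])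
    have hsplit: "h = (\<lambda>t. (of_real (f1 t) - of_real (f2 t)) + \<i> * (of_real (f3 t) - of_real (f4 t)))"
      by (rule ext) (auto simp: f1_def f2_def f3_def f4_def complex_eq_iff max_def)
    let ?s = "\<lambda>f t. szego (\<lambda>u. complex_of_real (f u)) (of_real r * t)"
    have "(\<integral>t. cmod (szego h (of_real r * t)) \<partial>\<mu>) \<le>
        (\<integral>t. (cmod (?s f1 t) + cmod (?s f2 t)) + (cmod (?s f3 t) + cmod (?s f4 t)) \<partial>\<mu>)"
    proof (rule integral_mono)
      have "integrable \<mu> h"
        by (rule integrable_of_powr[OF hm hp]) (use p in simp)
      then show "integrable \<mu> (\<lambda>t. cmod (szego h (of_real r * t)))"
        by (rule integrable_norm_szego[OF _ r])
      show "integrable \<mu> (\<lambda>t. (cmod (?s f1 t) + cmod (?s f2 t)) + (cmod (?s f3 t) + cmod (?s f4 t)))"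
        using n1 n2 n3 n4 by (intro Bochner_Integration.integrable_add integrable_norm_szego r) auto
      fix t assume "t \<in> space \<mu>"
      then have z: "cmod (of_real r * t) < 1" using r by (simp add: norm_mult)
      have "szego h (of_real r * t) = (?s f1 t - ?s f2 t) + \<i> * (?s f3 t - ?s f4 t)"
        using n1 n2 n3 n4
        by (subst hsplit) (simp add: szego_add szego_cmult szego_diff z)
      also have "cmod \<dots> \<le> (cmod (?s f1 t) + cmod (?s f2 t)) + (cmod (?s f3 t) + cmod (?s f4 t))"
        by (intro order_trans[OF norm_triangle_ineq] add_mono norm_triangle_ineq4) (simp add: norm_mult norm_triangle_ineq4)
      finally show "cmod (szego h (of_real r * t)) \<le> (cmod (?s f1 t) + cmod (?s f2 t)) + (cmod (?s f3 t) + cmod (?s f4 t))" .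
    qed
    also have "\<dots> = ((\<integral>t. cmod (?s f1 t) \<partial>\<mu>) + (\<integral>t. cmod (?s f2 t) \<partial>\<mu>)) +
        ((\<integral>t. cmod (?s f3 t) \<partial>\<mu>) + (\<integral>t. cmod (?s f4 t) \<partial>\<mu>))"
    proof -
      have "integrable \<mu> (\<lambda>t. cmod (?s f1 t))" "integrable \<mu> (\<lambda>t. cmod (?s f2 t))"
        "integrable \<mu> (\<lambda>t. cmod (?s f3 t))" "integrable \<mu> (\<lambda>t. cmod (?s f4 t))"
        using n1 n2 n3 n4 by (auto intro!: integrable_norm_szego r)
      then show ?thesis by simp
    qed
    also have "\<dots> \<le> e" using n1 n2 n3 n4 by simp
    finally show "(\<integral>t. cmod (szego h (of_real r * t)) \<partial>\<mu>) \<le> e" .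
  qed
qed

section \<open>Poisson integrals: coefficients, bounds and convergence in the mean\<close>

lemma integrable_poisson_integral:
  assumes f: "integrable \<mu> f" and r: "0 \<le> r" "r < 1"
  shows "integrable \<mu> (poisson f r)"
proof -
  have "integrable \<mu> (\<lambda>t. szego f (of_real r * t) + cnj (szego (\<lambda>u. cnj (f u)) (of_real r * t)) - fourier_coeff f 0)"
    using integrable_szego[OF f r] integrable_szego[of "\<lambda>u. cnj (f u)", OF _ r] f by auto
  then show ?thesis
    by (rule Bochner_Integration.integrable_cong[THEN iffD1, rotated -1])
      (auto simp: poisson_eq_szego[OF f _ r])
qed

text \<open>One Cauchy integral carries the frequencies n \<ge> 0, the conjugated one those with n
  \<le> 0. Both contain frequency 0, and the subtracted constant removes one copy.\<close>

lemma fourier_coeff_poisson: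
  assumes f: "integrable \<mu> f" and r: "0 \<le> r" "r < 1"
  shows "fourier_coeff (poisson f r) n = of_real r ^ nat \<bar>n\<bar> * fourier_coeff f n"
proof -
  have fc: "integrable \<mu> (\<lambda>u. cnj (f u))" using f by simp
  let ?a = "\<lambda>t. szego f (of_real r * t)" and ?b = "\<lambda>t. cnj (szego (\<lambda>u. cnj (f u)) (of_real r * t))"
  have ai: "integrable \<mu> ?a" and bi: "integrable \<mu> ?b"
    using integrable_szego[OF f r] integrable_szego[OF fc r] by auto
  have "fourier_coeff (poisson f r) n = fourier_coeff (\<lambda>t. ?a t - (fourier_coeff f 0 - ?b t)) n"
    unfolding fourier_coeff_eq[of "poisson f r"] fourier_coeff_eq[of "\<lambda>t. ?a t - (fourier_coeff f 0 - ?b t)"]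
    by (rule Bochner_Integration.integral_cong) (auto simp: poisson_eq_szego[OF f _ r])
  also have "\<dots> = fourier_coeff ?a n - (fourier_coeff (\<lambda>t. fourier_coeff f 0) n - fourier_coeff ?b n)"
    using ai bi by (subst fourier_coeff_diff, auto, subst fourier_coeff_diff, auto)
  also have "fourier_coeff (\<lambda>t. fourier_coeff f 0) n = (if n = 0 then fourier_coeff f 0 else 0)"
  proof -
    have "(\<integral>t. cnj (t powi n) \<partial>\<mu>) = cnj (\<integral>t. t powi n \<partial>\<mu>)"
      by (simp only: Bochner_Integration.integral_cnj)
    also have "\<dots> = (if n = 0 then 1 else 0)" unfolding integral_powi_circle by simp
    finally show ?thesis unfolding fourier_coeff_eq[of "\<lambda>t. fourier_coeff f 0"] integral_mult_right_zero by simp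
  qed
  also have "fourier_coeff ?b n = cnj (fourier_coeff (\<lambda>t. szego (\<lambda>u. cnj (f u)) (of_real r * t)) (- n))"
    by (rule fourier_coeff_cnj)
  also have "\<dots> = (if n \<le> 0 then fourier_coeff f n * of_real r ^ nat (- n) else 0)"
    unfolding fourier_coeff_szego[OF fc r] by (simp add: fourier_coeff_cnj)
  also have "fourier_coeff ?a n = (if 0 \<le> n then fourier_coeff f n * of_real r ^ nat n else 0)"
    by (rule fourier_coeff_szego[OF f r])
  finally show ?thesis by auto
qed

lemma szego_poisson:
  assumes f: "integrable \<mu> f" and r: "0 \<le> r" "r < 1" and z: "cmod z < 1"
  shows "szego (poisson f r) z = szego f (of_real r * z)"
proof -
  have "(\<lambda>n. fourier_coeff f (int n) * (of_real r * z) ^ n) sums szego (poisson f r) z"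
    using szego_sums[OF integrable_poisson_integral[OF f r] z] by (simp add: fourier_coeff_poisson[OF f r] power_mult_distrib mult_ac)
  moreover have "cmod (of_real r * z) < 1"
  proof -
    have "r * cmod z \<le> 1 * cmod z" using r by (intro mult_right_mono) auto
    then show ?thesis using z r by (simp add: norm_mult)
  qed
  then have "(\<lambda>n. fourier_coeff f (int n) * (of_real r * z) ^ n) sums szego f (of_real r * z)"
    by (rule szego_sums[OF f])
  ultimately show ?thesis by (rule sums_unique2)
qed

lemma poisson_bounded:
  assumes f: "integrable \<mu> f" and B: "\<And>t. cmod t = 1 \<Longrightarrow> cmod (f t) \<le> B" "0 \<le> B"
    and t: "cmod t = 1" and r: "0 \<le> r" "r < 1"
  shows "cmod (poisson f r t) \<le> B"
proof -
  have "ennreal (cmod (poisson f r t)) \<le> (\<integral>\<^sup>+ u. ennreal (poisson_kernel r t u) * ennreal (cmod (f u)) \<partial>\<mu>)"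
    by (rule norm_poisson_le[OF f t r])
  also have "\<dots> \<le> (\<integral>\<^sup>+ u. ennreal (poisson_kernel r t u) * ennreal B \<partial>\<mu>)"
    by (rule nn_integral_mono) (use B in \<open>auto intro!: mult_left_mono ennreal_leI\<close>)
  also have "\<dots> = ennreal B"
    by (subst nn_integral_multc) (auto simp: nn_integral_poisson_kernel[OF t r])
  finally show ?thesis using B(2) by simp
qed

text \<open>Fatou's theorem provides pointwise convergence and the bound B for Poisson integrals a
  constant majorant. The left limit is tested along sequences, to which dominated convergence
  applies.\<close>

lemma poisson_bounded_convergence:
  assumes b: "integrable \<mu> b" and B: "\<And>t. cmod t = 1 \<Longrightarrow> cmod (b t) \<le> B" "0 \<le> B" and p: "0 < p"
  shows "((\<lambda>s. \<integral>t. cmod (b t - poisson b s t) powr p \<partial>\<mu>) \<longlongrightarrow> 0) (at_left 1)"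
proof (rule tendsto_at_left_sequentially[of 0])
  fix S :: "nat \<Rightarrow> real" assume S: "\<And>n. S n < 1" "\<And>n. 0 < S n" "S \<longlonglongrightarrow> 1"
  then have S0: "0 \<le> S n" for n by (simp add: less_imp_le)
  have [measurable]: "b \<in> borel_measurable \<mu>" "poisson b (S n) \<in> borel_measurable \<mu>" for n
    using b integrable_poisson_integral[OF b S0 S(1)] by auto
  have fl: "filterlim S (at_left 1) sequentially"
    using S by (auto simp: filterlim_at order.strict_implies_not_eq)
  have "(\<lambda>n. \<integral>t. cmod (b t - poisson b (S n) t) powr p \<partial>\<mu>) \<longlonglongrightarrow> (\<integral>t. 0 \<partial>\<mu>)"
  proof (rule integral_dominated_convergence[where w = "\<lambda>_. (2 * B) powr p"])
    show "AE t in \<mu>. (\<lambda>n. cmod (b t - poisson b (S n) t) powr p) \<longlonglongrightarrow> 0"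
      using poisson_tendsto_AE[OF b]
    proof eventually_elim
      case (elim t)
      have "(\<lambda>n. poisson b (S n) t) \<longlonglongrightarrow> b t" by (rule filterlim_compose[OF elim fl])
      then have "(\<lambda>n. cmod (b t - poisson b (S n) t)) \<longlonglongrightarrow> cmod (b t - b t)" by (intro tendsto_intros)
      then have "(\<lambda>n. cmod (b t - poisson b (S n) t) powr p) \<longlonglongrightarrow> 0 powr p"
        using p by (intro tendsto_powr') auto
      then show ?case using p by simp
    qed
    fix n show "AE t in \<mu>. norm (cmod (b t - poisson b (S n) t) powr p) \<le> (2 * B) powr p"
    proof (rule AE_I2)
      fix t assume "t \<in> space \<mu>"
      then have t: "cmod t = 1" by simp
      have "cmod (b t - poisson b (S n) t) \<le> 2 * B"
        using norm_triangle_ineq4[of "b t" "poisson b (S n) t"] B(1)[OF t] poisson_bounded[OF b B t S0 S(1)] by (smt (verit))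
      then show "norm (cmod (b t - poisson b (S n) t) powr p) \<le> (2 * B) powr p"
        using p by (auto intro!: powr_mono2)
    qed
  qed measurable
  then show "(\<lambda>n. \<integral>t. cmod (b t - poisson b (S n) t) powr p \<partial>\<mu>) \<longlonglongrightarrow> 0" by simp
qed simp

text \<open>The Cauchy integral of \<open>poisson b s\<close> at \<open>r t\<close> is that of \<open>b\<close> at \<open>r s t\<close>. For bounded \<open>b\<close> the
  difference \<open>b - poisson b s\<close> tends to \<open>0\<close> in \<open>L^p\<close>, which makes the Cauchy integrals at \<open>r t\<close> and \<open>r s t\<close> close uniformly in \<open>r\<close>; the rest of \<open>f\<close> is small
  in \<open>L^p\<close> by truncation.\<close>

lemma szego_dilation_close:
  fixes p :: real
  assumes fm: "f \<in> L0" and fp: "integrable \<mu> (\<lambda>t. cmod (f t) powr p)"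
    and p: "1 < p" "p < 2" and e: "0 < e"
  obtains s0 where "0 \<le> s0" "s0 < 1" "\<And>s r. \<lbrakk>s0 < s; s < 1; 0 \<le> r; r < 1\<rbrakk> \<Longrightarrow>
     (\<integral>t. cmod (szego f (of_real r * t) - szego f (of_real (r * s) * t)) \<partial>\<mu>) \<le> e"
proof -
  note [measurable] = fm
  have f: "integrable \<mu> f" by (rule integrable_of_powr[OF fm fp]) (use p in simp)
  have e3: "0 < e / 3" using e by simp
  obtain d where d: "0 < d" "\<And>h r. \<lbrakk>h \<in> L0; integrable \<mu> (\<lambda>t. cmod (h t) powr p);
     (\<integral>t. cmod (h t) powr p \<partial>\<mu>) \<le> d; 0 \<le> r; r < 1\<rbrakk> \<Longrightarrow>
     (\<integral>t. cmod (szego h (of_real r * t)) \<partial>\<mu>) \<le> e / 3"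
    using szego_small[OF p e3] by blast
  \<comment> \<open>Truncation at height k: f - b k is dominated by |f| and vanishes at each point
    once k is large, so it tends to 0 in L^p.\<close>
  define b where "b k t = (if cmod (f t) \<le> real k then f t else 0)" for k t
  have bm [measurable]: "b k \<in> L0" for k unfolding b_def by measurable
  have "(\<lambda>k. \<integral>t. cmod (f t - b k t) powr p \<partial>\<mu>) \<longlonglongrightarrow> (\<integral>t. 0 \<partial>\<mu>)"
  proof (rule integral_dominated_convergence[where w = "\<lambda>t. cmod (f t) powr p"])
    show "AE t in \<mu>. (\<lambda>k. cmod (f t - b k t) powr p) \<longlonglongrightarrow> 0"
    proof (rule AE_I2)
      fix t
      obtain K :: nat where "cmod (f t) \<le> real K" using real_arch_simple by blast
      then have "\<forall>k\<ge>K. cmod (f t - b k t) powr p = 0" using p by (auto simp: b_def)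
      then show "(\<lambda>k. cmod (f t - b k t) powr p) \<longlonglongrightarrow> 0"
        by (intro tendsto_eventually) (auto simp: eventually_sequentially)
    qed
    show "AE t in \<mu>. norm (cmod (f t - b k t) powr p) \<le> cmod (f t) powr p" for k
      by (rule AE_I2) (use p in \<open>auto simp: b_def\<close>)
  qed (use fp in measurable)
  then have "\<forall>\<^sub>F k in sequentially. (\<integral>t. cmod (f t - b k t) powr p \<partial>\<mu>) < d"
    using d(1) by (intro order_tendstoD(2)) auto
  then obtain k where k: "(\<integral>t. cmod (f t - b k t) powr p \<partial>\<mu>) < d"
    by (auto simp: eventually_sequentially)
  define h where "h t = f t - b k t" for t
  have hm [measurable]: "h \<in> L0" unfolding h_def by measurable
  have hp: "integrable \<mu> (\<lambda>t. cmod (h t) powr p)"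
    by (rule Bochner_Integration.integrable_bound[OF fp]) (measurable, use p in \<open>auto simp: h_def b_def\<close>)
  have hi: "integrable \<mu> h" by (rule integrable_of_powr[OF hm hp]) (use p in simp)
  have bb: "cmod (b k t) \<le> real k" for t by (simp add: b_def)
  have bi: "integrable \<mu> (b k)" by (rule integrable_circle_bounded[OF bm]) (rule bb)
  have "\<forall>\<^sub>F s in at_left 1. (\<integral>t. cmod (b k t - poisson (b k) s t) powr p \<partial>\<mu>) < d"
    by (rule order_tendstoD(2)[OF poisson_bounded_convergence[OF bi bb]]) (use p d in auto)
  then obtain s0 where s0: "s0 < 1" "\<And>s. s0 < s \<Longrightarrow> s < 1 \<Longrightarrow> (\<integral>t. cmod (b k t - poisson (b k) s t) powr p \<partial>\<mu>) < d"
    by (auto simp: eventually_at_left_field)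
  show ?thesis
  proof (rule that[of "max s0 0"])
    fix s r :: real assume s: "max s0 0 < s" "s < 1" and r: "0 \<le> r" "r < 1"
    then have s': "s0 < s" "0 \<le> s" by auto
    have rs: "0 \<le> r * s" "r * s < 1" using r s s' mult_strict_mono[of r 1 s 1] by (auto simp: mult_le_one intro: le_less_trans[OF mult_left_le])
    define g where "g t = b k t - poisson (b k) s t" for t
    have pi: "integrable \<mu> (poisson (b k) s)" by (rule integrable_poisson_integral[OF bi s'(2) s(2)])
    then have gm: "g \<in> L0" unfolding g_def by measurable
    have gp: "integrable \<mu> (\<lambda>t. cmod (g t) powr p)"
    proof (rule integrable_circle_bounded[where B = "(2 * real k) powr p"])
      show "(\<lambda>t. cmod (g t) powr p) \<in> borel_measurable \<mu>" using gm by measurable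
      fix t :: complex assume t: "cmod t = 1"
      have "cmod (g t) \<le> 2 * real k"
        using norm_triangle_ineq4[of "b k t" "poisson (b k) s t"] bb[of t] poisson_bounded[OF bi bb _ t s'(2) s(2)]
        by (simp add: g_def)
      then show "norm (cmod (g t) powr p) \<le> (2 * real k) powr p" using p by (auto intro!: powr_mono2)
    qed
    have G: "(\<integral>t. cmod (szego g (of_real r * t)) \<partial>\<mu>) \<le> e / 3"
      by (rule d(2)[OF gm gp _ r]) (use s0(2)[OF s'(1) s(2)] in \<open>simp add: g_def\<close>)
    have H: "(\<integral>t. cmod (szego h (of_real q * t)) \<partial>\<mu>) \<le> e / 3" if "0 \<le> q" "q < 1" for q
      by (rule d(2)[OF hm hp _ that]) (use k in \<open>simp add: h_def\<close>)
    have gi: "integrable \<mu> g" by (rule integrable_of_powr[OF gm gp]) (use p in simp)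
    have ints: "integrable \<mu> (\<lambda>t. cmod (szego g (of_real r * t)))"
      "integrable \<mu> (\<lambda>t. cmod (szego h (of_real r * t)))"
      "integrable \<mu> (\<lambda>t. cmod (szego h (of_real (r * s) * t)))"
      by (intro integrable_norm_szego gi hi r rs)+
    \<comment> \<open>With f = b k + h, the two Cauchy integrals of b k combine into that of g = b k
      - \<open>poisson\<close> (b k) s at radius r. The remaining terms belong to h at the radii r
      and r s. Each of the three costs e/3.\<close>
    have "(\<integral>t. cmod (szego f (of_real r * t) - szego f (of_real (r * s) * t)) \<partial>\<mu>) \<le>
        (\<integral>t. cmod (szego g (of_real r * t)) + (cmod (szego h (of_real r * t)) + cmod (szego h (of_real (r * s) * t))) \<partial>\<mu>)"
    proof (rule integral_mono)
      show "integrable \<mu> (\<lambda>t. cmod (szego f (of_real r * t) - szego f (of_real (r * s) * t)))"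
        using integrable_szego[OF f r] integrable_szego[OF f rs] by auto
      show "integrable \<mu> (\<lambda>t. cmod (szego g (of_real r * t)) + (cmod (szego h (of_real r * t)) + cmod (szego h (of_real (r * s) * t))))"
        using ints by auto
      fix t assume "t \<in> space \<mu>"
      then have t: "cmod t = 1" by simp
      have z1: "cmod (of_real r * t) < 1" and z2: "cmod (of_real (r * s) * t) < 1" using t r rs by (simp_all add: norm_mult abs_mult)
      have fbh: "szego f z = szego (b k) z + szego h z" if "cmod z < 1" for z
        using szego_add[OF bi hi that] by (simp add: h_def)
      have "szego g (of_real r * t) = szego (b k) (of_real r * t) - szego (b k) (of_real s * (of_real r * t))"
        unfolding g_def by (subst szego_diff[OF bi pi z1]) (simp add: szego_poisson[OF bi s'(2) s(2) z1])
      moreover have "of_real s * (of_real r * t) = of_real (r * s) * t" by simp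
      ultimately have "szego f (of_real r * t) - szego f (of_real (r * s) * t) =
          szego g (of_real r * t) + (szego h (of_real r * t) - szego h (of_real (r * s) * t))"
        unfolding fbh[OF z1] fbh[OF z2] by simp
      then show "cmod (szego f (of_real r * t) - szego f (of_real (r * s) * t)) \<le>
          cmod (szego g (of_real r * t)) + (cmod (szego h (of_real r * t)) + cmod (szego h (of_real (r * s) * t)))"
        by (metis (no_types, lifting) add_left_mono norm_triangle_ineq norm_triangle_ineq4 order_trans)
    qed
    also have "\<dots> = (\<integral>t. cmod (szego g (of_real r * t)) \<partial>\<mu>) +
       ((\<integral>t. cmod (szego h (of_real r * t)) \<partial>\<mu>) + (\<integral>t. cmod (szego h (of_real (r * s) * t)) \<partial>\<mu>))"
      using ints by (simp del: of_real_mult)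
    also have "\<dots> \<le> e / 3 + (e / 3 + e / 3)" by (intro add_mono G H r rs)
    finally show "(\<integral>t. cmod (szego f (of_real r * t) - szego f (of_real (r * s) * t)) \<partial>\<mu>) \<le> e" by simp
  qed (use s0 in auto)
qed

lemma szego_L1_Cauchy:
  fixes p :: real
  assumes fm: "f \<in> L0" and fp: "integrable \<mu> (\<lambda>t. cmod (f t) powr p)"
    and p: "1 < p" "p < 2" and e: "0 < e"
  obtains s0 where "0 \<le> s0" "s0 < 1" "\<And>q r. \<lbrakk>s0 < q; q < 1; s0 < r; r < 1\<rbrakk> \<Longrightarrow>
     (\<integral>t. cmod (szego f (of_real r * t) - szego f (of_real q * t)) \<partial>\<mu>) \<le> e"
proof -
  obtain s0 where s0: "0 \<le> s0" "s0 < 1" "\<And>s r. \<lbrakk>s0 < s; s < 1; 0 \<le> r; r < 1\<rbrakk> \<Longrightarrow>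
     (\<integral>t. cmod (szego f (of_real r * t) - szego f (of_real (r * s) * t)) \<partial>\<mu>) \<le> e"
    using szego_dilation_close[OF assms] by blast
  \<comment> \<open>For q < r < 1 write q = r s with s = q/r. Then s is at least q, so it lies in
    the admissible range above s0.\<close>
  have lt: "(\<integral>t. cmod (szego f (of_real r * t) - szego f (of_real q * t)) \<partial>\<mu>) \<le> e"
    if "s0 < q" "q < r" "r < 1" for q r
  proof -
    have r: "0 < r" using that s0 by linarith
    have "q * r \<le> q * 1" using that s0 by (intro mult_left_mono) auto
    then have "q \<le> q / r" using r by (simp add: pos_le_divide_eq)
    then have "s0 < q / r" "q / r < 1" using that r by auto
    then show ?thesis using s0(3)[of "q / r" r] that r by simp
  qed
  show ?thesis
  proof (rule that[OF s0(1,2)])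
    fix q r assume *: "s0 < q" "q < 1" "s0 < r" "r < (1::real)"
    consider "q < r" | "q = r" | "r < q" by linarith
    then show "(\<integral>t. cmod (szego f (of_real r * t) - szego f (of_real q * t)) \<partial>\<mu>) \<le> e"
    proof cases
      case 3
      then show ?thesis using lt[of r q] * by (simp add: norm_minus_commute)
    qed (use lt * e in auto)
  qed
qed

lemma riesz_projection_eq:
  fixes p :: real
  assumes fm: "f \<in> L0" and fp: "integrable \<mu> (\<lambda>t. cmod (f t) powr p)"
    and p: "1 < p" "p < 2"
  obtains G where "integrable \<mu> G"
    "\<And>n. fourier_coeff G n = (if 0 \<le> n then fourier_coeff f n else 0)"
    "AE t in \<mu>. riesz_projection f t = G t"
proof -
  note [measurable] = fm
  have f: "integrable \<mu> f" by (rule integrable_of_powr[OF fm fp]) (use p in simp)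
  define q where "q j = 1 - 1 / real (j + 2)" for j :: nat
  have q: "0 \<le> q j" "q j < 1" for j by (simp_all add: q_def)
  have q1: "q \<longlonglongrightarrow> 1"
    unfolding q_def using LIMSEQ_ignore_initial_segment[OF lim_1_over_n, of 2] tendsto_diff[OF tendsto_const[of 1]] by fastforce
  define s where "s j t = szego f (of_real (q j) * t)" for j t
  have si: "integrable \<mu> (s j)" for j unfolding s_def by (rule integrable_szego[OF f q])
  have cauchy: "\<exists>N. \<forall>i\<ge>N. \<forall>j\<ge>N. (\<integral>t. cmod (s i t - s j t) \<partial>\<mu>) < e" if "0 < e" for e
  proof -
    have e2: "0 < e / 2" using that by simp
    obtain s0 where s0: "0 \<le> s0" "s0 < 1" "\<And>q r. \<lbrakk>s0 < q; q < 1; s0 < r; r < 1\<rbrakk> \<Longrightarrow>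
       (\<integral>t. cmod (szego f (of_real r * t) - szego f (of_real q * t)) \<partial>\<mu>) \<le> e / 2"
      using szego_L1_Cauchy[OF fm fp p e2] by blast
    have "\<forall>\<^sub>F j in sequentially. s0 < q j" by (rule order_tendstoD(1)[OF q1 s0(2)])
    then obtain N where "\<And>j. N \<le> j \<Longrightarrow> s0 < q j" by (auto simp: eventually_sequentially)
    then have "\<forall>i\<ge>N. \<forall>j\<ge>N. (\<integral>t. cmod (s i t - s j t) \<partial>\<mu>) \<le> e / 2"
      unfolding s_def using s0(3) q by auto
    moreover have "x < e" if "x \<le> e / 2" for x using that e2 by linarith
    ultimately show ?thesis by blast
  qed
  \<comment> \<open>Only a subsequence needs to converge a.e. to define a candidate for the L^1
    limit.\<close>
  obtain \<rho> where \<rho>: "strict_mono \<rho>" "AE t in \<mu>. Cauchy (\<lambda>i. s (\<rho> i) t)"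
    using cauchy_L1_AE_cauchy_subseq[OF si cauchy] by blast
  define G where "G t = lim (\<lambda>i. s (\<rho> i) t)" for t
  have [measurable]: "s j \<in> borel_measurable \<mu>" for j using si by auto
  have Gm [measurable]: "G \<in> borel_measurable \<mu>"
    unfolding G_def by (rule borel_measurable_lim_metric) measurable
  have Glim: "AE t in \<mu>. (\<lambda>i. s (\<rho> i) t) \<longlonglongrightarrow> G t"
    using \<rho>(2) by eventually_elim (simp add: G_def Cauchy_convergent_iff convergent_LIMSEQ_iff)
  \<comment> \<open>Fatou's lemma along the subsequence carries the Cauchy estimate over to the
    limit, so the whole sequence converges to G in L^1. The estimate uses the nonnegative integral
    because G is not yet known to be integrable.\<close>
  have Gs: "\<exists>N. \<forall>i\<ge>N. (\<integral>\<^sup>+ t. ennreal (cmod (s i t - G t)) \<partial>\<mu>) \<le> ennreal e" if "0 < e" for e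
  proof -
    obtain N where N: "\<forall>i\<ge>N. \<forall>j\<ge>N. (\<integral>t. cmod (s i t - s j t) \<partial>\<mu>) < e" using cauchy[OF \<open>0 < e\<close>] by blast
    show ?thesis
    proof (intro exI allI impI)
      fix i assume i: "N \<le> i"
      have "(\<integral>\<^sup>+ t. ennreal (cmod (s i t - G t)) \<partial>\<mu>) = (\<integral>\<^sup>+ t. liminf (\<lambda>j. ennreal (cmod (s i t - s (\<rho> j) t))) \<partial>\<mu>)"
      proof (rule nn_integral_cong_AE)
        show "AE t in \<mu>. ennreal (cmod (s i t - G t)) = liminf (\<lambda>j. ennreal (cmod (s i t - s (\<rho> j) t)))"
          using Glim
        proof eventually_elim
          case (elim t)
          have "(\<lambda>j. ennreal (cmod (s i t - s (\<rho> j) t))) \<longlonglongrightarrow> ennreal (cmod (s i t - G t))"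
            by (intro tendsto_ennrealI tendsto_intros elim)
          then show ?case by (intro lim_imp_Liminf[symmetric]) simp_all
        qed
      qed
      also have "\<dots> \<le> liminf (\<lambda>j. \<integral>\<^sup>+ t. ennreal (cmod (s i t - s (\<rho> j) t)) \<partial>\<mu>)"
        by (rule nn_integral_liminf) measurable
      also have "\<dots> \<le> ennreal e"
      proof (rule Liminf_le)
        have "\<forall>\<^sub>F j in sequentially. N \<le> \<rho> j"
          using eventually_ge_at_top[of N] by eventually_elim (use seq_suble[OF \<rho>(1)] in \<open>auto intro: order_trans\<close>)
        then show "\<forall>\<^sub>F j in sequentially. (\<integral>\<^sup>+ t. ennreal (cmod (s i t - s (\<rho> j) t)) \<partial>\<mu>) \<le> ennreal e"
        proof eventually_elim
          case (elim j)
          have "(\<integral>\<^sup>+ t. ennreal (cmod (s i t - s (\<rho> j) t)) \<partial>\<mu>) = ennreal (\<integral>t. cmod (s i t - s (\<rho> j) t) \<partial>\<mu>)"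
            using si by (intro nn_integral_eq_integral) auto
          moreover have "(\<integral>t. cmod (s i t - s (\<rho> j) t) \<partial>\<mu>) < e" using N i elim by blast
          ultimately show ?case by (simp add: ennreal_leI)
        qed
      qed simp
      finally show "(\<integral>\<^sup>+ t. ennreal (cmod (s i t - G t)) \<partial>\<mu>) \<le> ennreal e" .
    qed
  qed
  have dint: "integrable \<mu> (\<lambda>t. s i t - G t)"
    if "(\<integral>\<^sup>+ t. ennreal (cmod (s i t - G t)) \<partial>\<mu>) \<le> ennreal e" for i e
    by (rule integrableI_bounded) (use that in \<open>auto intro: le_less_trans[OF _ ennreal_less_top]\<close>)
  have Gi: "integrable \<mu> G"
  proof -
    obtain N where N: "(\<integral>\<^sup>+ t. ennreal (cmod (s N t - G t)) \<partial>\<mu>) \<le> ennreal 1" using Gs[of 1] by auto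
    have "integrable \<mu> (\<lambda>t. s N t - (s N t - G t))"
      by (rule Bochner_Integration.integrable_diff[OF si dint[OF N]])
    then show ?thesis by simp
  qed
  have coeff: "fourier_coeff G n = (if 0 \<le> n then fourier_coeff f n else 0)" for n
  proof -
    have "(\<lambda>i. fourier_coeff (s i) n) \<longlonglongrightarrow> fourier_coeff G n"
    proof (rule LIMSEQ_I)
      fix e :: real assume e: "0 < e"
      then obtain N where N: "\<forall>i\<ge>N. (\<integral>\<^sup>+ t. ennreal (cmod (s i t - G t)) \<partial>\<mu>) \<le> ennreal (e/2)"
        using Gs[of "e/2"] by auto
      have "norm (fourier_coeff (s i) n - fourier_coeff G n) < e" if "N \<le> i" for i
      proof -
        have le: "(\<integral>\<^sup>+ t. ennreal (cmod (s i t - G t)) \<partial>\<mu>) \<le> ennreal (e/2)" using N that by auto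
        have "norm (fourier_coeff (s i) n - fourier_coeff G n) \<le> (\<integral>t. cmod (s i t - G t) \<partial>\<mu>)"
          using norm_fourier_coeff_le[OF dint[OF le]] by (simp add: fourier_coeff_diff[OF si Gi])
        moreover have "ennreal (\<integral>t. cmod (s i t - G t) \<partial>\<mu>) \<le> ennreal (e/2)"
          using le nn_integral_eq_integral[of \<mu> "\<lambda>t. cmod (s i t - G t)"] dint[OF le] by simp
        ultimately show ?thesis using e by simp
      qed
      then show "\<exists>N. \<forall>i\<ge>N. norm (fourier_coeff (s i) n - fourier_coeff G n) < e" by blast
    qed
    moreover have "(\<lambda>i. fourier_coeff (s i) n) \<longlonglongrightarrow> (if 0 \<le> n then fourier_coeff f n else 0)"
    proof -
      have "(\<lambda>i. fourier_coeff f n * of_real (q i) ^ nat n) \<longlonglongrightarrow> fourier_coeff f n * of_real 1 ^ nat n"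
        by (intro tendsto_intros q1)
      then show ?thesis unfolding s_def fourier_coeff_szego[OF f q] by auto
    qed
    ultimately show ?thesis by (rule LIMSEQ_unique)
  qed
  \<comment> \<open>G has the nonnegative-index coefficients of f and no others, so its Cauchy
    integral is that of f and the Cauchy integral of its conjugate is constant. Hence the Poisson
    integral of G is exactly the Cauchy integral of f, and Fatou's theorem applied to G gives the
    radial limits of the latter.\<close>
  have szG: "szego G z = szego f z" if "cmod z < 1" for z
    using szego_sums[OF Gi that] szego_sums[OF f that] by (simp add: coeff sums_unique2)
  have szcG: "szego (\<lambda>u. cnj (G u)) z = cnj (fourier_coeff f 0)" if "cmod z < 1" for z
  proof -
    have "integrable \<mu> (\<lambda>u. cnj (G u))" using Gi by simp
    then have "(\<lambda>n. fourier_coeff (\<lambda>u. cnj (G u)) (int n) * z ^ n) sums szego (\<lambda>u. cnj (G u)) z"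
      by (rule szego_sums[OF _ that])
    moreover have "(\<lambda>n. fourier_coeff (\<lambda>u. cnj (G u)) (int n) * z ^ n) = (\<lambda>n. if n = 0 then cnj (fourier_coeff f 0) else 0)"
      by (auto simp: fourier_coeff_cnj coeff)
    ultimately show ?thesis using sums_single[of 0 "\<lambda>_. cnj (fourier_coeff f 0)"] sums_unique2 by fastforce
  qed
  have "AE t in \<mu>. riesz_projection f t = G t"
    using poisson_tendsto_AE[OF f] poisson_tendsto_AE[OF Gi] AE_space
  proof eventually_elim
    case (elim t)
    then have t: "cmod t = 1" by simp
    have ev: "\<forall>\<^sub>F r::real in at_left 1. 0 \<le> r \<and> r < 1" by (rule eventually_at_leftI[of 0]) auto
    have "((\<lambda>r. - \<i> * (2 * poisson G r t - poisson f r t - fourier_coeff f 0)) \<longlongrightarrow> - \<i> * (2 * G t - f t - fourier_coeff f 0)) (at_left 1)"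
      by (intro tendsto_intros elim(1,2))
    moreover have "\<forall>\<^sub>F r in at_left 1. - \<i> * (2 * poisson G r t - poisson f r t - fourier_coeff f 0) = conjugate_poisson f r t"
      using ev
    proof eventually_elim
      case (elim r)
      then have z: "cmod (of_real r * t) < 1" using t by (simp add: norm_mult)
      have "poisson G r t = szego f (of_real r * t)"
        using poisson_eq_szego[OF Gi t] elim z by (simp add: szG szcG coeff)
      then have "2 * poisson G r t - poisson f r t - fourier_coeff f 0 = \<i> * conjugate_poisson f r t"
        using conjugate_poisson_eq_szego[OF f t, of r] elim by simp
      then show ?case by (simp flip: mult.assoc)
    qed
    ultimately have "((\<lambda>r. conjugate_poisson f r t) \<longlongrightarrow> - \<i> * (2 * G t - f t - fourier_coeff f 0)) (at_left 1)"
      by (rule Lim_transform_eventually)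
    then have "conjugate_function f t = - \<i> * (2 * G t - f t - fourier_coeff f 0)"
      unfolding conjugate_function_def by (intro tendsto_Lim) auto
    then have "\<i> * conjugate_function f t = 2 * G t - f t - fourier_coeff f 0"
      by (simp flip: mult.assoc)
    then show "riesz_projection f t = G t" by (simp add: riesz_projection_def)
  qed
  then show ?thesis by (rule that[OF Gi coeff])
qed

text \<open>Approximate f in L^1 by a continuous function and that by one of its Poisson integrals,
  whose coefficients decay geometrically. Both replacements change every coefficient by less than
  e/3.\<close>

lemma fourier_coeff_tendsto_0:
  assumes f: "integrable \<mu> f" and e: "0 < e"
  shows "\<exists>N. \<forall>n. N \<le> \<bar>n\<bar> \<longrightarrow> cmod (fourier_coeff f n) < e"
proof -
  obtain g where g: "continuous_on UNIV g" "(\<integral>t. cmod (f t - g t) \<partial>\<mu>) < e / 3"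
    using integrable_circle_approx[OF f, of "e/3"] e by auto
  note gi = integrable_continuous_circle[OF continuous_on_subset[OF g(1) subset_UNIV]]
  obtain B where B: "\<And>t. cmod t = 1 \<Longrightarrow> cmod (g t) \<le> B" "0 \<le> B"
    using continuous_on_circle_bounded[OF continuous_on_subset[OF g(1) subset_UNIV]] by blast
  have "\<forall>\<^sub>F s in at_left 1. (\<integral>t. cmod (g t - poisson g s t) powr 1 \<partial>\<mu>) < e / 3"
    by (rule order_tendstoD(2)[OF poisson_bounded_convergence[OF gi B]]) (use e in auto)
  then obtain s0 where s0: "s0 < 1" "\<And>s. s0 < s \<Longrightarrow> s < 1 \<Longrightarrow> (\<integral>t. cmod (g t - poisson g s t) powr 1 \<partial>\<mu>) < e / 3"
    by (auto simp: eventually_at_left_field)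
  obtain s where s: "max s0 0 < s" "s < 1" using dense[of "max s0 0" 1] s0 by auto
  then have s': "0 \<le> s" by simp
  have pi: "integrable \<mu> (poisson g s)" by (rule integrable_poisson_integral[OF gi s' s(2)])
  have gp: "(\<integral>t. cmod (g t - poisson g s t) \<partial>\<mu>) < e / 3" using s0(2)[of s] s by simp
  define C where "C = (\<integral>t. cmod (g t) \<partial>\<mu>)"
  have "(\<lambda>n. s ^ n * C) \<longlonglongrightarrow> 0 * C" using s s' by (intro tendsto_intros LIMSEQ_realpow_zero) auto
  then have "\<forall>\<^sub>F n in sequentially. s ^ n * C < e / 3" using e by (intro order_tendstoD(2)) auto
  then obtain N where N: "\<And>n. N \<le> n \<Longrightarrow> s ^ n * C < e / 3" by (auto simp: eventually_sequentially)
  have "cmod (fourier_coeff f n) < e" if n: "int N \<le> \<bar>n\<bar>" for n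
  proof -
    have 1: "cmod (fourier_coeff f n - fourier_coeff g n) < e / 3"
      using norm_fourier_coeff_le[of "\<lambda>t. f t - g t" n] g(2) f gi by (simp add: fourier_coeff_diff)
    have 2: "cmod (fourier_coeff g n - fourier_coeff (poisson g s) n) < e / 3"
      using norm_fourier_coeff_le[of "\<lambda>t. g t - poisson g s t" n] gp pi gi by (simp add: fourier_coeff_diff)
    have "cmod (fourier_coeff (poisson g s) n) \<le> s ^ nat \<bar>n\<bar> * C"
      unfolding fourier_coeff_poisson[OF gi s' s(2)] norm_mult C_def
      using s' by (simp add: norm_power mult_left_mono norm_fourier_coeff_le[OF gi])
    also have "\<dots> < e / 3" by (rule N) (use n in linarith)
    finally have 3: "cmod (fourier_coeff (poisson g s) n) < e / 3" .
    have "fourier_coeff f n = (fourier_coeff f n - fourier_coeff g n) + (fourier_coeff g n - fourier_coeff (poisson g s) n) + fourier_coeff (poisson g s) n" by simp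
    then have "cmod (fourier_coeff f n) \<le> cmod (fourier_coeff f n - fourier_coeff g n) + cmod (fourier_coeff g n - fourier_coeff (poisson g s) n) + cmod (fourier_coeff (poisson g s) n)"
      by (metis (no_types, lifting) norm_triangle_ineq add_right_mono order_trans)
    then show ?thesis using 1 2 3 by simp
  qed
  then show ?thesis by blast
qed

text \<open>If all coefficients vanish then so does every Poisson integral, and its radial limits
  recover f a.e.\<close>

lemma fourier_coeff_zero_AE:
  assumes f: "integrable \<mu> f" and 0: "\<And>n. fourier_coeff f n = 0"
  shows "AE t in \<mu>. f t = 0"
  using poisson_tendsto_AE[OF f] AE_space
proof eventually_elim
  case (elim t)
  then have t: "cmod t = 1" by simp
  have sz: "szego g z = 0" if "integrable \<mu> g" "\<And>n. fourier_coeff g n = 0" "cmod z < 1" for g z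
    using szego_sums[OF that(1,3)] sums_unique2[OF _ sums_zero] by (simp add: that(2))
  have fc: "integrable \<mu> (\<lambda>u. cnj (f u))" using f by simp
  have "\<forall>\<^sub>F r::real in at_left 1. 0 \<le> r \<and> r < 1" by (rule eventually_at_leftI[of 0]) auto
  then have "\<forall>\<^sub>F r in at_left 1. poisson f r t = 0"
  proof eventually_elim
    case (elim r)
    then have z: "cmod (of_real r * t) < 1" using t by (simp add: norm_mult)
    show ?case
      using poisson_eq_szego[OF f t, of r] elim sz[OF f 0 z] sz[OF fc _ z] by (simp add: fourier_coeff_cnj 0)
  qed
  then have "((\<lambda>r. poisson f r t) \<longlongrightarrow> 0) (at_left 1)" by (rule tendsto_eventually)
  then show "f t = 0" using elim(1) tendsto_unique[of "at_left (1::real)"] by auto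
qed

subsection \<open>Boyd indices and Lebesgue spaces\<close>

text \<open>An arc starting at angle 0, half-open to match \<open>dilation\<close>, which measures
  angles by \<open>Arg2pi\<close> in [0, 2 pi).\<close>

definition arc :: "real \<Rightarrow> complex set" where
  "arc c = cis ` {0..<c}"

lemma Arg2pi_cis: "0 \<le> x \<Longrightarrow> x < 2*pi \<Longrightarrow> Arg2pi (cis x) = x"
  by (rule Arg2pi_unique[of 1]) (auto simp: cis_conv_exp)

text \<open>A continuous image of a half-open interval is a countable union of compact sets.\<close>

lemma arc_borel [measurable]: "arc c \<in> sets borel"
proof -
  have "arc c = (\<Union>n::nat. cis ` {0..c - 1 / real (Suc n)})"
  proof
    show "arc c \<subseteq> (\<Union>n::nat. cis ` {0..c - 1 / real (Suc n)})"
    proof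
      fix t assume "t \<in> arc c"
      then obtain x where x: "0 \<le> x" "x < c" "t = cis x" by (auto simp: arc_def)
      then obtain n where "inverse (real (Suc n)) < c - x" using reals_Archimedean[of "c - x"] by auto
      then have "x \<in> {0..c - 1 / real (Suc n)}" using x by (simp add: inverse_eq_divide)
      then show "t \<in> (\<Union>n::nat. cis ` {0..c - 1 / real (Suc n)})" using x(3) by blast
    qed
    show "(\<Union>n::nat. cis ` {0..c - 1 / real (Suc n)}) \<subseteq> arc c"
    proof
      fix t assume "t \<in> (\<Union>n::nat. cis ` {0..c - 1 / real (Suc n)})"
      then obtain n :: nat and x where x: "0 \<le> x" "x \<le> c - 1 / real (Suc n)" "t = cis x" by auto
      moreover have "0 < 1 / real (Suc n)" by simp
      ultimately have "x < c" by linarith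
      then show "t \<in> arc c" using x by (auto simp: arc_def)
    qed
  qed
  moreover have "cis ` {0..c - 1 / real (Suc n)} \<in> sets borel" for n
    by (intro borel_compact compact_continuous_image continuous_intros) auto
  ultimately show ?thesis by simp
qed

lemma arc_subset: "arc c \<subseteq> sphere 0 1"
  by (auto simp: arc_def)

lemma arc_sets [measurable]: "arc c \<in> sets \<mu>"
  using sets_circle_Int[OF arc_borel[of c]] arc_subset by (simp add: Int_absorb2)

lemma measure_arc:
  assumes "0 \<le> u" "u \<le> 1"
  shows "measure \<mu> (arc (2*pi*u)) = u"
proof -
  have u: "2*pi*u \<le> 2*pi" using assms by simp
  have "{0..<2*pi} \<inter> cis -` arc (2*pi*u) = {0..<2*pi*u}"
  proof
    show "{0..<2*pi} \<inter> cis -` arc (2*pi*u) \<subseteq> {0..<2*pi*u}"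
    proof
      fix x assume x: "x \<in> {0..<2*pi} \<inter> cis -` arc (2*pi*u)"
      then obtain y where y: "0 \<le> y" "y < 2*pi*u" "cis x = cis y" by (auto simp: arc_def)
      then have "x = y" using Arg2pi_cis[of x] Arg2pi_cis[of y] x u by simp
      then show "x \<in> {0..<2*pi*u}" using y by simp
    qed
    show "{0..<2*pi*u} \<subseteq> {0..<2*pi} \<inter> cis -` arc (2*pi*u)"
      using u by (auto simp: arc_def)
  qed
  then have "emeasure \<mu> (arc (2*pi*u) \<inter> sphere 0 1) = ennreal (2*pi*u) / ennreal (2*pi)"
    using assms by (subst emeasure_circle) auto
  also have "\<dots> = ennreal u" using assms by (simp add: divide_ennreal)
  finally show ?thesis
    using assms arc_subset by (simp add: Int_absorb2 circle.emeasure_eq_measure)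
qed

context banach_function_space
begin

lemma const_mem: "(\<lambda>_. c) \<in> X"
  by (rule Linfty_sub) auto

lemma norm_const: "N (\<lambda>_. c) = cmod c * N (\<lambda>_. 1)"
  using norm_scale[OF const_mem[of 1], of c] by simp

lemma norm_one_pos: "0 < N (\<lambda>_. 1)"
proof -
  have "\<not> (AE t in \<mu>. (1::complex) = 0)" by simp
  then have "N (\<lambda>_. 1) \<noteq> 0" using norm_eq_0[OF const_mem[of 1]] by simp
  then show ?thesis using norm_nonneg[OF const_mem[of 1]] by simp
qed

lemma indicator_mem: "A \<in> sets \<mu> \<Longrightarrow> indicator A \<in> X"
  by (rule Linfty_sub) (auto intro!: exI[of _ 1] simp: indicator_def)

lemma diff_mem: "f \<in> X \<Longrightarrow> g \<in> X \<Longrightarrow> (\<lambda>t. f t - g t) \<in> X"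
  using add_mem[OF _ scale_mem[of g "- 1"], of f] by simp

lemma norm_diff_commute:
  assumes "f \<in> X" "g \<in> X"
  shows "N (\<lambda>t. f t - g t) = N (\<lambda>t. g t - f t)"
  using norm_scale[OF diff_mem[OF assms], of "- 1"] by simp

lemma norm_diff_triangle:
  assumes "f \<in> X" "g \<in> X" "h \<in> X"
  shows "N (\<lambda>t. f t - h t) \<le> N (\<lambda>t. f t - g t) + N (\<lambda>t. h t - g t)"
  using norm_triangle[OF diff_mem[OF assms(1,2)] diff_mem[OF assms(2,3)]] norm_diff_commute[OF assms(2,3)] by simp

end

context ri_banach_function_space
begin

lemma norm_indicator_eq:
  assumes A: "A \<in> sets \<mu>" and B: "B \<in> sets \<mu>"
    and eq: "measure \<mu> A = measure \<mu> B"
  shows "N (indicator A) = N (indicator B)"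
proof -
  have *: "{t \<in> space \<mu>. c < cmod (indicator C t)} = (if c < 1 then C else {})"
    if "C \<in> sets \<mu>" "0 \<le> c" for C c
    using sets.sets_into_space[OF that(1)] that(2) by (auto simp: indicator_def)
  have "equimeasurable (indicator A) (indicator B)"
    unfolding equimeasurable_def using *[OF A] *[OF B] eq by auto
  moreover have "indicator B \<in> L0" using B by simp
  ultimately show ?thesis using rearrangement_invariant[OF indicator_mem[OF A]] by blast
qed

text \<open>The dilation by \<open>1/s\<close> carries the indicator of an arc of measure \<open>1/s\<close> to \<open>1\<close>, so its norm
  bounds the fundamental function from below.\<close>

lemma indicator_arc_ge:
  assumes s: "1 \<le> s" and op: "op_norm X N (dilation (1 / s)) \<le> ennreal c" and c: "0 < c"
  shows "N (\<lambda>_. 1) / c \<le> N (indicator (arc (2*pi*(1/s))))"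
proof -
  let ?A = "arc (2*pi*(1/s))"
  define n where "n = N (indicator ?A)"
  have mA: "measure \<mu> ?A = 1/s" by (rule measure_arc) (use s in auto)
  have "n \<noteq> 0"
  proof
    assume "n = 0"
    then have "AE t in \<mu>. indicator ?A t = (0::complex)"
      using norm_eq_0[OF indicator_mem[OF arc_sets]] by (simp add: n_def)
    then have "AE t in \<mu>. t \<notin> ?A" by eventually_elim (auto simp: indicator_def split: if_splits)
    then have "?A \<in> null_sets \<mu>" by (subst AE_iff_null_sets) auto
    then have "measure \<mu> ?A = 0" by (simp add: measure_eq_0_null_sets)
    then show False using mA s by simp
  qed
  then have n: "0 < n" using norm_nonneg[OF indicator_mem[OF arc_sets]] by (simp add: n_def less_le)
  define f :: "complex \<Rightarrow> complex" where "f t = of_real (1 / n) * indicator ?A t" for t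
  have fX: "f \<in> X" unfolding f_def by (rule scale_mem[OF indicator_mem[OF arc_sets]])
  have "N f = cmod (of_real (1 / n)) * N (indicator ?A)"
    unfolding f_def by (rule norm_scale[OF indicator_mem[OF arc_sets]])
  then have Nf: "N f = 1" using n by (simp add: n_def norm_divide)
  have D: "dilation (1 / s) f = (\<lambda>_. of_real (1 / n))"
  proof
    fix t
    have A: "0 \<le> Arg2pi t" "Arg2pi t < 2*pi" using Arg2pi[of t] by auto
    have "Arg2pi t / s \<le> Arg2pi t / 1" using A s by (intro divide_left_mono) auto
    then have lt: "Arg2pi t * (1 / s) < 2*pi" using A by simp
    have "Arg2pi t * (1/s) < 2*pi*(1/s)" using A s by (intro mult_strict_right_mono) auto
    moreover have "0 \<le> Arg2pi t * (1/s)" using A s by simp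
    ultimately have "cis (Arg2pi t * (1/s)) \<in> ?A" unfolding arc_def by (intro imageI) auto
    then show "dilation (1 / s) f t = of_real (1 / n)" using lt by (simp add: dilation_def f_def)
  qed
  have "ennreal (N (dilation (1 / s) f)) \<le> op_norm X N (dilation (1 / s))"
    unfolding op_norm_def using fX Nf by (intro SUP_upper) auto
  also have "\<dots> \<le> ennreal c" by fact
  finally have "N (dilation (1 / s) f) \<le> c" using c by simp
  then have "N (\<lambda>_. 1) / n \<le> c" using n norm_const[of "of_real (1/n)"] by (simp add: D norm_divide)
  then show ?thesis using n c by (simp add: n_def field_simps)
qed

text \<open>The norm of an indicator depends only on the measure of the set, so it can be computed
  on arcs. There a power bound for the dilation norms at large s becomes a power lower bound for the
  fundamental function of the space.\<close>

lemma indicator_norm_ge: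
  assumes boyd: "nontrivial_boyd_indices X N"
  obtains b k where "0 < b" "b < 1" "0 < k"
    "\<And>A. A \<in> sets \<mu> \<Longrightarrow> k * measure \<mu> A powr b \<le> N (indicator A)"
proof -
  let ?op = "\<lambda>s. op_norm X N (dilation (1 / s))"
  obtain \<beta> where \<beta>: "0 < \<beta>" "\<beta> < 1" "((\<lambda>s. ln (enn2real (?op s)) / ln s) \<longlongrightarrow> \<beta>) at_top"
    using boyd by (auto simp: nontrivial_boyd_indices_def has_boyd_indices_def)
  \<comment> \<open>A margin above the index: the dilation norm is eventually at most s^b although
    only its logarithmic growth rate \<beta> is known, and b is still below 1.\<close>
  define b where "b = (1 + \<beta>) / 2"
  have b: "0 < b" "b < 1" "\<beta> < b" using \<beta> by (simp_all add: b_def)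
  \<comment> \<open>Strict positivity of the quotient carries information: \<open>enn2real\<close>
    sends \<infinity> to 0 and \<open>ln\<close> sends 0 to 0, so an infinite operator norm would
    give the quotient 0.\<close>
  have "\<forall>\<^sub>F s in at_top. 0 < ln (enn2real (?op s)) / ln s \<and> ln (enn2real (?op s)) / ln s < b \<and> 1 < s"
    using order_tendstoD(1)[OF \<beta>(3) \<beta>(1)] order_tendstoD(2)[OF \<beta>(3) b(3)] eventually_gt_at_top[of 1]
    by eventually_elim auto
  then obtain S where S: "\<And>s. S \<le> s \<Longrightarrow> 0 < ln (enn2real (?op s)) / ln s \<and> ln (enn2real (?op s)) / ln s < b \<and> 1 < s"
    by (auto simp: eventually_at_top_linorder)
  have S1: "1 < S" using S[of S] by simp
  have arc_ge: "N (\<lambda>_. 1) / s powr b \<le> N (indicator (arc (2*pi*(1/s))))" if s: "S \<le> s" for s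
  proof (rule indicator_arc_ge)
    have s1: "1 < s" and l: "0 < ln (enn2real (?op s)) / ln s" "ln (enn2real (?op s)) / ln s < b"
      using S[OF s] by auto
    have ls: "0 < ln s" using s1 by simp
    have ln: "0 < ln (enn2real (?op s))" "ln (enn2real (?op s)) < b * ln s"
      using l ls by (simp_all add: zero_less_divide_iff pos_divide_less_eq)
    have pos: "0 < enn2real (?op s)"
      using ln(1) enn2real_nonneg[of "?op s"] by (cases "enn2real (?op s) = 0") auto
    have "enn2real (?op s) = exp (ln (enn2real (?op s)))" using pos by simp
    also have "\<dots> \<le> s powr b" using ln(2) s1 by (simp add: powr_def)
    finally have le: "enn2real (?op s) \<le> s powr b" .
    have "?op s \<noteq> top" using pos by auto
    then have "?op s = ennreal (enn2real (?op s))" by (simp add: less_top)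
    also have "\<dots> \<le> ennreal (s powr b)" by (rule ennreal_leI[OF le])
    finally show "?op s \<le> ennreal (s powr b)" .
    show "1 \<le> s" "0 < s powr b" using s1 by auto
  qed
  \<comment> \<open>One constant for both ranges of the measure u. If u is at most 1/S, the arc
    estimate holds with s = 1/u and k is at most the norm of 1. Otherwise the arc contains the one
    of measure 1/S, whose norm is at least k, while u^b is at most 1.\<close>
  define k where "k = N (\<lambda>_. 1) / S powr b"
  have k: "0 < k" using norm_one_pos S1 by (simp add: k_def)
  show ?thesis
  proof (rule that[OF b(1,2) k])
    fix A assume A: "A \<in> sets \<mu>"
    define u where "u = measure \<mu> A"
    have u: "0 \<le> u" "u \<le> 1" using circle.prob_le_1 by (auto simp: u_def)
    show "k * measure \<mu> A powr b \<le> N (indicator A)"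
    proof (cases "u = 0")
      case True
      then show ?thesis using norm_nonneg[OF indicator_mem[OF A]] by (simp add: u_def)
    next
      case False
      then have u0: "0 < u" using u by simp
      have NA: "N (indicator A) = N (indicator (arc (2*pi*u)))"
        by (rule norm_indicator_eq[OF A arc_sets]) (use measure_arc[OF u] in \<open>simp add: u_def\<close>)
      show ?thesis
      proof (cases "S \<le> 1 / u")
        case True
        have "k * u powr b \<le> N (\<lambda>_. 1) * u powr b"
          using norm_one_pos S1 b by (intro mult_right_mono) (auto simp: k_def divide_le_eq ge_one_powr_ge_zero)
        also have "\<dots> = N (\<lambda>_. 1) / (1 / u) powr b" using u0 by (simp add: powr_divide)
        also have "\<dots> \<le> N (indicator (arc (2*pi*(1/(1/u)))))" by (rule arc_ge[OF True])
        finally show ?thesis using NA u0 by (simp add: u_def)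
      next
        case False
        then have Su: "1 / S \<le> u" using u0 S1 by (simp add: field_simps)
        have "k * u powr b \<le> k * 1" using k u b by (intro mult_left_mono) (auto intro: powr_le1)
        also have "\<dots> \<le> N (indicator (arc (2*pi*(1/S))))" using arc_ge[of S] by (simp add: k_def)
        also have "\<dots> \<le> N (indicator (arc (2*pi*u)))"
        proof -
          have "2*pi*(1/S) \<le> 2*pi*u" using Su by (intro mult_left_mono) auto
          then have "arc (2*pi*(1/S)) \<subseteq> arc (2*pi*u)" by (auto simp: arc_def)
          then have "AE t in \<mu>. cmod (indicator (arc (2*pi*(1/S))) t) \<le> cmod (indicator (arc (2*pi*u)) t)"
            by (intro AE_I2) (auto simp: indicator_def)
          then show ?thesis
            using ideal[OF indicator_mem[OF arc_sets], of "indicator (arc (2*pi*(1/S)))"] by simp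
        qed
        finally show ?thesis using NA by (simp add: u_def)
      qed
    qed
  qed
qed

text \<open>For x > 1 let 2^(j+1) be the first power of 2 that is at least x. Then 2^j < x, and the
  single term with index j already dominates x^p.\<close>

lemma powr_dyadic_bound:
  fixes x p :: real
  assumes "0 \<le> x" "0 < p"
  shows "ennreal (x powr p) \<le> 1 + (\<Sum>j. ennreal (2 powr (real (Suc j) * p)) * indicator {y. 2 ^ j < y} x)"
proof (cases "x \<le> 1")
  case True
  then have "x powr p \<le> 1" using assms by (intro powr_le1) auto
  then have "ennreal (x powr p) \<le> 1" by simp
  then show ?thesis by (simp add: add_increasing2)
next
  case False
  have single: "g j \<le> (\<Sum>i. g i)" for g :: "nat \<Rightarrow> ennreal" and j
    using sum_le_suminf[of g "{j}"] by auto
  obtain n where n: "x < 2 ^ n" using real_arch_pow[of 2 x] by auto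
  define m where "m = (LEAST n. x \<le> 2 ^ n)"
  have m: "x \<le> 2 ^ m" unfolding m_def by (rule LeastI[of _ n]) (use n in simp)
  have "m \<noteq> 0" using m False by (cases m) auto
  then obtain j where j: "m = Suc j" by (cases m) auto
  have "\<not> x \<le> 2 ^ j" unfolding m_def[symmetric] using not_less_Least[of j "\<lambda>n. x \<le> 2 ^ n"] j by (simp add: m_def)
  then have jx: "2 ^ j < x" by simp
  have "x powr p \<le> (2 ^ Suc j) powr p" using m j assms by (intro powr_mono2) auto
  also have "\<dots> = 2 powr (real (Suc j) * p)" by (simp only: powr_realpow[symmetric] powr_powr zero_less_numeral)
  finally have "ennreal (x powr p) \<le> ennreal (2 powr (real (Suc j) * p)) * indicator {y. 2 ^ j < y} x"
    using jx by (simp add: ennreal_leI)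
  also have "\<dots> \<le> (\<Sum>j. ennreal (2 powr (real (Suc j) * p)) * indicator {y. 2 ^ j < y} x)"
    by (rule single)
  finally show ?thesis by (simp add: add_increasing)
qed

text \<open>An upper Boyd index below \<open>1\<close> embeds the space into weak \<open>L^q\<close> for some \<open>q = 1/b > 1\<close>, hence
  into \<open>L^p\<close> for \<open>1 < p < q\<close>.\<close>

lemma Lp_embedding:
  assumes boyd: "nontrivial_boyd_indices X N"
  obtains p K where "1 < p" "p < 2" "0 \<le> K"
    "\<And>f. f \<in> X \<Longrightarrow> N f \<le> 1 \<Longrightarrow> (\<integral>\<^sup>+ t. ennreal (cmod (f t) powr p) \<partial>\<mu>) \<le> ennreal K"
proof -
  obtain b k where bk: "0 < b" "b < 1" "0 < k"
    "\<And>A. A \<in> sets \<mu> \<Longrightarrow> k * measure \<mu> A powr b \<le> N (indicator A)"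
    using indicator_norm_ge[OF boyd] by blast
  define P where "P = 1 / b"
  have P: "1 < P" using bk by (simp add: P_def)
  \<comment> \<open>Halfway between 1 and the smaller of P and 2, hence strictly below both.\<close>
  define p where "p = (1 + min P 2) / 2"
  have p: "1 < p" "p < 2" "p < P" using P by (auto simp: p_def min_def)
  \<comment> \<open>The ratio of the geometric series below: 2^((j+1) p) times the weak-type bound
    (2^j k)^(-P) equals c q^j, and q < 1 because p < P.\<close>
  define q where "q = 2 powr (p - P)"
  have q: "0 < q" "q < 1"
    using p powr_less_mono[of "p - P" 0 2] by (simp_all add: q_def)
  define c where "c = 2 powr p * k powr (- P)"
  have c: "0 \<le> c" by (simp add: c_def)
  define K where "K = 1 + c / (1 - q)"
  have K: "0 \<le> K" using c q by (simp add: K_def)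
  show ?thesis
  proof (rule that[OF p(1,2) K])
    fix f assume f: "f \<in> X" and Nf: "N f \<le> 1"
    have [measurable]: "f \<in> L0" using f sub_L0 by auto
    let ?A = "\<lambda>l::real. {t \<in> space \<mu>. l < cmod (f t)}"
    have As [measurable]: "?A l \<in> sets \<mu>" for l by measurable
    \<comment> \<open>Chebyshev's inequality in the lattice norm: l times the indicator of the set
      where |f| > l is dominated by |f|, so its norm is at most 1. The lower bound for indicators
      then limits the b-th power of the measure, and raising to P = 1/b finishes.\<close>
    have weak: "measure \<mu> (?A l) \<le> (l * k) powr (- P)" if l: "0 < l" for l
    proof -
      have "(\<lambda>t. of_real l * indicator (?A l) t) \<in> X \<and> N (\<lambda>t. of_real l * indicator (?A l) t) \<le> N f"
      proof (rule ideal[OF f])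
        show "(\<lambda>t. of_real l * indicator (?A l) t) \<in> L0" by measurable
        show "AE t in \<mu>. cmod (of_real l * indicator (?A l) t) \<le> cmod (f t)"
          by (rule AE_I2) (use l in \<open>auto simp: indicator_def norm_mult\<close>)
      qed
      then have "l * N (indicator (?A l)) \<le> 1"
        using norm_scale[OF indicator_mem[OF As], of "of_real l" l] l Nf by simp
      moreover have "l * (k * measure \<mu> (?A l) powr b) \<le> l * N (indicator (?A l))"
        using l bk(4)[OF As] by (intro mult_left_mono) auto
      ultimately have "(l * k) * measure \<mu> (?A l) powr b \<le> 1" by (simp add: mult.assoc)
      then have "measure \<mu> (?A l) powr b \<le> 1 / (l * k)" using l bk(3) by (simp add: pos_le_divide_eq mult.commute)
      then have "(measure \<mu> (?A l) powr b) powr P \<le> (1 / (l * k)) powr P"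
        using P by (intro powr_mono2) auto
      moreover have "(measure \<mu> (?A l) powr b) powr P = measure \<mu> (?A l)"
        using bk(1) by (simp add: powr_powr P_def)
      moreover have "(1 / (l * k)) powr P = (l * k) powr (- P)"
        using l bk(3) by (simp add: powr_divide powr_minus_divide)
      ultimately show ?thesis by simp
    qed
    have dyadic: "ennreal (2 powr (real (Suc j) * p)) * emeasure \<mu> (?A (2 ^ j)) \<le> ennreal (c * q ^ j)" for j
    proof -
      have "2 powr (real (Suc j) * p) * measure \<mu> (?A (2 ^ j)) \<le> 2 powr (real (Suc j) * p) * (2 ^ j * k) powr (- P)"
        by (intro mult_left_mono weak) auto
      also have "(2 ^ j * k) powr (- P) = 2 powr (- (real j * P)) * k powr (- P)"
        using bk(3) by (simp add: powr_mult powr_realpow[symmetric] powr_powr)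
      also have "2 powr (real (Suc j) * p) * (2 powr (- (real j * P)) * k powr (- P)) = c * q ^ j"
      proof -
        have "q ^ j = 2 powr (real j * (p - P))"
          using q by (simp add: q_def powr_realpow[symmetric] powr_powr mult.commute)
        moreover have "2 powr (real (Suc j) * p) * 2 powr (- (real j * P)) = 2 powr p * 2 powr (real j * (p - P))"
          by (simp add: powr_add[symmetric] algebra_simps)
        ultimately show ?thesis by (simp add: c_def mult_ac)
      qed
      finally show ?thesis by (simp add: circle.emeasure_eq_measure ennreal_mult'[symmetric] ennreal_leI)
    qed
    have "(\<integral>\<^sup>+ t. ennreal (cmod (f t) powr p) \<partial>\<mu>) \<le>
        (\<integral>\<^sup>+ t. 1 + (\<Sum>j. ennreal (2 powr (real (Suc j) * p)) * indicator (?A (2 ^ j)) t) \<partial>\<mu>)"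
    proof (rule nn_integral_mono)
      fix t assume t: "t \<in> space \<mu>"
      have "indicator {y. 2 ^ j < y} (cmod (f t)) = (indicator (?A (2 ^ j)) t :: ennreal)" for j
        using t by (simp add: indicator_def)
      then show "ennreal (cmod (f t) powr p) \<le> 1 + (\<Sum>j. ennreal (2 powr (real (Suc j) * p)) * indicator (?A (2 ^ j)) t)"
        using powr_dyadic_bound[of "cmod (f t)" p] p by simp
    qed
    also have "\<dots> = 1 + (\<Sum>j. ennreal (2 powr (real (Suc j) * p)) * emeasure \<mu> (?A (2 ^ j)))"
    proof -
      have gm [measurable]: "(\<lambda>t. ennreal (2 powr (real (Suc j) * p)) * indicator (?A (2 ^ j)) t) \<in> borel_measurable \<mu>" for j
        by (intro borel_measurable_times_ennreal borel_measurable_const borel_measurable_indicator As)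
      have "(\<integral>\<^sup>+ t. (\<Sum>j. ennreal (2 powr (real (Suc j) * p)) * indicator (?A (2 ^ j)) t) \<partial>\<mu>) =
          (\<Sum>j. \<integral>\<^sup>+ t. ennreal (2 powr (real (Suc j) * p)) * indicator (?A (2 ^ j)) t \<partial>\<mu>)"
        by (rule nn_integral_suminf[OF gm])
      also have "\<dots> = (\<Sum>j. ennreal (2 powr (real (Suc j) * p)) * emeasure \<mu> (?A (2 ^ j)))"
        by (simp only: nn_integral_cmult_indicator[OF As])
      finally have sum: "(\<integral>\<^sup>+ t. (\<Sum>j. ennreal (2 powr (real (Suc j) * p)) * indicator (?A (2 ^ j)) t) \<partial>\<mu>) =
          (\<Sum>j. ennreal (2 powr (real (Suc j) * p)) * emeasure \<mu> (?A (2 ^ j)))" .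
      have one: "(\<integral>\<^sup>+ t. 1 \<partial>\<mu>) = (1 :: ennreal)" using circle.emeasure_space_1 by simp
      have "(\<integral>\<^sup>+ t. 1 + (\<Sum>j. ennreal (2 powr (real (Suc j) * p)) * indicator (?A (2 ^ j)) t) \<partial>\<mu>) =
          (\<integral>\<^sup>+ t. 1 \<partial>\<mu>) + (\<integral>\<^sup>+ t. (\<Sum>j. ennreal (2 powr (real (Suc j) * p)) * indicator (?A (2 ^ j)) t) \<partial>\<mu>)"
        by (rule nn_integral_add) (rule borel_measurable_const, rule borel_measurable_suminf_order[OF gm])
      then show ?thesis unfolding sum one .
    qed
    also have "\<dots> \<le> 1 + (\<Sum>j. ennreal (c * q ^ j))"
      by (intro add_left_mono suminf_le dyadic) auto
    also have "(\<Sum>j. ennreal (c * q ^ j)) = ennreal (c / (1 - q))"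
    proof -
      have "(\<lambda>j. c * q ^ j) sums (c * (1 / (1 - q)))"
        using q by (intro sums_mult geometric_sums) auto
      then show ?thesis using c q by (intro suminf_ennreal_eq) auto
    qed
    also have "1 + ennreal (c / (1 - q)) = ennreal K"
      using c q by (simp add: K_def ennreal_plus)
    finally show "(\<integral>\<^sup>+ t. ennreal (cmod (f t) powr p) \<partial>\<mu>) \<le> ennreal K" .
  qed
qed

text \<open>Rescaling removes the restriction to the unit ball. The inclusion constant serves the
  compactness criterion, whose statement provides none.\<close>

lemma integrable_powr_and_L1_inclusion:
  assumes boyd: "nontrivial_boyd_indices X N"
  obtains p m where "1 < p" "p < 2" "L1_inclusion_constant X N m"
    "\<And>f. f \<in> X \<Longrightarrow> integrable \<mu> (\<lambda>t. cmod (f t) powr p)"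
proof -
  obtain p K where pK: "1 < p" "p < 2" "0 \<le> K"
    "\<And>f. f \<in> X \<Longrightarrow> N f \<le> 1 \<Longrightarrow> (\<integral>\<^sup>+ t. ennreal (cmod (f t) powr p) \<partial>\<mu>) \<le> ennreal K"
    using Lp_embedding[OF boyd] by blast
  have int: "integrable \<mu> (\<lambda>t. cmod (f t) powr p)" if f: "f \<in> X" for f
  proof -
    have [measurable]: "f \<in> L0" using f sub_L0 by auto
    define c where "c = 1 / (N f + 1)"
    have c: "0 < c" "c * N f \<le> 1" using norm_nonneg[OF f] by (simp_all add: c_def)
    have "N (\<lambda>t. of_real c * f t) \<le> 1" using norm_scale[OF f, of "of_real c"] c by simp
    then have le: "(\<integral>\<^sup>+ t. ennreal (cmod (of_real c * f t) powr p) \<partial>\<mu>) \<le> ennreal K"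
      by (rule pK(4)[OF scale_mem[OF f]])
    have "integrable \<mu> (\<lambda>t. cmod (of_real c * f t) powr p)"
      by (rule integrableI_bounded) (use le in \<open>auto intro: le_less_trans[OF _ ennreal_less_top]\<close>)
    then have "integrable \<mu> (\<lambda>t. (1 / c) powr p * cmod (of_real c * f t) powr p)" by simp
    moreover have "(1 / c) powr p * cmod (of_real c * f t) powr p = cmod (f t) powr p" for t
      using c by (simp add: norm_mult powr_mult powr_divide)
    ultimately show ?thesis by simp
  qed
  have L1: "(\<integral>\<^sup>+ t. ennreal (cmod (f t)) \<partial>\<mu>) \<le> ennreal (1 + K)" if f: "f \<in> X" "N f \<le> 1" for f
  proof -
    have [measurable]: "f \<in> L0" using f sub_L0 by auto
    have "(\<integral>\<^sup>+ t. ennreal (cmod (f t)) \<partial>\<mu>) \<le> (\<integral>\<^sup>+ t. 1 + ennreal (cmod (f t) powr p) \<partial>\<mu>)"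
    proof (rule nn_integral_mono)
      fix t
      have "cmod (f t) \<le> 1 + cmod (f t) powr p" using le_add_powr[of "cmod (f t)" 1 p] pK(1) by simp
      then have "ennreal (cmod (f t)) \<le> ennreal (1 + cmod (f t) powr p)" by (rule ennreal_leI)
      then show "ennreal (cmod (f t)) \<le> 1 + ennreal (cmod (f t) powr p)" by (simp add: ennreal_plus)
    qed
    also have "\<dots> = 1 + (\<integral>\<^sup>+ t. ennreal (cmod (f t) powr p) \<partial>\<mu>)"
      by (subst nn_integral_add) (auto simp: circle.emeasure_space_1[simplified])
    also have "\<dots> \<le> 1 + ennreal K" by (intro add_left_mono pK(4) f)
    finally show ?thesis using pK(3) by (simp add: ennreal_plus)
  qed
  have "L1_inclusion_constant X N (1 / (1 + K))"
    unfolding L1_inclusion_constant_def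
  proof (intro conjI ballI)
    show "0 < 1 / (1 + K)" using pK(3) by simp
    fix f assume f: "f \<in> X"
    have [measurable]: "f \<in> L0" using f sub_L0 by auto
    show "ennreal (1 / (1 + K)) * (\<integral>\<^sup>+ t. ennreal (cmod (f t)) \<partial>\<mu>) \<le> ennreal (N f)"
    proof (cases "N f = 0")
      case True
      then have "AE t in \<mu>. f t = 0" using norm_eq_0[OF f] by simp
      then have "(\<integral>\<^sup>+ t. ennreal (cmod (f t)) \<partial>\<mu>) = 0"
        by (subst nn_integral_0_iff_AE) auto
      then show ?thesis by simp
    next
      case False
      then have n: "0 < N f" using norm_nonneg[OF f] by simp
      have "N (\<lambda>t. of_real (1 / N f) * f t) \<le> 1" using norm_scale[OF f, of "of_real (1 / N f)"] n by (simp add: norm_divide)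
      then have le: "(\<integral>\<^sup>+ t. ennreal (cmod (of_real (1 / N f) * f t)) \<partial>\<mu>) \<le> ennreal (1 + K)"
        by (rule L1[OF scale_mem[OF f]])
      have eq: "(\<integral>\<^sup>+ t. ennreal (cmod (f t)) \<partial>\<mu>) = ennreal (N f) * (\<integral>\<^sup>+ t. ennreal (cmod (of_real (1 / N f) * f t)) \<partial>\<mu>)"
      proof -
        have "(\<integral>\<^sup>+ t. ennreal (cmod (f t)) \<partial>\<mu>) = (\<integral>\<^sup>+ t. ennreal (N f) * ennreal (cmod (of_real (1 / N f) * f t)) \<partial>\<mu>)"
          by (rule nn_integral_cong) (use n in \<open>simp add: norm_mult norm_divide flip: ennreal_mult'\<close>)
        then show ?thesis by (simp add: nn_integral_cmult)
      qed
      have "ennreal (1 / (1 + K)) * (\<integral>\<^sup>+ t. ennreal (cmod (f t)) \<partial>\<mu>) \<le> ennreal (1 / (1 + K)) * (ennreal (N f) * ennreal (1 + K))"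
        unfolding eq by (intro mult_left_mono le) auto
      also have "ennreal (N f) * ennreal (1 + K) = ennreal (N f * (1 + K))"
        by (rule ennreal_mult[symmetric]) (use n pK(3) in auto)
      also have "ennreal (1 / (1 + K)) * ennreal (N f * (1 + K)) = ennreal (1 / (1 + K) * (N f * (1 + K)))"
        by (rule ennreal_mult[symmetric]) (use n pK(3) in auto)
      also have "1 / (1 + K) * (N f * (1 + K)) = N f" using pK(3) by (simp add: field_simps)
      finally show ?thesis .
    qed
  qed
  then show ?thesis using that[OF pK(1,2)] int by blast
qed

end

subsection \<open>Toeplitz operators\<close>

text \<open>Fix a nonzero coefficient. All but finitely many others are smaller in modulus, so the
  supremum is a maximum over a finite set.\<close>

lemma fourier_coeff_attains_max:
  assumes f: "integrable \<mu> f"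
  shows "\<exists>k. \<forall>n. cmod (fourier_coeff f n) \<le> cmod (fourier_coeff f k)"
proof (cases "\<forall>n. fourier_coeff f n = 0")
  case False
  then obtain n0 where n0: "0 < cmod (fourier_coeff f n0)" by auto
  obtain N where N: "\<And>n. N \<le> \<bar>n\<bar> \<Longrightarrow> cmod (fourier_coeff f n) < cmod (fourier_coeff f n0)"
    using fourier_coeff_tendsto_0[OF f n0] by blast
  let ?S = "insert n0 {- N..N}"
  define W where "W = (\<lambda>n. cmod (fourier_coeff f n)) ` ?S"
  have W: "finite W" "W \<noteq> {}" by (simp_all add: W_def)
  obtain k where k: "Max W = cmod (fourier_coeff f k)"
    using Max_in[OF W] unfolding W_def by blast
  have le: "cmod (fourier_coeff f n) \<le> cmod (fourier_coeff f k)" if "n \<in> ?S" for n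
    unfolding k[symmetric] by (rule Max_ge[OF W(1)]) (unfold W_def, rule image_eqI[OF refl that])
  have "cmod (fourier_coeff f n) \<le> cmod (fourier_coeff f k)" for n
  proof (cases "n \<in> {- N..N}")
    case False
    then have "N \<le> \<bar>n\<bar>" by auto
    then show ?thesis using N[of n] le[of n0] by simp
  qed (use le in auto)
  then show ?thesis by blast
qed auto

lemma fourier_coeff_powi: "fourier_coeff (\<lambda>t. t powi n) m = (if m = n then 1 else 0)"
proof -
  have "fourier_coeff (\<lambda>t. t powi n) m = fourier_coeff (\<lambda>t. 1 * t powi n) m" by simp
  also have "\<dots> = fourier_coeff (\<lambda>_. 1) (m - n)" by (rule fourier_coeff_shift)
  also have "\<dots> = cnj (\<integral>t. t powi (m - n) \<partial>\<mu>)"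
    unfolding fourier_coeff_eq mult_1 by (simp only: Bochner_Integration.integral_cnj)
  also have "\<dots> = (if m = n then 1 else 0)" unfolding integral_powi_circle by simp
  finally show ?thesis .
qed

text \<open>A unimodular function is equimeasurable with the constant 1, so every character has the
  norm of 1.\<close>

lemma (in ri_banach_function_space) powi_mem_hardy:
  assumes "0 \<le> n"
  shows "(\<lambda>t. c * t powi n) \<in> hardy X" "N (\<lambda>t. c * t powi n) = cmod c * N (\<lambda>_. 1)"
proof -
  have "equimeasurable (\<lambda>_. 1) (\<lambda>t. t powi n)"
    unfolding equimeasurable_def
    by (intro allI impI arg_cong[where f = "measure \<mu>"]) (auto simp: norm_powi_circle)
  then have *: "(\<lambda>t. t powi n) \<in> X \<and> N (\<lambda>_. 1) = N (\<lambda>t. t powi n)"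
    by (intro rearrangement_invariant const_mem) measurable
  then show "N (\<lambda>t. c * t powi n) = cmod c * N (\<lambda>_. 1)"
    using norm_scale[of "\<lambda>t. t powi n" c] by simp
  have "(\<lambda>t. c * t powi n) \<in> X" using * by (intro scale_mem) simp
  then show "(\<lambda>t. c * t powi n) \<in> hardy X"
    using assms by (simp add: hardy_def fourier_coeff_cmult fourier_coeff_powi)
qed

text \<open>Multiplication by a character shifts the coefficients of a, and the projection keeps
  those of index j \<ge> 0. The projection agrees with a function of known coefficients only a.e.;
  the measurability in \<open>T\<close> lets the integrals be compared.\<close>

lemma fourier_coeff_toeplitz_powi:
  fixes p :: real
  assumes a: "a \<in> L0" and ap: "integrable \<mu> (\<lambda>t. cmod (a t) powr p)" and p: "1 < p" "p < 2"
    and T: "toeplitz a (\<lambda>t. c * t powi n) \<in> L0" and j: "0 \<le> j"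
  shows "fourier_coeff (toeplitz a (\<lambda>t. c * t powi n)) j = c * fourier_coeff a (j - n)"
    "integrable \<mu> (toeplitz a (\<lambda>t. c * t powi n))"
proof -
  note [measurable] = a
  define f where "f t = a t * (c * t powi n)" for t
  have fm: "f \<in> L0" unfolding f_def by measurable
  have "integrable \<mu> (\<lambda>t. cmod c powr p * cmod (a t) powr p)" using ap by simp
  then have fp: "integrable \<mu> (\<lambda>t. cmod (f t) powr p)"
    by (rule Bochner_Integration.integrable_cong[THEN iffD1, rotated -1])
      (auto simp: f_def norm_mult norm_powi_circle powr_mult mult.commute)
  obtain G where G: "integrable \<mu> G"
    "\<And>n. fourier_coeff G n = (if 0 \<le> n then fourier_coeff f n else 0)"
    "AE t in \<mu>. riesz_projection f t = G t"
    using riesz_projection_eq[OF fm fp p] by blast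
  have Tf: "toeplitz a (\<lambda>t. c * t powi n) = riesz_projection f"
    by (simp add: toeplitz_def f_def[abs_def])
  have "fourier_coeff (riesz_projection f) j = fourier_coeff G j"
    by (rule fourier_coeff_cong_AE) (use T G in \<open>auto simp: Tf\<close>)
  also have "\<dots> = fourier_coeff f j" using G(2) j by simp
  also have "\<dots> = fourier_coeff (\<lambda>t. c * (a t * t powi n)) j" by (simp add: f_def[abs_def] mult_ac)
  also have "\<dots> = c * fourier_coeff a (j - n)"
    by (simp only: fourier_coeff_cmult fourier_coeff_shift)
  finally show "fourier_coeff (toeplitz a (\<lambda>t. c * t powi n)) j = c * fourier_coeff a (j - n)"
    unfolding Tf .
  show "integrable \<mu> (toeplitz a (\<lambda>t. c * t powi n))"
    unfolding Tf by (subst integrable_cong_AE[of _ _ G]) (use T G in \<open>auto simp: Tf\<close>)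
qed

lemma (in banach_function_space) toeplitz_powi_separation:
  fixes p :: real and n m :: nat
  assumes a: "a \<in> L0" and ap: "integrable \<mu> (\<lambda>t. cmod (a t) powr p)" and p: "1 < p" "p < 2"
    and M: "L1_inclusion_constant X N M"
    and Tn: "toeplitz a (\<lambda>t. c * t powi int n) \<in> X" and Tm: "toeplitz a (\<lambda>t. c * t powi int m) \<in> X"
    and k: "0 \<le> int n + k"
  shows "M * cmod c * cmod (fourier_coeff a k - fourier_coeff a (k + int n - int m)) \<le>
    N (\<lambda>t. toeplitz a (\<lambda>t. c * t powi int n) t - toeplitz a (\<lambda>t. c * t powi int m) t)"
proof -
  let ?f = "toeplitz a (\<lambda>t. c * t powi int n)" and ?g = "toeplitz a (\<lambda>t. c * t powi int m)"
  have fL: "?f \<in> L0" and gL: "?g \<in> L0" using Tn Tm sub_L0 by auto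
  note F = fourier_coeff_toeplitz_powi[OF a ap p fL k] and G = fourier_coeff_toeplitz_powi[OF a ap p gL k]
  have D: "integrable \<mu> (\<lambda>t. ?f t - ?g t)" using F(2) G(2) by (rule Bochner_Integration.integrable_diff)
  have Mp: "0 < M" using M by (simp add: L1_inclusion_constant_def)
  have "c * (fourier_coeff a k - fourier_coeff a (k + int n - int m)) = fourier_coeff (\<lambda>t. ?f t - ?g t) (int n + k)"
    unfolding fourier_coeff_diff[OF F(2) G(2)] F(1) G(1) by (simp add: right_diff_distrib algebra_simps)
  then have "cmod c * cmod (fourier_coeff a k - fourier_coeff a (k + int n - int m)) \<le> (\<integral>t. cmod (?f t - ?g t) \<partial>\<mu>)"
    using norm_fourier_coeff_le[OF D, of "int n + k"] by (simp flip: norm_mult)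
  then have "M * (cmod c * cmod (fourier_coeff a k - fourier_coeff a (k + int n - int m))) \<le> M * (\<integral>t. cmod (?f t - ?g t) \<partial>\<mu>)"
    using Mp by (intro mult_left_mono) auto
  also have "\<dots> \<le> N (\<lambda>t. ?f t - ?g t)"
  proof -
    have mem: "(\<lambda>t. ?f t - ?g t) \<in> X" by (rule diff_mem[OF Tn Tm])
    have "ennreal (M * (\<integral>t. cmod (?f t - ?g t) \<partial>\<mu>)) = ennreal M * (\<integral>\<^sup>+ t. ennreal (cmod (?f t - ?g t)) \<partial>\<mu>)"
      using D Mp by (subst nn_integral_eq_integral) (auto simp: ennreal_mult')
    also have "\<dots> \<le> ennreal (N (\<lambda>t. ?f t - ?g t))"
      using M mem by (auto simp: L1_inclusion_constant_def)
    finally show ?thesis using norm_nonneg[OF mem] by simp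
  qed
  finally show ?thesis by (simp only: mult.assoc)
qed

theorem theorem6p1:
  fixes X Y :: "(complex \<Rightarrow> complex) set"
    and NX NY :: "(complex \<Rightarrow> complex) \<Rightarrow> real"
    and a :: "complex \<Rightarrow> complex"
  assumes "ri_banach_function_space X NX"
    and "ri_banach_function_space Y NY"
    and "X \<subseteq> Y"
    and "nontrivial_boyd_indices Y NY"
    and "a \<in> multipliers X Y"
  shows "(\<exists>k. (\<forall>n. cmod (fourier_coeff a n) \<le> cmod (fourier_coeff a k)) \<and>
            (\<forall>mY. L1_inclusion_constant Y NY mY \<longrightarrow>
               op_noncompactness (hardy X) NX (hardy Y) NY (toeplitz a)
                 \<ge> ennreal (mY / NX (\<lambda>_. 1) * cmod (fourier_coeff a k)) \<and>
               (NX (\<lambda>_. 1) = 1 \<longrightarrow>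
                  op_noncompactness (hardy X) NX (hardy Y) NY (toeplitz a)
                    \<ge> ennreal (mY * cmod (fourier_coeff a k))))) \<and>
         (compact_operator (hardy X) NX (hardy Y) NY (toeplitz a) \<longleftrightarrow>
            (AE t in circle_measure. a t = 0))"
proof -
  interpret X: ri_banach_function_space X NX by fact
  interpret Y: ri_banach_function_space Y NY by fact
  have aL: "a \<in> L0" and aM: "\<And>g. g \<in> X \<Longrightarrow> (\<lambda>t. a t * g t) \<in> Y"
    using assms(5) by (auto simp: multipliers_def)
  note [measurable] = aL
  have aY: "a \<in> Y" using aM[OF X.const_mem[of 1]] by simp
  obtain p m where p: "1 < p" "p < 2" and m: "L1_inclusion_constant Y NY m"
    and Yp: "\<And>f. f \<in> Y \<Longrightarrow> integrable \<mu> (\<lambda>t. cmod (f t) powr p)"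
    using Y.integrable_powr_and_L1_inclusion[OF assms(4)] by blast
  note ap = Yp[OF aY]
  have ai: "integrable \<mu> a" by (rule integrable_of_powr[OF aL ap]) (use p in simp)
  \<comment> \<open>Normalises the characters to norm 1 in X; this is where the factor
    \<open>1 / NX (\<lambda>_. 1)\<close> enters the bound.\<close>
  define c :: complex where "c = of_real (1 / NX (\<lambda>_. 1))"
  have N1: "0 < NX (\<lambda>_. 1)" by (rule X.norm_one_pos)
  have c: "cmod c = 1 / NX (\<lambda>_. 1)" using N1 by (simp add: c_def norm_divide)
  define e where "e n = (\<lambda>t. c * t powi int n)" for n :: nat
  have eH: "e n \<in> hardy X" and eN: "NX (e n) = 1" for n
    unfolding e_def using X.powi_mem_hardy[of "int n" c] N1 c by auto
  \<comment> \<open>Formulated for an arbitrary infinite index set so that it serves twice: for the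
    indices falling into one member of a finite cover, and for the tail of a convergent
    subsequence.\<close>
  have sep: "M / NX (\<lambda>_. 1) * cmod (fourier_coeff a k) \<le> d"
    if M: "L1_inclusion_constant Y NY M" and I: "infinite I"
      and T: "\<And>n. n \<in> I \<Longrightarrow> toeplitz a (e n) \<in> hardy Y"
      and d: "\<And>n n'. n \<in> I \<Longrightarrow> n' \<in> I \<Longrightarrow> NY (\<lambda>t. toeplitz a (e n) t - toeplitz a (e n') t) \<le> d"
    for M k d and I :: "nat set"
  proof (rule field_le_epsilon)
    fix \<epsilon> :: real assume \<epsilon>: "0 < \<epsilon>"
    have Mp: "0 < M" using M by (simp add: L1_inclusion_constant_def)
    define w where "w = M / NX (\<lambda>_. 1)"
    have w: "0 < w" using Mp N1 by (simp add: w_def)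
    obtain L where L: "\<And>n. L \<le> \<bar>n\<bar> \<Longrightarrow> cmod (fourier_coeff a n) < \<epsilon> / w"
      using fourier_coeff_tendsto_0[OF ai, of "\<epsilon> / w"] \<epsilon> w by auto
    \<comment> \<open>The choice n > |k| makes the frequency n + k positive, so that it survives the
      projection. The choice of n' pushes the index k + n - n' below -|L|, where the coefficients of
      a are smaller than \<epsilon> / w.\<close>
    obtain n where n: "n \<in> I" "nat \<bar>k\<bar> < n" using I unfolding infinite_nat_iff_unbounded by blast
    obtain n' where n': "n' \<in> I" "n + nat \<bar>L\<bar> + nat \<bar>k\<bar> < n'" using I unfolding infinite_nat_iff_unbounded by blast
    have TY: "toeplitz a (e n) \<in> Y" "toeplitz a (e n') \<in> Y" using T n n' by (auto simp: hardy_def)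
    have "M * cmod c * cmod (fourier_coeff a k - fourier_coeff a (k + int n - int n')) \<le> d"
      using Y.toeplitz_powi_separation[OF aL ap p M, of c n n' k] TY n(2) d[OF n(1) n'(1)]
      unfolding e_def by linarith
    then have 1: "w * cmod (fourier_coeff a k - fourier_coeff a (k + int n - int n')) \<le> d"
      by (simp add: c w_def)
    have "cmod (fourier_coeff a (k + int n - int n')) < \<epsilon> / w" by (rule L) (use n'(2) in linarith)
    moreover have "cmod (fourier_coeff a k) \<le> cmod (fourier_coeff a k - fourier_coeff a (k + int n - int n')) + cmod (fourier_coeff a (k + int n - int n'))"
      using norm_triangle_ineq[of "fourier_coeff a k - fourier_coeff a (k + int n - int n')" "fourier_coeff a (k + int n - int n')"] by simp
    ultimately have "cmod (fourier_coeff a k) \<le> cmod (fourier_coeff a k - fourier_coeff a (k + int n - int n')) + \<epsilon> / w" by linarith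
    then have "w * cmod (fourier_coeff a k) \<le> w * (cmod (fourier_coeff a k - fourier_coeff a (k + int n - int n')) + \<epsilon> / w)"
      using w by (intro mult_left_mono) auto
    also have "\<dots> \<le> d + \<epsilon>" using 1 w by (simp add: distrib_left)
    finally show "M / NX (\<lambda>_. 1) * cmod (fourier_coeff a k) \<le> d + \<epsilon>" by (simp add: w_def)
  qed
  \<comment> \<open>The members of a cover lie in \<open>hardy Y\<close>, so the boundedness of the Riesz projection on \<open>Y\<close> is not
    needed: if \<open>toeplitz a\<close> leaves \<open>hardy Y\<close> then there is no cover and the measure of noncompactness is \<open>\<infinity>\<close>.\<close>
  have bound: "ennreal (M / NX (\<lambda>_. 1) * cmod (fourier_coeff a k)) \<le> op_noncompactness (hardy X) NX (hardy Y) NY (toeplitz a)"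
    if M: "L1_inclusion_constant Y NY M" for M k
    unfolding op_noncompactness_def noncompactness_def
  proof (rule Inf_greatest, clarify)
    fix \<delta> :: real and \<B> assume \<delta>: "0 < \<delta>" and fin: "finite \<B>"
      and cover: "toeplitz a ` {f \<in> hardy X. NX f \<le> 1} \<subseteq> \<Union> \<B>"
      and small: "\<forall>B\<in>\<B>. B \<subseteq> hardy Y \<and> (\<forall>f\<in>B. \<forall>g\<in>B. NY (\<lambda>t. f t - g t) \<le> \<delta>)"
    have ex: "\<forall>n. \<exists>B\<in>\<B>. toeplitz a (e n) \<in> B"
    proof
      fix n
      have "toeplitz a (e n) \<in> toeplitz a ` {f \<in> hardy X. NX f \<le> 1}" using eH eN by auto
      then show "\<exists>B\<in>\<B>. toeplitz a (e n) \<in> B" using cover by blast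
    qed
    have "(UNIV :: nat set) = (\<Union>B\<in>\<B>. {n. toeplitz a (e n) \<in> B})" using ex by auto
    then have "\<exists>B\<in>\<B>. infinite {n. toeplitz a (e n) \<in> B}"
      using fin infinite_UNIV_nat by (metis (no_types, lifting) finite_UN)
    then obtain B where B: "B \<in> \<B>" "infinite {n. toeplitz a (e n) \<in> B}" by blast
    have "M / NX (\<lambda>_. 1) * cmod (fourier_coeff a k) \<le> \<delta>"
      by (rule sep[OF M B(2)]) (use small B(1) in auto)
    then show "ennreal (M / NX (\<lambda>_. 1) * cmod (fourier_coeff a k)) \<le> ennreal \<delta>" by (rule ennreal_leI)
  qed
  have compact_imp: "AE t in \<mu>. a t = 0"
    if comp: "compact_operator (hardy X) NX (hardy Y) NY (toeplitz a)"
  proof (rule fourier_coeff_zero_AE[OF ai])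
    fix k
    have T: "toeplitz a (e n) \<in> hardy Y" for n using comp eH by (auto simp: compact_operator_def)
    have "(\<forall>n. e n \<in> hardy X) \<and> (\<exists>C. \<forall>n. NX (e n) \<le> C)" using eH eN by auto
    then obtain r g where r: "strict_mono r" "g \<in> hardy Y" "(\<lambda>n. NY (\<lambda>t. toeplitz a (e (r n)) t - g t)) \<longlonglongrightarrow> 0"
      using comp unfolding compact_operator_def by blast
    \<comment> \<open>The images along a tail of the convergent subsequence are within \<epsilon> of
      each other, and the tail still has infinitely many indices because r is strictly increasing.
      So the separation bound holds with d = \<epsilon> for every \<epsilon>.\<close>
    have "m / NX (\<lambda>_. 1) * cmod (fourier_coeff a k) \<le> 0"
    proof (rule field_le_epsilon)
      fix \<epsilon> :: real assume "0 < \<epsilon>"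
      then have "\<forall>\<^sub>F n in sequentially. NY (\<lambda>t. toeplitz a (e (r n)) t - g t) < \<epsilon> / 2"
        by (intro order_tendstoD(2)[OF r(3)]) simp
      then obtain n0 where n0: "\<And>n. n0 \<le> n \<Longrightarrow> NY (\<lambda>t. toeplitz a (e (r n)) t - g t) < \<epsilon> / 2"
        by (auto simp: eventually_sequentially)
      have "infinite (r ` {n0..})"
        using r(1) by (subst finite_image_iff) (auto intro: strict_mono_imp_inj_on inj_on_subset simp: infinite_Ici)
      then have "m / NX (\<lambda>_. 1) * cmod (fourier_coeff a k) \<le> \<epsilon>"
      proof (rule sep[OF m])
        fix n n' assume "n \<in> r ` {n0..}" "n' \<in> r ` {n0..}"
        then have "NY (\<lambda>t. toeplitz a (e n) t - g t) < \<epsilon> / 2" "NY (\<lambda>t. toeplitz a (e n') t - g t) < \<epsilon> / 2"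
          using n0 by auto
        moreover have "NY (\<lambda>t. toeplitz a (e n) t - toeplitz a (e n') t) \<le>
            NY (\<lambda>t. toeplitz a (e n) t - g t) + NY (\<lambda>t. toeplitz a (e n') t - g t)"
          by (rule Y.norm_diff_triangle) (use T r(2) in \<open>auto simp: hardy_def\<close>)
        ultimately show "NY (\<lambda>t. toeplitz a (e n) t - toeplitz a (e n') t) \<le> \<epsilon>" by linarith
      qed (rule T)
      then show "m / NX (\<lambda>_. 1) * cmod (fourier_coeff a k) \<le> 0 + \<epsilon>" by simp
    qed
    moreover have "0 < m / NX (\<lambda>_. 1)" using m N1 by (simp add: L1_inclusion_constant_def)
    ultimately have "cmod (fourier_coeff a k) \<le> 0" by (metis mult_le_cancel_left_pos mult_zero_right)
    then show "fourier_coeff a k = 0" by simp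
  qed
  have zero_imp: "compact_operator (hardy X) NX (hardy Y) NY (toeplitz a)"
    if a0: "AE t in \<mu>. a t = 0"
  proof -
    have T: "toeplitz a f \<in> hardy Y \<and> NY (\<lambda>t. toeplitz a f t - 0) = 0" if f: "f \<in> hardy X" for f
    proof -
      have fX: "f \<in> X" using f by (simp add: hardy_def)
      have af: "AE t in \<mu>. a t * f t = 0" using a0 by eventually_elim simp
      \<comment> \<open>Integrals ignore null sets, so although a vanishes only a.e., the conjugate
        Poisson integral is 0 at every point. Hence \<open>toeplitz a f\<close> is exactly half of a
        f, a function in Y that vanishes a.e.\<close>
      have "conjugate_poisson (\<lambda>t. a t * f t) r t = 0" for r t
        unfolding conjugate_poisson_def by (rule integral_eq_zero_AE) (use af in eventually_elim, simp)
      then have "conjugate_function (\<lambda>t. a t * f t) t = 0" for t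
        unfolding conjugate_function_def by (simp add: tendsto_Lim)
      moreover have "fourier_coeff (\<lambda>t. a t * f t) 0 = 0"
        unfolding fourier_coeff_eq by (rule integral_eq_zero_AE) (use af in eventually_elim, simp)
      ultimately have Tf: "toeplitz a f = (\<lambda>t. (1/2) * (a t * f t))"
        by (intro ext) (simp add: toeplitz_def riesz_projection_def)
      have Y: "toeplitz a f \<in> Y" unfolding Tf by (rule Y.scale_mem[OF aM[OF fX]])
      have AE0: "AE t in \<mu>. toeplitz a f t = 0" using af unfolding Tf by eventually_elim simp
      have "fourier_coeff (toeplitz a f) n = 0" for n
        unfolding fourier_coeff_eq by (rule integral_eq_zero_AE) (use AE0 in eventually_elim, simp)
      then show ?thesis using Y AE0 Y.norm_eq_0[OF Y] by (simp add: hardy_def)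
    qed
    have z: "(\<lambda>_. 0) \<in> hardy Y" using Y.const_mem[of 0] by (simp add: hardy_def fourier_coeff_eq)
    show ?thesis
      unfolding compact_operator_def
    proof (intro conjI allI impI)
      show "toeplitz a ` hardy X \<subseteq> hardy Y" using T by auto
      fix f :: "nat \<Rightarrow> complex \<Rightarrow> complex" assume "(\<forall>n. f n \<in> hardy X) \<and> (\<exists>C. \<forall>n. NX (f n) \<le> C)"
      then have "\<And>n. NY (\<lambda>t. toeplitz a (f (id n)) t - 0) = 0" using T by simp
      then show "\<exists>r g. strict_mono r \<and> g \<in> hardy Y \<and> (\<lambda>n. NY (\<lambda>t. toeplitz a (f (r n)) t - g t)) \<longlonglongrightarrow> 0"
        using z by (intro exI[of _ id] exI[of _ "\<lambda>_. 0"]) (simp add: strict_mono_id)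
    qed
  qed
  obtain k where k: "\<forall>n. cmod (fourier_coeff a n) \<le> cmod (fourier_coeff a k)"
    using fourier_coeff_attains_max[OF ai] by blast
  show ?thesis
  proof (intro conjI exI[of _ k] allI impI)
    show "cmod (fourier_coeff a n) \<le> cmod (fourier_coeff a k)" for n using k by blast
    show "ennreal (M / NX (\<lambda>_. 1) * cmod (fourier_coeff a k)) \<le> op_noncompactness (hardy X) NX (hardy Y) NY (toeplitz a)"
      if "L1_inclusion_constant Y NY M" for M by (rule bound[OF that])
    show "ennreal (M * cmod (fourier_coeff a k)) \<le> op_noncompactness (hardy X) NX (hardy Y) NY (toeplitz a)"
      if "L1_inclusion_constant Y NY M" "NX (\<lambda>_. 1) = 1" for M
      using bound[OF that(1), of k] that(2) by simp
    show "compact_operator (hardy X) NX (hardy Y) NY (toeplitz a) \<longleftrightarrow> (AE t in \<mu>. a t = 0)"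
      using compact_imp zero_imp by blast
  qed
qed

end
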